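(* Let $G$ and $\Gamma$ be countably infinite sofic groups at least one of which is not locally finite, and let $H$ be a countable group. Let $G\times\Gamma\curvearrowright (X,\mu)$ and $H\curvearrowright (Y,\nu)$ be free p.m.p. actions which are boundedly orbit equivalent. Suppose that the action $H\curvearrowright (Y,\nu)$ is uniquely ergodic. Then $$h_\nu (H\curvearrowright Y)\ \ge\ \underline{h}_\mu (G\times\Gamma\curvearrowright X),$$ where $h_\nu$ denotes maximum sofic measure entropy and $\underline{h}_\mu$ denotes infimum sofic measure entropy.
   Context: All groups are countable and discrete. A group is locally finite if each of its finitely generated subgroups is finite. P.m.p. actions. A p.m.p. action $G\curvearrowright (X,\mu)$ is an action by measure-preserving transformations on a standard probability space (a standard Borel space with a probability measure). It is free if the set of $x\in X$ with $sx\neq x$ for all $s\in G\setminus\{e_G\}$ has measure one. It is uniquely ergodic if there is a unique state (mean, i.e. unital positive linear functional) on $L^\infty(X,\mu)$ invariant under the $G$-action $(gf)(x)=f(g^{-1}x)$. Partitions are Borel. Bounded orbit equivalence. Two free p.m.p. actions $G\curvearrowright (X,\mu)$ and $H\curvearrowright (Y,\nu)$ are orbit equivalent if there are a $G$-invariant conull set $X_0\subseteq X$, an $H$-invariant conull set $Y_0\subseteq Y$, and a measure isomorphism $\Psi:X_0\to Y_0$ with $\Psi(Gx)=H\Psi(x)$ for all $x\in X_0$. Associated to $\Psi$ are cocycles $\kappa:G\times X_0\to H$ and $\lambda:H\times Y_0\to G$, determined up to null sets by $\Psi(gx)=\kappa(g,x)\Psi(x)$ and $\Psi^{-1}(ty)=\lambda(t,y)\Psi^{-1}(y)$.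 The actions are boundedly orbit equivalent if $X_0,Y_0,\Psi$ can be chosen so that $\kappa(g,X_0)$ is finite for every $g\in G$ and $\lambda(t,Y_0)$ is finite for every $t\in H$. Sofic approximations. For a nonempty finite set $V$, $\mathrm{Sym}(V)$ is its permutation group, $\mathbb{P}_V$ is the algebra of all subsets of $V$, $\mathrm{m}$ is the uniform probability measure on $V$, and $\rho_{\mathrm{Hamm}}(T,S)=|\{v\in V:Tv\ne Sv\}|/|V|$ for $T,S\in V^V$. A sofic approximation for $G$ is a (not necessarily multiplicative) map $\sigma:G\to\mathrm{Sym}(V)$ for some nonempty finite set $V$. It is an $(F,\delta)$-approximation ($F\subseteq G$ finite, $\delta>0$) if $\rho_{\mathrm{Hamm}}(\sigma_{st},\sigma_s\sigma_t)\le\delta$ for all $s,t\in F$ and $\rho_{\mathrm{Hamm}}(\sigma_s,\sigma_t)\ge 1-\delta$ for all distinct $s,t\in F$. A sofic approximation sequence for $G$ is a sequence $\Sigma=\{\sigma_k:G\to\mathrm{Sym}(V_k)\}_{k=1}^\infty$ such that for every finite $F\subseteq G$ and $\delta>0$, $\sigma_k$ is an $(F,\delta)$-approximation for all sufficiently large $k$. $G$ is sofic if it admits a sofic approximation sequence. Sofic measure entropy. Let $G\curvearrowright (X,\mu)$ be a p.m.p. action, $\mathscr{C}$ a finite partition of $X$, $F\subseteq G$ finite with $e_G\in F$, $\delta>0$, and $\sigma:G\to\mathrm{Sym}(V)$ a sofic approximation. Let $\mathrm{alg}(\cdot)$ denote the (finite) algebra of sets generated by a partition and $\mathscr{C}_F=\bigvee_{s\in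 F}s\mathscr{C}$. Let $\mathrm{Hom}_\mu(\mathscr{C},F,\delta,\sigma)$ be the set of all (Boolean algebra) homomorphisms $\varphi:\mathrm{alg}(\mathscr{C}_F)\to\mathbb{P}_V$ with $\sum_{A\in\mathscr{C}}\mathrm{m}(\sigma_g\varphi(A)\,\Delta\,\varphi(gA))<\delta$ for all $g\in F$ and $\sum_{A\in\mathscr{C}_F}|\mathrm{m}(\varphi(A))-\mu(A)|<\delta$. For a partition $\mathscr{P}\le\mathscr{C}$ (i.e. $\mathscr{C}$ refines $\mathscr{P}$), $|\mathrm{Hom}_\mu(\mathscr{C},F,\delta,\sigma)|_{\mathscr{P}}$ is the number of distinct restrictions of its elements to $\mathscr{P}$. Then $$h_{\Sigma,\mu}(G\curvearrowright X)=\sup_{\mathscr{P}}\inf_{\mathscr{C}\ge\mathscr{P}}\inf_F\inf_{\delta>0}\limsup_{k\to\infty}\frac{1}{|V_k|}\log|\mathrm{Hom}_\mu(\mathscr{C},F,\delta,\sigma_k)|_{\mathscr{P}},$$ with $\mathscr{P},\mathscr{C}$ ranging over finite partitions, $F$ over finite subsets of $G$ containing $e_G$, and $\log 0=-\infty$. The maximum and infimum sofic measure entropies are $h_\mu(G\curvearrowright X)=\max_\Sigma h_{\Sigma,\mu}(G\curvearrowright X)$ (the maximum exists) and $\underline{h}_\mu(G\curvearrowright X)=\inf_\Sigma h_{\Sigma,\mu}(G\curvearrowright X)$, over all sofic approximation sequences $\Sigma$ for $G$; both are $-\infty$ by convention if $G$ is not sofic. *)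

theory Defs
  imports
    "HOL-Probability.Probability"
    "HOL-Combinatorics.Permutations"
    "HOL-Algebra.Group_Action"
    "HOL-Algebra.Generated_Groups"
begin

definition locally_finite_group :: "('g, 'm) monoid_scheme \<Rightarrow> bool" where
  "locally_finite_group G \<longleftrightarrow>
     (\<forall>S. S \<subseteq> carrier G \<and> finite S \<longrightarrow> finite (generate G S))"


section \<open>Probability-measure-preserving actions\<close>

definition standard_borel :: "'x measure \<Rightarrow> bool" where
  "standard_borel M \<longleftrightarrow>
     (\<exists>T. completely_metrizable_space T \<and> second_countable T \<and> topspace T = space M \<and>
          sets M = sigma_sets (space M) {U. openin T U})"

locale pmp_action = group_action G "space M" \<alpha> + prob_space M
  for G :: "('g, 'm) monoid_scheme" (structure) and M :: "'x measure" and \<alpha> :: "'g \<Rightarrow> 'x \<Rightarrow> 'x" +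
  assumes standard_borel: "standard_borel M"
    and action_measurable: "g \<in> carrier G \<Longrightarrow> \<alpha> g \<in> measurable M M"
    and action_preserves: "g \<in> carrier G \<Longrightarrow> distr M M (\<alpha> g) = M"

locale free_pmp_action = pmp_action +
  assumes free: "AE x in M. \<forall>g \<in> carrier G - {\<one>}. \<alpha> g x \<noteq> x"

text \<open>
  The space \<open>L\<^sup>\<infinity>\<close> is handled through representatives: a functional on it is a functional
  on essentially bounded measurable functions that takes equal values on functions which agree
  almost everywhere.
\<close>

definition Linfty :: "'x measure \<Rightarrow> ('x \<Rightarrow> complex) set" where
  "Linfty M = {f \<in> borel_measurable M. \<exists>C. AE x in M. norm (f x) \<le> C}"

definition Linfty_state :: "'x measure \<Rightarrow> (('x \<Rightarrow> complex) \<Rightarrow> complex) \<Rightarrow> bool" where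
  "Linfty_state M m \<longleftrightarrow>
     (\<forall>f \<in> Linfty M. \<forall>g \<in> Linfty M. (AE x in M. f x = g x) \<longrightarrow> m f = m g) \<and>
     (\<forall>f \<in> Linfty M. \<forall>g \<in> Linfty M. m (\<lambda>x. f x + g x) = m f + m g) \<and>
     (\<forall>c. \<forall>f \<in> Linfty M. m (\<lambda>x. c * f x) = c * m f) \<and>
     (\<forall>f \<in> Linfty M. (AE x in M. f x \<in> \<real>\<^sub>\<ge>\<^sub>0) \<longrightarrow> m f \<in> \<real>\<^sub>\<ge>\<^sub>0) \<and>
     m (\<lambda>_. 1) = 1"

definition invariant_state ::
    "('g, 'm) monoid_scheme \<Rightarrow> 'x measure \<Rightarrow> ('g \<Rightarrow> 'x \<Rightarrow> 'x) \<Rightarrow> (('x \<Rightarrow> complex) \<Rightarrow> complex) \<Rightarrow> bool" where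
  "invariant_state G M \<alpha> m \<longleftrightarrow>
     Linfty_state M m \<and>
     (\<forall>g \<in> carrier G. \<forall>f \<in> Linfty M. m (\<lambda>x. f (\<alpha> (inv\<^bsub>G\<^esub> g) x)) = m f)"

text \<open>Extensionality makes uniqueness refer only to the values on \<open>L\<^sup>\<infinity>\<close>.\<close>

definition uniquely_ergodic ::
    "('g, 'm) monoid_scheme \<Rightarrow> 'x measure \<Rightarrow> ('g \<Rightarrow> 'x \<Rightarrow> 'x) \<Rightarrow> bool" where
  "uniquely_ergodic G M \<alpha> \<longleftrightarrow> (\<exists>!m. m \<in> extensional (Linfty M) \<and> invariant_state G M \<alpha> m)"


section \<open>Bounded orbit equivalence\<close>

definition invariant_conull ::
    "('g, 'm) monoid_scheme \<Rightarrow> 'x measure \<Rightarrow> ('g \<Rightarrow> 'x \<Rightarrow> 'x) \<Rightarrow> 'x set \<Rightarrow> bool" where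
  "invariant_conull G M \<alpha> X0 \<longleftrightarrow>
     X0 \<in> sets M \<and> emeasure M (space M - X0) = 0 \<and> (\<forall>g \<in> carrier G. \<alpha> g ` X0 \<subseteq> X0)"

definition measure_isomorphism ::
    "'x measure \<Rightarrow> 'x set \<Rightarrow> 'y measure \<Rightarrow> 'y set \<Rightarrow> ('x \<Rightarrow> 'y) \<Rightarrow> bool" where
  "measure_isomorphism M X0 N Y0 \<Psi> \<longleftrightarrow>
     bij_betw \<Psi> X0 Y0 \<and>
     \<Psi> \<in> measurable (restrict_space M X0) (restrict_space N Y0) \<and>
     the_inv_into X0 \<Psi> \<in> measurable (restrict_space N Y0) (restrict_space M X0) \<and>
     distr (restrict_space M X0) (restrict_space N Y0) \<Psi> = restrict_space N Y0"

definition orbit_equivalence ::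
    "('g, 'm) monoid_scheme \<Rightarrow> 'x measure \<Rightarrow> ('g \<Rightarrow> 'x \<Rightarrow> 'x) \<Rightarrow>
     ('h, 'n) monoid_scheme \<Rightarrow> 'y measure \<Rightarrow> ('h \<Rightarrow> 'y \<Rightarrow> 'y) \<Rightarrow>
     'x set \<Rightarrow> 'y set \<Rightarrow> ('x \<Rightarrow> 'y) \<Rightarrow> bool" where
  "orbit_equivalence G M \<alpha> H N \<beta> X0 Y0 \<Psi> \<longleftrightarrow>
     invariant_conull G M \<alpha> X0 \<and> invariant_conull H N \<beta> Y0 \<and>
     measure_isomorphism M X0 N Y0 \<Psi> \<and>
     (\<forall>x \<in> X0. \<Psi> ` orbit G \<alpha> x = orbit H \<beta> (\<Psi> x))"

text \<open>
  \<open>\<kappa>\<close> is a cocycle of \<open>\<Psi>\<close> on \<open>X0\<close>. The defining equation determines \<open>\<kappa> g x\<close> at every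
  \<open>x\<close> for which \<open>\<Psi> x\<close> has trivial stabilizer, hence almost everywhere for free actions.
\<close>

definition orbit_cocycle ::
    "('g, 'm) monoid_scheme \<Rightarrow> ('g \<Rightarrow> 'x \<Rightarrow> 'x) \<Rightarrow> ('h, 'n) monoid_scheme \<Rightarrow> ('h \<Rightarrow> 'y \<Rightarrow> 'y) \<Rightarrow>
     'x set \<Rightarrow> ('x \<Rightarrow> 'y) \<Rightarrow> ('g \<Rightarrow> 'x \<Rightarrow> 'h) \<Rightarrow> bool" where
  "orbit_cocycle G \<alpha> H \<beta> X0 \<Psi> \<kappa> \<longleftrightarrow>
     (\<forall>g \<in> carrier G. \<forall>x \<in> X0. \<kappa> g x \<in> carrier H \<and> \<Psi> (\<alpha> g x) = \<beta> (\<kappa> g x) (\<Psi> x))"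

definition boundedly_orbit_equivalent ::
    "('g, 'm) monoid_scheme \<Rightarrow> 'x measure \<Rightarrow> ('g \<Rightarrow> 'x \<Rightarrow> 'x) \<Rightarrow>
     ('h, 'n) monoid_scheme \<Rightarrow> 'y measure \<Rightarrow> ('h \<Rightarrow> 'y \<Rightarrow> 'y) \<Rightarrow> bool" where
  "boundedly_orbit_equivalent G M \<alpha> H N \<beta> \<longleftrightarrow>
     (\<exists>X0 Y0 \<Psi> \<kappa> \<theta>.
        orbit_equivalence G M \<alpha> H N \<beta> X0 Y0 \<Psi> \<and>
        orbit_cocycle G \<alpha> H \<beta> X0 \<Psi> \<kappa> \<and>
        orbit_cocycle H \<beta> G \<alpha> Y0 (the_inv_into X0 \<Psi>) \<theta> \<and>
        (\<forall>g \<in> carrier G. finite (\<kappa> g ` X0)) \<and>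
        (\<forall>t \<in> carrier H. finite (\<theta> t ` Y0)))"


section \<open>Sofic approximations\<close>

definition unif :: "'v set \<Rightarrow> 'v set \<Rightarrow> real" where
  "unif V A = real (card A) / real (card V)"

definition hamming :: "'v set \<Rightarrow> ('v \<Rightarrow> 'v) \<Rightarrow> ('v \<Rightarrow> 'v) \<Rightarrow> real" where
  "hamming V T S = real (card {v \<in> V. T v \<noteq> S v}) / real (card V)"

definition sofic_approximation ::
    "('g, 'm) monoid_scheme \<Rightarrow> 'v set \<Rightarrow> ('g \<Rightarrow> 'v \<Rightarrow> 'v) \<Rightarrow> bool" where
  "sofic_approximation G V \<sigma> \<longleftrightarrow>
     finite V \<and> V \<noteq> {} \<and> (\<forall>s \<in> carrier G. \<sigma> s permutes V)"

definition good_approximation ::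
    "('g, 'm) monoid_scheme \<Rightarrow> 'g set \<Rightarrow> real \<Rightarrow> 'v set \<Rightarrow> ('g \<Rightarrow> 'v \<Rightarrow> 'v) \<Rightarrow> bool" where
  "good_approximation G F \<delta> V \<sigma> \<longleftrightarrow>
     (\<forall>s \<in> F. \<forall>t \<in> F. hamming V (\<sigma> (s \<otimes>\<^bsub>G\<^esub> t)) (\<sigma> s \<circ> \<sigma> t) \<le> \<delta>) \<and>
     (\<forall>s \<in> F. \<forall>t \<in> F. s \<noteq> t \<longrightarrow> hamming V (\<sigma> s) (\<sigma> t) \<ge> 1 - \<delta>)"

text \<open>
  The finite sets \<open>V k\<close> are taken inside the natural numbers. Every notion below is invariant
  under relabelling of \<open>V k\<close>, so this does not affect suprema and infima over all sequences.
\<close>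

definition sofic_approximation_sequence ::
    "('g, 'm) monoid_scheme \<Rightarrow> (nat \<Rightarrow> nat set) \<Rightarrow> (nat \<Rightarrow> 'g \<Rightarrow> nat \<Rightarrow> nat) \<Rightarrow> bool" where
  "sofic_approximation_sequence G V \<sigma> \<longleftrightarrow>
     (\<forall>k. sofic_approximation G (V k) (\<sigma> k)) \<and>
     (\<forall>F \<delta>. finite F \<and> F \<subseteq> carrier G \<and> \<delta> > 0 \<longrightarrow>
        (\<forall>\<^sub>F k in sequentially. good_approximation G F \<delta> (V k) (\<sigma> k)))"

definition sofic_group :: "('g, 'm) monoid_scheme \<Rightarrow> bool" where
  "sofic_group G \<longleftrightarrow> (\<exists>V \<sigma>. sofic_approximation_sequence G V \<sigma>)"


section \<open>Sofic measure entropy\<close>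

definition finite_partition :: "'x measure \<Rightarrow> 'x set set \<Rightarrow> bool" where
  "finite_partition M C \<longleftrightarrow> finite C \<and> C \<subseteq> sets M \<and> partition_on (space M) C"

definition generated_algebra :: "'x set \<Rightarrow> 'x set set \<Rightarrow> 'x set set" where
  "generated_algebra \<Omega> C = \<Inter> {\<A>. Sigma_Algebra.algebra \<Omega> \<A> \<and> C \<subseteq> \<A>}"

definition translated_join :: "('g \<Rightarrow> 'x \<Rightarrow> 'x) \<Rightarrow> 'g set \<Rightarrow> 'x set set \<Rightarrow> 'x set set" where
  "translated_join \<alpha> F C = common_refinement ((\<lambda>s. (\<lambda>A. \<alpha> s ` A) ` C) ` F)"

definition boolean_homs :: "'x set \<Rightarrow> 'x set set \<Rightarrow> 'v set \<Rightarrow> ('x set \<Rightarrow> 'v set) set" where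
  "boolean_homs \<Omega> \<A> V =
     {\<phi> \<in> \<A> \<rightarrow>\<^sub>E Pow V.
        \<phi> {} = {} \<and> \<phi> \<Omega> = V \<and>
        (\<forall>A \<in> \<A>. \<phi> (\<Omega> - A) = V - \<phi> A) \<and>
        (\<forall>A \<in> \<A>. \<forall>B \<in> \<A>. \<phi> (A \<union> B) = \<phi> A \<union> \<phi> B \<and> \<phi> (A \<inter> B) = \<phi> A \<inter> \<phi> B)}"

definition sofic_homs ::
    "'x measure \<Rightarrow> ('g \<Rightarrow> 'x \<Rightarrow> 'x) \<Rightarrow> 'x set set \<Rightarrow> 'g set \<Rightarrow> real \<Rightarrow>
     'v set \<Rightarrow> ('g \<Rightarrow> 'v \<Rightarrow> 'v) \<Rightarrow> ('x set \<Rightarrow> 'v set) set" where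
  "sofic_homs M \<alpha> C F \<delta> V \<sigma> =
     {\<phi> \<in> boolean_homs (space M) (generated_algebra (space M) (translated_join \<alpha> F C)) V.
        (\<forall>g \<in> F. (\<Sum>A\<in>C. unif V (sym_diff (\<sigma> g ` \<phi> A) (\<phi> (\<alpha> g ` A)))) < \<delta>) \<and>
        (\<Sum>A\<in>translated_join \<alpha> F C. \<bar>unif V (\<phi> A) - measure M A\<bar>) < \<delta>}"

definition count_on :: "'x set set \<Rightarrow> ('x set \<Rightarrow> 'v set) set \<Rightarrow> nat" where
  "count_on P \<Phi> = card ((\<lambda>\<phi>. restrict \<phi> P) ` \<Phi>)"

definition log_count :: "nat \<Rightarrow> ereal" where
  "log_count n = (if n = 0 then -\<infinity> else ereal (ln (real n)))"

definition sofic_entropy ::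
    "('g, 'm) monoid_scheme \<Rightarrow> 'x measure \<Rightarrow> ('g \<Rightarrow> 'x \<Rightarrow> 'x) \<Rightarrow>
     (nat \<Rightarrow> nat set) \<Rightarrow> (nat \<Rightarrow> 'g \<Rightarrow> nat \<Rightarrow> nat) \<Rightarrow> ereal" where
  "sofic_entropy G M \<alpha> V \<sigma> =
     (SUP P \<in> {P. finite_partition M P}.
      INF C \<in> {C. finite_partition M C \<and> refines (space M) C P}.
      INF F \<in> {F. finite F \<and> F \<subseteq> carrier G \<and> \<one>\<^bsub>G\<^esub> \<in> F}.
      INF \<delta> \<in> {0<..}.
        limsup (\<lambda>k. ereal (1 / real (card (V k))) *
                     log_count (count_on P (sofic_homs M \<alpha> C F \<delta> (V k) (\<sigma> k)))))"

text \<open>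
  The supremum over all sofic approximation sequences is attained, which is why it is called the
  maximum sofic entropy.
\<close>

definition max_sofic_entropy ::
    "('g, 'm) monoid_scheme \<Rightarrow> 'x measure \<Rightarrow> ('g \<Rightarrow> 'x \<Rightarrow> 'x) \<Rightarrow> ereal" where
  "max_sofic_entropy G M \<alpha> =
     (if sofic_group G
      then SUP (V, \<sigma>) \<in> {(V, \<sigma>). sofic_approximation_sequence G V \<sigma>}. sofic_entropy G M \<alpha> V \<sigma>
      else -\<infinity>)"

definition inf_sofic_entropy ::
    "('g, 'm) monoid_scheme \<Rightarrow> 'x measure \<Rightarrow> ('g \<Rightarrow> 'x \<Rightarrow> 'x) \<Rightarrow> ereal" where
  "inf_sofic_entropy G M \<alpha> =
     (if sofic_group G
      then INF (V, \<sigma>) \<in> {(V, \<sigma>). sofic_approximation_sequence G V \<sigma>}. sofic_entropy G M \<alpha> V \<sigma>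
      else -\<infinity>)"

end

theory Submission
  imports Defs
begin

text \<open>
  Take the product of sofic approximations \<open>V\<close> of \<open>G\<close> and \<open>W\<close> of \<open>\<Gamma>\<close>. A microstate
  \<open>x\<close> on \<open>V \<times> W\<close> for the action of \<open>G \<times> \<Gamma>\<close> turns, through the cocycle of the orbit equivalence, into an
  approximate action of \<open>H\<close> on \<open>V \<times> W\<close> together with a microstate for the action of \<open>H\<close>, but this
  action depends on \<open>x\<close>. Two infinite factors, one of them containing an infinite finitely
  generated subgroup, make the approximation connected by a very sparse set of edges. Prescribing
  the cocycle on these edges costs little entropy (boundedness) and determines the action of \<open>H\<close>
  up to a permutation of \<open>V \<times> W\<close>. So, up to such permutations, exponentially many \<open>x\<close> yield
  microstates for one and the same sofic approximation of \<open>H\<close>, and \<open>x\<close> can be recovered from the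
  permuted microstate up to a small Hamming error.
\<close>

section \<open>Finite combinatorics\<close>

text \<open>In the definition of entropy the observing partition is chosen before the finite subset
  of \<open>H\<close>, the test sets and the tolerance. Hence whatever is needed to recover
  \<open>x\<close> must be fixed at that stage: the displacements \<open>S\<close> to the base
  points, and with them the density of the sparse set \<open>B\<close> of base points. So
  \<open>B\<close> can pay only for edges known in advance, those of a fixed finite set
  \<open>S0\<close>. Edges that depend on the later tests are paid for by sparser sets chosen later:
  \<open>B'\<close> inside \<open>B\<close> for long edges in the direction of the first factor,
  then \<open>A\<close> for long edges in the direction of the second. No circle arises, because
  \<open>A\<close> is reached along words in \<open>S0\<close>, whose length costs nothing. Such
  words can reach a set of arbitrarily small density only if \<open>S0\<close> generates an infinite
  group; this is the role of the factor that is not locally finite. The infinite second factor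
  supplies \<open>B\<close> and \<open>B'\<close>. An infimum is compared with a maximum because
  both the product approximation and the approximation of \<open>H\<close> extracted from it are
  special ones.\<close>

lemma extend_to_permutation:
  assumes "finite U" "A \<subseteq> U" "inj_on f A" "f ` A \<subseteq> U"
  obtains p where "p permutes U" "\<And>a. a \<in> A \<Longrightarrow> p a = f a"
proof -
  have "card (U - A) = card (U - f ` A)"
    using assms by (simp add: card_Diff_subset finite_subset card_image)
  then obtain h where h: "bij_betw h (U - A) (U - f ` A)"
    using assms(1) by (metis finite_Diff finite_same_card_bij)
  define p where "p u = (if u \<in> A then f u else if u \<in> U then h u else u)" for u
  have "bij_betw p A (f ` A)"
    using assms(3) by (auto simp: bij_betw_def p_def inj_on_def)
  moreover have "bij_betw p (U - A) (U - f ` A)"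
    using h by (rule iffD1[OF bij_betw_cong, rotated]) (auto simp: p_def)
  ultimately have "bij_betw p (A \<union> (U - A)) (f ` A \<union> (U - f ` A))"
    by (rule bij_betw_combine) auto
  then have "bij_betw p U U"
    using assms by (simp add: Un_absorb1)
  then have "p permutes U"
    by (rule bij_imp_permutes) (use assms(2) in \<open>auto simp: p_def\<close>)
  then show thesis
    by (rule that) (simp add: p_def)
qed

lemma card_vimage_permutes:
  assumes "p permutes U" "B \<subseteq> U"
  shows "card {u \<in> U. p u \<in> B} = card B"
proof -
  have "bij_betw p {u \<in> U. p u \<in> B} B"
    unfolding bij_betw_def
  proof
    show "inj_on p {u \<in> U. p u \<in> B}" using permutes_inj[OF assms(1)] by (rule inj_on_subset) simp
    have "w \<in> p ` {u \<in> U. p u \<in> B}" if "w \<in> B" for w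
    proof -
      have "w \<in> p ` U" using permutes_image[OF assms(1)] that assms(2) by auto
      then show ?thesis using that by auto
    qed
    then show "p ` {u \<in> U. p u \<in> B} = B" by auto
  qed
  then show ?thesis by (rule bij_betw_same_card)
qed

lemma sum_power_card_Pow:
  fixes z :: real
  assumes "finite U"
  shows "(\<Sum>Z\<in>Pow U. z ^ card Z) = (1 + z) ^ card U"
  using prod_add[OF assms, of "\<lambda>_. z" "\<lambda>_. 1"] by (simp add: add.commute)

text \<open>
  The Chernoff-type bound: a set \<open>Z\<close> of at most \<open>m\<close> positions, with weight \<open>\<bar>L\<bar> ^ \<bar>Z\<bar>\<close>, is
  counted with weight at most \<open>(\<bar>L\<bar> / z) powr m * z ^ \<bar>Z\<bar>\<close>.
\<close>

lemma card_hamming_ball: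
  fixes z m :: real
  assumes U: "finite U" and L: "finite L" "L \<noteq> {}" and z: "0 < z" "z \<le> 1"
    and P: "P \<subseteq> U \<rightarrow>\<^sub>E L" "\<And>p. p \<in> P \<Longrightarrow> real (card {u \<in> U. p u \<noteq> p0 u}) \<le> m"
  shows "real (card P) \<le> exp (m * ln (real (card L) / z) + z * real (card U))"
proof -
  define \<Z> where "\<Z> = {Z \<in> Pow U. real (card Z) \<le> m}"
  define ext where "ext Z q = (\<lambda>u\<in>U. if u \<in> Z then q u else p0 u)" for Z and q :: "'a \<Rightarrow> 'b"
  have fin: "finite \<Z>" using U by (simp add: \<Z>_def)
  have finZ: "finite Z" if "Z \<in> \<Z>" for Z
    using that U by (auto simp: \<Z>_def intro: finite_subset)
  \<comment> \<open>A member of \<open>P\<close> is determined by the set \<open>Z\<close> on which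
    it departs from \<open>p0\<close> and by its values there.\<close>
  have "P \<subseteq> (\<Union>Z\<in>\<Z>. ext Z ` (Z \<rightarrow>\<^sub>E L))"
  proof
    fix p assume p: "p \<in> P"
    define Z where "Z = {u \<in> U. p u \<noteq> p0 u}"
    have "Z \<in> \<Z>" using P(2)[OF p] by (auto simp: \<Z>_def Z_def)
    moreover have "p = ext Z (restrict p Z)"
      using p P(1) by (auto simp: ext_def Z_def fun_eq_iff PiE_def extensional_def subset_iff)
    moreover have "restrict p Z \<in> Z \<rightarrow>\<^sub>E L"
      using p P(1) by (auto simp: Z_def PiE_def Pi_def subset_iff)
    ultimately show "p \<in> (\<Union>Z\<in>\<Z>. ext Z ` (Z \<rightarrow>\<^sub>E L))" by blast
  qed
  then have "card P \<le> card (\<Union>Z\<in>\<Z>. ext Z ` (Z \<rightarrow>\<^sub>E L))"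
    by (intro card_mono finite_UN_I fin finite_imageI finite_PiE finZ) (use L in auto)
  also have "\<dots> \<le> (\<Sum>Z\<in>\<Z>. card (ext Z ` (Z \<rightarrow>\<^sub>E L)))"
    by (rule card_UN_le[OF fin])
  also have "\<dots> \<le> (\<Sum>Z\<in>\<Z>. card L ^ card Z)"
  proof (rule sum_mono)
    fix Z assume "Z \<in> \<Z>"
    then have "card (ext Z ` (Z \<rightarrow>\<^sub>E L)) \<le> card (Z \<rightarrow>\<^sub>E L)"
      by (intro card_image_le finite_PiE finZ) (use L in auto)
    then show "card (ext Z ` (Z \<rightarrow>\<^sub>E L)) \<le> card L ^ card Z"
      using finZ[OF \<open>Z \<in> \<Z>\<close>] by (simp add: card_PiE)
  qed
  finally have 1: "real (card P) \<le> (\<Sum>Z\<in>\<Z>. real (card L) ^ card Z)"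
    by (metis (mono_tags, lifting) of_nat_le_iff of_nat_power of_nat_sum sum.cong)
  have L1: "1 \<le> real (card L)" using L by (simp add: Suc_le_eq card_gt_0_iff)
  then have q: "1 \<le> real (card L) / z" using z by (simp add: pos_le_divide_eq)
  have 2: "real (card L) ^ card Z \<le> (real (card L) / z) powr m * z ^ card Z" if "Z \<in> \<Z>" for Z
  proof -
    have "real (card L) ^ card Z = (real (card L) / z) powr real (card Z) * z ^ card Z"
      using z L1 q by (simp add: powr_realpow power_divide)
    also have "\<dots> \<le> (real (card L) / z) powr m * z ^ card Z"
      using that z q by (intro mult_right_mono powr_mono) (auto simp: \<Z>_def)
    finally show ?thesis .
  qed
  \<comment> \<open>A small \<open>z\<close> keeps the factor \<open>(1 + z) ^ card U\<close>
    harmless; its price \<open>ln (1 / z)\<close> is multiplied only by the number \<open>m\<close>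
    of errors.\<close>
  have "(\<Sum>Z\<in>\<Z>. real (card L) ^ card Z) \<le> (real (card L) / z) powr m * (\<Sum>Z\<in>\<Z>. z ^ card Z)"
    unfolding sum_distrib_left by (rule sum_mono[OF 2])
  also have "(\<Sum>Z\<in>\<Z>. z ^ card Z) \<le> (\<Sum>Z\<in>Pow U. z ^ card Z)"
    by (rule sum_mono2) (use U z in \<open>auto simp: \<Z>_def\<close>)
  also have "\<dots> = (1 + z) ^ card U" by (rule sum_power_card_Pow[OF U])
  also have "\<dots> \<le> exp z ^ card U"
    by (rule power_mono) (use z in auto)
  also have "\<dots> = exp (z * card U)" by (rule exp_of_nat2_mult[symmetric])
  also have "(real (card L) / z) powr m = exp (m * ln (real (card L) / z))"
    using L1 z by (auto simp: powr_def)
  finally have "(\<Sum>Z\<in>\<Z>. real (card L) ^ card Z)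
      \<le> exp (m * ln (real (card L) / z)) * exp (z * card U)"
    using q z L by (simp add: mult_left_mono powr_def card_gt_0_iff)
  with 1 show ?thesis by (simp add: exp_add)
qed

lemma card_image_le_of_kernel:
  assumes "finite (g ` X)" "\<And>x y. x \<in> X \<Longrightarrow> y \<in> X \<Longrightarrow> g x = g y \<Longrightarrow> f x = f y"
  shows "card (f ` X) \<le> card (g ` X)"
proof -
  have "f x = f (inv_into X g (g x))" if "x \<in> X" for x
    using that by (intro assms(2)) (auto intro: inv_into_into simp: f_inv_into_f)
  then have "f ` X \<subseteq> (\<lambda>y. f (inv_into X g y)) ` (g ` X)"
    by (auto simp: image_iff)
  then show ?thesis
    using surj_card_le[OF assms(1)] by blast
qed

lemma card_le_fibre_bound:
  fixes b :: real
  assumes "finite X" "\<And>x0. x0 \<in> X \<Longrightarrow> real (card {x \<in> X. g x = g x0}) \<le> b"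
  shows "real (card X) \<le> b * real (card (g ` X))"
proof -
  have "real (card X) = (\<Sum>x\<in>X. 1)" by simp
  also have "\<dots> = (\<Sum>y\<in>g ` X. \<Sum>x\<in>{x \<in> X. g x = y}. 1)"
    by (rule sum.image_gen[OF assms(1)])
  also have "\<dots> \<le> (\<Sum>y\<in>g ` X. b)"
    by (rule sum_mono) (use assms(2) in auto)
  finally show ?thesis by (simp add: mult.commute)
qed

lemma pigeonhole_real:
  fixes b :: real
  assumes "finite X" "X \<noteq> {}" "real (card (g ` X)) \<le> b"
  shows "\<exists>x0\<in>X. real (card X) \<le> b * real (card {x \<in> X. g x = g x0})"
proof (rule ccontr)
  assume "\<not> ?thesis"
  then have less: "b * real (card {x \<in> X. g x = g x0}) < real (card X)" if "x0 \<in> X" for x0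
    using that by fastforce
  have "card (g ` X) > 0" using assms by (simp add: card_gt_0_iff)
  then have b: "b > 0" using assms(3) by linarith
  have "b * real (card X) = b * (\<Sum>x\<in>X. 1)" by simp
  also have "(\<Sum>x\<in>X. 1) = (\<Sum>y\<in>g ` X. \<Sum>x\<in>{x \<in> X. g x = y}. 1::real)"
    by (rule sum.image_gen[OF assms(1)])
  also have "b * \<dots> = (\<Sum>y\<in>g ` X. b * real (card {x \<in> X. g x = y}))"
    by (simp add: sum_distrib_left)
  also have "\<dots> < (\<Sum>y\<in>g ` X. real (card X))"
    by (rule sum_strict_mono) (use assms less in auto)
  also have "\<dots> = real (card (g ` X)) * real (card X)" by simp
  also have "\<dots> \<le> b * real (card X)" by (rule mult_right_mono) (use assms in auto)
  finally show False by simp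
qed

lemma card_UN_le_mult:
  fixes b :: real
  assumes "finite I" "\<And>i. i \<in> I \<Longrightarrow> real (card (A i)) \<le> b"
  shows "real (card (\<Union>i\<in>I. A i)) \<le> real (card I) * b"
proof -
  have "real (card (\<Union>i\<in>I. A i)) \<le> (\<Sum>i\<in>I. real (card (A i)))"
    using card_UN_le[OF assms(1), of A] by (simp flip: of_nat_sum)
  also have "\<dots> \<le> (\<Sum>i\<in>I. b)" by (rule sum_mono[OF assms(2)])
  finally show ?thesis by simp
qed

section \<open>Sofic approximations\<close>

definition inconsistent ::
    "('g, 'm) monoid_scheme \<Rightarrow> 'g set \<Rightarrow> 'v set \<Rightarrow> ('g \<Rightarrow> 'v \<Rightarrow> 'v) \<Rightarrow> 'v set" where
  "inconsistent G F V \<sigma> =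
     {v \<in> V. \<exists>s\<in>F. \<exists>t\<in>F. \<sigma> (s \<otimes>\<^bsub>G\<^esub> t) v \<noteq> \<sigma> s (\<sigma> t v) \<or> s \<noteq> t \<and> \<sigma> s v = \<sigma> t v}"

text \<open>Each pair from \<open>F\<close> contributes one set of density at most
  \<open>\<delta>\<close> for multiplicativity and one for freeness, hence the factor 2.\<close>

lemma card_inconsistent:
  assumes V: "finite V" "V \<noteq> {}" and F: "finite F" and good: "good_approximation G F \<delta> V \<sigma>"
  shows "real (card (inconsistent G F V \<sigma>)) \<le> 2 * real (card F) ^ 2 * \<delta> * real (card V)"
proof -
  have cV: "real (card V) > 0" using V by (simp add: card_gt_0_iff)
  define A where "A = (\<lambda>(s, t). {v \<in> V. \<sigma> (s \<otimes>\<^bsub>G\<^esub> t) v \<noteq> \<sigma> s (\<sigma> t v)})"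
  define B where "B = (\<lambda>(s, t). {v \<in> V. s \<noteq> t \<and> \<sigma> s v = \<sigma> t v})"
  have A: "real (card (A p)) \<le> \<delta> * real (card V)" if "p \<in> F \<times> F" for p
    using that good cV unfolding good_approximation_def hamming_def A_def
    by (force simp: pos_divide_le_eq)
  have B: "real (card (B p)) \<le> \<delta> * real (card V)" if "p \<in> F \<times> F" for p
  proof (cases "fst p = snd p")
    case True
    then have "B p = {}" by (auto simp: B_def split: prod.splits)
    moreover have "0 \<le> \<delta>"
      using A[OF that] cV by (meson of_nat_0_le_iff order_trans zero_le_mult_iff not_less)
    ultimately show ?thesis by simp
  next
    case False
    define s t where "s = fst p" and "t = snd p"
    then have p: "p = (s, t)" "s \<in> F" "t \<in> F" "s \<noteq> t" using \<open>p \<in> F \<times> F\<close> False by auto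
    have "1 - \<delta> \<le> hamming V (\<sigma> s) (\<sigma> t)" using good p unfolding good_approximation_def by blast
    then have "(1 - \<delta>) * real (card V) \<le> real (card {v \<in> V. \<sigma> s v \<noteq> \<sigma> t v})"
      using cV by (simp add: hamming_def pos_le_divide_eq)
    moreover have "card (B p) + card {v \<in> V. \<sigma> s v \<noteq> \<sigma> t v} = card V"
    proof -
      have "V = B p \<union> {v \<in> V. \<sigma> s v \<noteq> \<sigma> t v}" "B p \<inter> {v \<in> V. \<sigma> s v \<noteq> \<sigma> t v} = {}"
        using p by (auto simp: B_def)
      then show ?thesis using V(1)
        by (metis (no_types, lifting) card_Un_disjoint finite_Un)
    qed
    ultimately show ?thesis by (simp add: algebra_simps flip: of_nat_add)
  qed
  have "inconsistent G F V \<sigma> = (\<Union>p\<in>F \<times> F. A p) \<union> (\<Union>p\<in>F \<times> F. B p)"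
    by (auto simp: inconsistent_def A_def B_def)
  then have "real (card (inconsistent G F V \<sigma>))
      \<le> real (card (\<Union>p\<in>F \<times> F. A p)) + real (card (\<Union>p\<in>F \<times> F. B p))"
    by (metis card_Un_le of_nat_add of_nat_le_iff)
  also have "\<dots> \<le> real (card (F \<times> F)) * (\<delta> * real (card V)) + real (card (F \<times> F)) * (\<delta> * real (card V))"
    by (intro add_mono card_UN_le_mult A B) (use F in auto)
  finally show ?thesis by (simp add: power2_eq_square algebra_simps card_cartesian_product)
qed

text \<open>A maximal set \<open>A\<close> with pairwise disjoint translates \<open>E a\<close> is syndetic.\<close>

lemma (in group) sparse_syndetic_subset:
  assumes V: "finite V" and perm: "\<And>g. g \<in> carrier G \<Longrightarrow> \<sigma> g permutes V"
    and E: "finite E" "E \<noteq> {}" "E \<subseteq> carrier G" and V0: "V0 \<subseteq> V"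
    and F: "E \<subseteq> F" "\<And>e e'. e \<in> E \<Longrightarrow> e' \<in> E \<Longrightarrow> inv e' \<otimes> e \<in> F"
  shows "\<exists>A\<subseteq>V0. real (card A) \<le> real (card V) / real (card E) + real (card (inconsistent G F V \<sigma>)) \<and>
           (\<forall>v\<in>V0. v \<in> A \<or> (\<exists>e\<in>E. \<exists>e'\<in>E. \<sigma> (inv e' \<otimes> e) v \<in> A))"
proof -
  define W where "W = V0 - inconsistent G F V \<sigma>"
  define sep where "sep A \<longleftrightarrow> (\<forall>a\<in>A. \<forall>b\<in>A. \<forall>e\<in>E. \<forall>e'\<in>E. a \<noteq> b \<longrightarrow> \<sigma> e a \<noteq> \<sigma> e' b)" for A
  have finW: "finite W" using V V0 by (auto simp: W_def intro: finite_subset)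
  have "finite {A \<in> Pow W. sep A}" "{} \<in> {A \<in> Pow W. sep A}"
    using finW by (auto simp: sep_def)
  then have "\<exists>A\<in>{A \<in> Pow W. sep A}. \<forall>B\<in>{A \<in> Pow W. sep A}. A \<subseteq> B \<longrightarrow> A = B"
    by (intro finite_has_maximal) auto
  then obtain A where "A \<in> {A \<in> Pow W. sep A}" and m: "\<forall>B\<in>{A \<in> Pow W. sep A}. A \<subseteq> B \<longrightarrow> A = B"
    by (rule bexE)
  then have A: "A \<subseteq> W" "sep A" by auto
  have max: "B = A" if "B \<subseteq> W" "sep B" "A \<subseteq> B" for B
    using m[rule_format, of B] that by simp
  have WV: "W \<subseteq> V" using V0 by (auto simp: W_def)
  have cons: "\<sigma> (s \<otimes> t) v = \<sigma> s (\<sigma> t v)" "s \<noteq> t \<Longrightarrow> \<sigma> s v \<noteq> \<sigma> t v"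
    if "v \<in> W" "s \<in> F" "t \<in> F" for s t v
    using that WV by (auto simp: W_def inconsistent_def)
  \<comment> \<open>Translates of different points are disjoint by separation; the translates of one
    point are distinct because it is not inconsistent. Packing \<open>E \<times> A\<close> into
    \<open>V\<close> bounds \<open>A\<close>.\<close>
  have "inj_on (\<lambda>(e, a). \<sigma> e a) (E \<times> A)"
  proof (rule inj_onI, clarify)
    fix e a e' b assume h: "e \<in> E" "a \<in> A" "e' \<in> E" "b \<in> A" "\<sigma> e a = \<sigma> e' b"
    then have "a = b" using A(2) unfolding sep_def by blast
    moreover have "e = e'" using cons(2)[of a e e'] h A(1) F(1) \<open>a = b\<close> by blast
    ultimately show "e = e' \<and> a = b" by simp
  qed
  moreover have "(\<lambda>(e, a). \<sigma> e a) ` (E \<times> A) \<subseteq> V"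
    using A(1) WV E(3) perm by (auto simp: permutes_in_image subset_iff)
  ultimately have "card (E \<times> A) \<le> card V"
    using card_inj_on_le V by blast
  then have "real (card E) * real (card A) \<le> real (card V)"
    by (simp add: card_cartesian_product flip: of_nat_mult)
  moreover have "card E > 0" using E by (simp add: card_gt_0_iff)
  ultimately have cA: "real (card A) \<le> real (card V) / real (card E)"
    by (simp add: pos_le_divide_eq mult.commute)
  \<comment> \<open>Inconsistent points are adjoined wholesale, since the maximality argument needs
    multiplicativity at \<open>v\<close>. This is the second summand of the bound.\<close>
  define A' where "A' = A \<union> (V0 \<inter> inconsistent G F V \<sigma>)"
  have "card A' \<le> card A + card (V0 \<inter> inconsistent G F V \<sigma>)"
    unfolding A'_def by (rule card_Un_le)
  also have "card (V0 \<inter> inconsistent G F V \<sigma>) \<le> card (inconsistent G F V \<sigma>)"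
    by (rule card_mono) (use V in \<open>auto simp: inconsistent_def\<close>)
  finally have "real (card A') \<le> real (card V) / real (card E) + real (card (inconsistent G F V \<sigma>))"
    using cA by linarith
  moreover have "A' \<subseteq> V0" using A(1) by (auto simp: A'_def W_def)
  moreover have "v \<in> A' \<or> (\<exists>e\<in>E. \<exists>e'\<in>E. \<sigma> (inv e' \<otimes> e) v \<in> A')" if v: "v \<in> V0" for v
  proof (cases "v \<in> W \<and> v \<notin> A")
    case False
    then show ?thesis using v by (auto simp: A'_def W_def)
  next
    case True
    have not_sep: "\<not> sep (insert v A)" using max[of "insert v A"] True A(1) by auto
    have "\<exists>a\<in>A. \<exists>e\<in>E. \<exists>e'\<in>E. \<sigma> e v = \<sigma> e' a"
    proof (rule ccontr)
      assume "\<not> ?thesis"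
      then have 1: "\<And>a e e'. a \<in> A \<Longrightarrow> e \<in> E \<Longrightarrow> e' \<in> E \<Longrightarrow> \<sigma> e v \<noteq> \<sigma> e' a" by blast
      then have "\<And>a e e'. a \<in> A \<Longrightarrow> e \<in> E \<Longrightarrow> e' \<in> E \<Longrightarrow> \<sigma> e a \<noteq> \<sigma> e' v" by metis
      with 1 A(2) have "sep (insert v A)" unfolding sep_def by simp
      with not_sep show False by simp
    qed
    then obtain a e e' where h: "a \<in> A" "e \<in> E" "e' \<in> E" "\<sigma> e v = \<sigma> e' a" by blast
    have "\<sigma> e v = \<sigma> (e' \<otimes> (inv e' \<otimes> e)) v"
      using h E(3) by (simp add: subset_iff m_assoc[symmetric])
    also have "\<dots> = \<sigma> e' (\<sigma> (inv e' \<otimes> e) v)"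
      using True h F by (intro cons(1)) auto
    finally have "\<sigma> e' a = \<sigma> e' (\<sigma> (inv e' \<otimes> e) v)" using h by simp
    moreover have "inj (\<sigma> e')" using perm h E(3) by (auto intro: permutes_inj)
    ultimately have "\<sigma> (inv e' \<otimes> e) v = a" by (simp add: inj_eq)
    then show ?thesis using h by (auto simp: A'_def)
  qed
  ultimately show ?thesis by blast
qed

section \<open>Homomorphisms as point maps\<close>

text \<open>These are the atoms of the algebra generated by \<open>S\<close>. Indexing them by
  points of \<open>\<Omega>\<close> keeps out the empty set, which \<open>partition_on\<close>
  forbids.\<close>

definition generated_partition :: "'x set \<Rightarrow> 'x set set \<Rightarrow> 'x set set" where
  "generated_partition \<Omega> S = (\<lambda>z. {w \<in> \<Omega>. \<forall>A\<in>S. w \<in> A \<longleftrightarrow> z \<in> A}) ` \<Omega>"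

lemma partition_on_generated_partition: "partition_on \<Omega> (generated_partition \<Omega> S)"
  unfolding generated_partition_def partition_on_def disjoint_def by auto

lemma generated_partition_cong:
  assumes "B \<in> generated_partition \<Omega> S" "z \<in> B" "w \<in> B" "A \<in> S"
  shows "z \<in> A \<longleftrightarrow> w \<in> A"
  using assms by (auto simp: generated_partition_def)

lemma finite_generated_partition:
  assumes "finite S"
  shows "finite (generated_partition \<Omega> S)"
proof -
  have "generated_partition \<Omega> S \<subseteq> (\<lambda>T. {w \<in> \<Omega>. \<forall>A\<in>S. w \<in> A \<longleftrightarrow> A \<in> T}) ` Pow S"
    unfolding generated_partition_def
  proof (rule image_subsetI)
    fix z
    have "{w \<in> \<Omega>. \<forall>A\<in>S. w \<in> A \<longleftrightarrow> z \<in> A} = {w \<in> \<Omega>. \<forall>A\<in>S. w \<in> A \<longleftrightarrow> A \<in> {A \<in> S. z \<in> A}}" by auto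
    then show "{w \<in> \<Omega>. \<forall>A\<in>S. w \<in> A \<longleftrightarrow> z \<in> A} \<in> (\<lambda>T. {w \<in> \<Omega>. \<forall>A\<in>S. w \<in> A \<longleftrightarrow> A \<in> T}) ` Pow S"
      by (rule image_eqI) auto
  qed
  then show ?thesis using assms by (auto intro: finite_subset)
qed

lemma sets_generated_partition:
  assumes "finite S" "S \<subseteq> sets M"
  shows "generated_partition (space M) S \<subseteq> sets M"
proof
  fix B assume "B \<in> generated_partition (space M) S"
  then obtain z where B: "B = {w \<in> space M. \<forall>A\<in>S. w \<in> A \<longleftrightarrow> z \<in> A}"
    by (auto simp: generated_partition_def)
  have "{w \<in> space M. \<forall>A\<in>S. w \<in> A \<longleftrightarrow> z \<in> A} \<in> sets M"
  proof (rule sets.sets_Collect_finite_All[OF _ assms(1)])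
    fix A assume "A \<in> S"
    then have "A \<in> sets M" using assms by auto
    then have "A \<inter> space M \<in> sets M" "space M - A \<in> sets M" by auto
    moreover have "{w \<in> space M. w \<in> A \<longleftrightarrow> z \<in> A} = (if z \<in> A then A \<inter> space M else space M - A)"
      by auto
    ultimately show "{w \<in> space M. w \<in> A \<longleftrightarrow> z \<in> A} \<in> sets M" by simp
  qed
  then show "B \<in> sets M" by (simp add: B)
qed

lemma finite_partition_generated_partition:
  "finite S \<Longrightarrow> S \<subseteq> sets M \<Longrightarrow> finite_partition M (generated_partition (space M) S)"
  unfolding finite_partition_def
  by (simp add: finite_generated_partition sets_generated_partition partition_on_generated_partition)

lemma generated_partition_Union:
  assumes "A \<in> S" "A \<subseteq> \<Omega>"
  shows "\<Union>{B \<in> generated_partition \<Omega> S. B \<subseteq> A} = A"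
proof
  show "A \<subseteq> \<Union>{B \<in> generated_partition \<Omega> S. B \<subseteq> A}"
  proof
    fix z assume z: "z \<in> A"
    define B where "B = {w \<in> \<Omega>. \<forall>A\<in>S. w \<in> A \<longleftrightarrow> z \<in> A}"
    have "B \<in> generated_partition \<Omega> S" "B \<subseteq> A" "z \<in> B"
      using z assms by (auto simp: B_def generated_partition_def)
    then show "z \<in> \<Union>{B \<in> generated_partition \<Omega> S. B \<subseteq> A}" by blast
  qed
qed auto

lemma refines_generated_partition:
  assumes "partition_on \<Omega> P" "P \<subseteq> S"
  shows "refines \<Omega> (generated_partition \<Omega> S) P"
  unfolding refines_def
proof (intro conjI ballI)
  fix X assume "X \<in> generated_partition \<Omega> S"
  then obtain z where z: "z \<in> \<Omega>" and X: "X = {w \<in> \<Omega>. \<forall>A\<in>S. w \<in> A \<longleftrightarrow> z \<in> A}"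
    by (auto simp: generated_partition_def)
  then obtain Y where "Y \<in> P" "z \<in> Y" using assms(1) by (auto simp: partition_on_def)
  then show "\<exists>Y\<in>P. X \<subseteq> Y" using assms(2) X by auto
qed (simp_all add: assms partition_on_generated_partition)

lemma partition_on_part_eq:
  assumes "partition_on \<Omega> P" "A \<in> P" "B \<in> P" "z \<in> A" "z \<in> B"
  shows "A = B"
  using assms unfolding partition_on_def disjoint_def by blast

text \<open>A nonempty intersection of one part from each partition consists of the points lying in
  the same parts as any one of its points. Having at least one partition keeps such an intersection
  inside \<open>\<Omega>\<close>.\<close>

lemma common_refinement_eq_generated_partition:
  assumes P: "\<And>P. P \<in> \<P> \<Longrightarrow> partition_on \<Omega> P" and ne: "\<P> \<noteq> {}"
  shows "common_refinement \<P> = generated_partition \<Omega> (\<Union>\<P>)"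
proof -
  have block: "\<Inter> (f ` \<P>) = {w \<in> \<Omega>. \<forall>A\<in>\<Union>\<P>. w \<in> A \<longleftrightarrow> z \<in> A}"
    if f: "\<And>P. P \<in> \<P> \<Longrightarrow> f P \<in> P" and z: "\<And>P. P \<in> \<P> \<Longrightarrow> z \<in> f P" for f z
  proof -
    have 1: "w \<in> \<Omega>" if "w \<in> \<Inter> (f ` \<P>)" for w
    proof -
      obtain P where "P \<in> \<P>" using ne by auto
      then show ?thesis using that f[of P] P[of P] by (auto simp: partition_on_def)
    qed
    have 2: "w \<in> A \<longleftrightarrow> z \<in> A" if "w \<in> \<Inter> (f ` \<P>)" "P \<in> \<P>" "A \<in> P" for w A P
      using that f[of P] z[of P] partition_on_part_eq[OF P[of P]] by blast
    have 3: "w \<in> f P" if "\<forall>A\<in>\<Union>\<P>. w \<in> A \<longleftrightarrow> z \<in> A" "P \<in> \<P>" for w P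
      using that f[of P] z[of P] by blast
    show ?thesis
    proof (intro equalityI subsetI)
      fix w assume "w \<in> \<Inter> (f ` \<P>)"
      then show "w \<in> {w \<in> \<Omega>. \<forall>A\<in>\<Union>\<P>. w \<in> A \<longleftrightarrow> z \<in> A}" using 1[of w] 2[of w] by blast
    next
      fix w assume "w \<in> {w \<in> \<Omega>. \<forall>A\<in>\<Union>\<P>. w \<in> A \<longleftrightarrow> z \<in> A}"
      then show "w \<in> \<Inter> (f ` \<P>)" using 3[of w] by simp
    qed
  qed
  show ?thesis
  proof (intro equalityI subsetI)
    fix X assume "X \<in> common_refinement \<P>"
    then obtain f where f: "\<And>P. P \<in> \<P> \<Longrightarrow> f P \<in> P" "X = \<Inter> (f ` \<P>)" "X \<noteq> {}"
      by (auto simp: common_refinement Pi_def)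
    then obtain z where "z \<in> X" by auto
    then have z: "\<And>P. P \<in> \<P> \<Longrightarrow> z \<in> f P" using f by auto
    have X: "X = {w \<in> \<Omega>. \<forall>A\<in>\<Union>\<P>. w \<in> A \<longleftrightarrow> z \<in> A}" using block[OF f(1) z] f(2) by simp
    then have "z \<in> \<Omega>" using \<open>z \<in> X\<close> by auto
    with X show "X \<in> generated_partition \<Omega> (\<Union>\<P>)"
      unfolding generated_partition_def by blast
  next
    fix X assume "X \<in> generated_partition \<Omega> (\<Union>\<P>)"
    then obtain z where z: "z \<in> \<Omega>" and X: "X = {w \<in> \<Omega>. \<forall>A\<in>\<Union>\<P>. w \<in> A \<longleftrightarrow> z \<in> A}"
      by (auto simp: generated_partition_def)
    have "\<forall>P\<in>\<P>. \<exists>A. A \<in> P \<and> z \<in> A" using P z by (auto simp: partition_on_def)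
    then obtain f where f: "\<And>P. P \<in> \<P> \<Longrightarrow> f P \<in> P \<and> z \<in> f P" by metis
    have "X = \<Inter> (f ` \<P>)" using block[of f z] f X by simp
    moreover have "z \<in> X" using X z by simp
    ultimately show "X \<in> common_refinement \<P>"
      using f by (auto simp: common_refinement Pi_def)
  qed
qed

lemma partition_on_image:
  assumes "partition_on \<Omega> C" "bij_betw f \<Omega> \<Omega>"
  shows "partition_on \<Omega> ((\<lambda>A. f ` A) ` C)"
proof -
  have *: "\<Omega> = \<Union>C" and sub: "\<And>A. A \<in> C \<Longrightarrow> A \<subseteq> \<Omega>" using assms by (auto simp: partition_on_def)
  have "\<Union>((\<lambda>A. f ` A) ` C) = f ` \<Omega>" by (auto simp: *)
  then have "\<Union>((\<lambda>A. f ` A) ` C) = \<Omega>" using assms(2) by (simp add: bij_betw_def)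
  moreover have "disjoint ((\<lambda>A. f ` A) ` C)"
  proof (clarsimp simp: disjoint_def)
    fix A B assume "A \<in> C" "B \<in> C" "f ` A \<noteq> f ` B"
    then have "A \<inter> B = {}" using assms(1) by (auto simp: partition_on_def disjoint_def)
    then show "f ` A \<inter> f ` B = {}"
      using sub[OF \<open>A \<in> C\<close>] sub[OF \<open>B \<in> C\<close>] assms(2) inj_on_image_Int[of f \<Omega> A B]
      by (simp add: bij_betw_def)
  qed
  moreover have "{} \<notin> (\<lambda>A. f ` A) ` C" using assms(1) by (auto simp: partition_on_def)
  ultimately show ?thesis by (simp add: partition_on_def)
qed

lemma algebra_generated_algebra:
  assumes "C \<subseteq> Pow \<Omega>"
  shows "Sigma_Algebra.algebra \<Omega> (generated_algebra \<Omega> C)"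
proof -
  have "Sigma_Algebra.algebra \<Omega> (Pow \<Omega>)" by (auto simp: algebra_iff_Un)
  then have "generated_algebra \<Omega> C \<subseteq> Pow \<Omega>" using assms by (auto simp: generated_algebra_def)
  then show ?thesis by (auto simp: algebra_iff_Un generated_algebra_def)
qed

lemma generated_algebra_Union:
  assumes "C \<subseteq> Pow \<Omega>" "finite T" "T \<subseteq> C"
  shows "\<Union>T \<in> generated_algebra \<Omega> C"
proof -
  interpret Sigma_Algebra.algebra \<Omega> "generated_algebra \<Omega> C" by (rule algebra_generated_algebra[OF assms(1)])
  have "T \<subseteq> generated_algebra \<Omega> C" using assms by (auto simp: generated_algebra_def)
  then show ?thesis by (rule finite_Union[OF assms(2)])
qed

text \<open>A homomorphism on a finite algebra is induced by choosing a point in the atom over each \<open>v\<close>.\<close>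

lemma boolean_hom_point_map:
  assumes \<phi>: "\<phi> \<in> boolean_homs \<Omega> (generated_algebra \<Omega> D) V"
    and D: "finite D" "partition_on \<Omega> D"
  obtains x where "x \<in> V \<rightarrow>\<^sub>E \<Omega>" "\<And>T. T \<subseteq> D \<Longrightarrow> \<phi> (\<Union>T) = {v \<in> V. x v \<in> \<Union>T}"
proof -
  have sub: "D \<subseteq> Pow \<Omega>" "\<Union>D = \<Omega>" using D by (auto simp: partition_on_def)
  have fin: "finite T" if "T \<subseteq> D" for T using that D(1) finite_subset by blast
  have gen: "\<Union>T \<in> generated_algebra \<Omega> D" if "T \<subseteq> D" for T
    by (rule generated_algebra_Union[OF sub(1) fin[OF that] that])
  have gen1: "d \<in> generated_algebra \<Omega> D" if "d \<in> D" for d using gen[of "{d}"] that by simp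
  have U: "\<phi> (\<Union>T) = (\<Union>d\<in>T. \<phi> d)" if "T \<subseteq> D" for T
    using fin[OF that] that
  proof (induction T rule: finite_induct)
    case empty
    then show ?case using \<phi> by (simp add: boolean_homs_def)
  next
    case (insert d T)
    have "\<phi> (d \<union> \<Union>T) = \<phi> d \<union> \<phi> (\<Union>T)"
      using \<phi> gen1[of d] gen[of T] insert.prems by (simp add: boolean_homs_def)
    with insert show ?case by simp
  qed
  have disj: "d = d'" if "d \<in> D" "d' \<in> D" "v \<in> \<phi> d" "v \<in> \<phi> d'" for d d' v
  proof (rule ccontr)
    assume "d \<noteq> d'"
    then have "d \<inter> d' = {}" using D that by (auto simp: partition_on_def disjoint_def)
    moreover have "\<phi> (d \<inter> d') = \<phi> d \<inter> \<phi> d'" "\<phi> {} = {}"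
      using \<phi> gen1 that by (auto simp: boolean_homs_def)
    ultimately show False using that by auto
  qed
  have "\<forall>v\<in>V. \<exists>z. \<exists>d\<in>D. v \<in> \<phi> d \<and> z \<in> d"
  proof
    fix v assume "v \<in> V"
    moreover have "\<phi> (\<Union>D) = V" using \<phi> sub by (simp add: boolean_homs_def)
    ultimately obtain d where d: "d \<in> D" "v \<in> \<phi> d" using U[of D] by auto
    then have "d \<noteq> {}" using D by (auto simp: partition_on_def)
    then show "\<exists>z. \<exists>d\<in>D. v \<in> \<phi> d \<and> z \<in> d" using d by blast
  qed
  then obtain x where x: "\<And>v. v \<in> V \<Longrightarrow> \<exists>d\<in>D. v \<in> \<phi> d \<and> x v \<in> d" by metis
  show thesis
  proof (rule that)
    show "restrict x V \<in> V \<rightarrow>\<^sub>E \<Omega>" using x sub by fastforce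
    fix T assume T: "T \<subseteq> D"
    have "v \<in> \<phi> (\<Union>T) \<longleftrightarrow> x v \<in> \<Union>T" if v: "v \<in> V" for v
    proof -
      obtain d where d: "d \<in> D" "v \<in> \<phi> d" "x v \<in> d" using x[OF v] by auto
      have "v \<in> \<phi> (\<Union>T) \<longleftrightarrow> d \<in> T" using U[OF T] disj[of d] d T by blast
      also have "\<dots> \<longleftrightarrow> x v \<in> \<Union>T"
        using partition_on_part_eq[OF D(2) d(1)] d T by blast
      finally show ?thesis .
    qed
    moreover have "\<phi> (\<Union>T) \<subseteq> V" using \<phi> gen[OF T] by (auto simp: boolean_homs_def)
    ultimately show "\<phi> (\<Union>T) = {v \<in> V. restrict x V v \<in> \<Union>T}" by auto
  qed
qed

lemma point_map_boolean_hom: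
  assumes "C \<subseteq> Pow \<Omega>" "x \<in> V \<rightarrow> \<Omega>"
  shows "(\<lambda>A\<in>generated_algebra \<Omega> C. {v \<in> V. x v \<in> A}) \<in> boolean_homs \<Omega> (generated_algebra \<Omega> C) V"
proof -
  interpret Sigma_Algebra.algebra \<Omega> "generated_algebra \<Omega> C" by (rule algebra_generated_algebra[OF assms(1)])
  show ?thesis
    using assms(2) top Int Un by (auto simp: boolean_homs_def PiE_def Pi_def)
qed

section \<open>Microstates\<close>

text \<open>A homomorphism records only which test sets hold the point over \<open>v\<close>.
  Choosing an actual point \<open>x v\<close> makes the values of the cocycles at \<open>x v\<close>
  available, and \<open>S\<close> may then be any family of sets instead of a partition.\<close>

definition microstates ::
    "'x measure \<Rightarrow> ('g \<Rightarrow> 'x \<Rightarrow> 'x) \<Rightarrow> 'x set set \<Rightarrow> 'g set \<Rightarrow> real \<Rightarrow>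
     'v set \<Rightarrow> ('g \<Rightarrow> 'v \<Rightarrow> 'v) \<Rightarrow> ('v \<Rightarrow> 'x) set" where
  "microstates M \<alpha> S F \<delta> V \<sigma> =
     {x \<in> V \<rightarrow>\<^sub>E space M.
        (\<forall>g\<in>F. real (card {v \<in> V. \<exists>A\<in>S. (x (\<sigma> g v) \<in> A) \<noteq> (\<alpha> g (x v) \<in> A)}) \<le> \<delta> * real (card V)) \<and>
        (\<forall>A\<in>S. \<bar>unif V {v \<in> V. x v \<in> A} - measure M A\<bar> \<le> \<delta>)}"

text \<open>The pointwise counterpart of restricting a homomorphism to \<open>P\<close>; counting
  names replaces \<open>count_on\<close>.\<close>

definition names :: "'v set \<Rightarrow> 'x set set \<Rightarrow> ('v \<Rightarrow> 'x) \<Rightarrow> 'v \<Rightarrow> 'x set set" where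
  "names V P x = (\<lambda>v\<in>V. {A \<in> P. x v \<in> A})"

lemma names_in_PiE: "names V P x \<in> V \<rightarrow>\<^sub>E Pow P"
  by (auto simp: names_def)

lemma finite_names_image: "finite V \<Longrightarrow> finite P \<Longrightarrow> finite (names V P ` X)"
  by (rule finite_subset[of _ "V \<rightarrow>\<^sub>E Pow P"]) (simp_all add: image_subset_iff names_in_PiE finite_PiE)

lemma names_eqD:
  assumes "names V P x = names V P y" "v \<in> V" "A \<in> P"
  shows "x v \<in> A \<longleftrightarrow> y v \<in> A"
  using fun_cong[OF assms(1), of v] assms(2,3) by (auto simp: names_def)

lemma names_eqI:
  assumes "\<And>v A. v \<in> V \<Longrightarrow> A \<in> P \<Longrightarrow> x v \<in> A \<longleftrightarrow> y v \<in> A"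
  shows "names V P x = names V P y"
  using assms by (auto simp: names_def fun_eq_iff)

context pmp_action
begin

lemma action_bij: "g \<in> carrier G \<Longrightarrow> bij_betw (\<alpha> g) (space M) (space M)"
  using inj_prop surj_prop by (simp add: bij_betw_def)

lemma action_closed: "g \<in> carrier G \<Longrightarrow> x \<in> space M \<Longrightarrow> \<alpha> g x \<in> space M"
  using element_image by blast

lemma action_one: "x \<in> space M \<Longrightarrow> \<alpha> \<one> x = x"
  using id_eq_one by (metis restrict_apply')

lemma group_G: "group G"
  using group_hom by (simp add: group_hom_def)

lemma action_inv:
  assumes "g \<in> carrier G" "x \<in> space M"
  shows "\<alpha> (inv g) (\<alpha> g x) = x" "\<alpha> g (\<alpha> (inv g) x) = x"
proof -
  interpret group G by (rule group_G)
  show "\<alpha> (inv g) (\<alpha> g x) = x" "\<alpha> g (\<alpha> (inv g) x) = x"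
    using assms composition_rule[of x "inv g" g] composition_rule[of x g "inv g"]
    by (simp_all add: action_one)
qed

lemma image_eq_preimage:
  assumes "g \<in> carrier G" "A \<subseteq> space M"
  shows "\<alpha> g ` A = {z \<in> space M. \<alpha> (inv g) z \<in> A}"
proof -
  interpret group G by (rule group_G)
  show ?thesis
  proof (intro equalityI subsetI)
    fix z assume "z \<in> \<alpha> g ` A"
    then show "z \<in> {z \<in> space M. \<alpha> (inv g) z \<in> A}"
      using assms by (auto simp: action_closed action_inv subset_iff)
  next
    fix z assume "z \<in> {z \<in> space M. \<alpha> (inv g) z \<in> A}"
    then show "z \<in> \<alpha> g ` A" using assms action_inv(2)[of g z]
      by (metis (mono_tags, lifting) image_eqI mem_Collect_eq)
  qed
qed

lemma action_in_image_iff: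
  assumes "g \<in> carrier G" "A \<subseteq> space M" "z \<in> space M"
  shows "\<alpha> g z \<in> \<alpha> g ` A \<longleftrightarrow> z \<in> A"
  using assms inj_prop[OF assms(1)] by (auto simp: inj_on_def subset_iff)

lemma preimage_sets: "g \<in> carrier G \<Longrightarrow> A \<in> sets M \<Longrightarrow> {z \<in> space M. \<alpha> g z \<in> A} \<in> sets M"
  using measurable_sets[OF action_measurable, of g A]
  by (simp add: vimage_def Int_def conj_commute)

lemma measure_preimage:
  assumes "g \<in> carrier G" "A \<in> sets M"
  shows "measure M {z \<in> space M. \<alpha> g z \<in> A} = measure M A"
  using measure_distr[OF action_measurable[OF assms(1)] assms(2)] action_preserves[OF assms(1)]
  by (simp add: vimage_def Int_def conj_commute)

lemma image_sets: "g \<in> carrier G \<Longrightarrow> A \<in> sets M \<Longrightarrow> \<alpha> g ` A \<in> sets M"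
  using image_eq_preimage[of g A] preimage_sets[of "inv g" A] group.inv_closed[OF group_G, of g]
    sets.sets_into_space[of A M] by simp

lemma measure_image: "g \<in> carrier G \<Longrightarrow> A \<in> sets M \<Longrightarrow> measure M (\<alpha> g ` A) = measure M A"
  using image_eq_preimage[of g A] measure_preimage[of "inv g" A] group.inv_closed[OF group_G, of g]
    sets.sets_into_space[of A M] by simp

lemma translated_join_eq:
  assumes "F \<subseteq> carrier G" "F \<noteq> {}" "partition_on (space M) C"
  shows "translated_join \<alpha> F C = generated_partition (space M) (\<Union>g\<in>F. (\<lambda>A. \<alpha> g ` A) ` C)"
  unfolding translated_join_def
  by (subst common_refinement_eq_generated_partition[where \<Omega> = "space M"])
     (use assms in \<open>auto intro!: partition_on_image action_bij\<close>)

lemma finite_partition_translated_join: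
  assumes "F \<subseteq> carrier G" "finite F" "F \<noteq> {}" "finite_partition M C"
  shows "finite_partition M (translated_join \<alpha> F C)"
proof -
  have C: "partition_on (space M) C" "finite C" "C \<subseteq> sets M"
    using assms(4) by (auto simp: finite_partition_def)
  show ?thesis
    unfolding translated_join_eq[OF assms(1,3) C(1)]
    using assms C by (intro finite_partition_generated_partition) (auto intro!: image_sets)
qed

text \<open>
  Refining by the translates of \<open>S\<close> turns equivariance of a homomorphism on the partition into
  equivariance of a point map on \<open>S\<close>.
\<close>

lemma count_sofic_homs_le_microstates:
  assumes S: "finite S" "S \<subseteq> sets M" and F: "finite F" "F \<subseteq> carrier G" "\<one> \<in> F"
    and P: "finite_partition M P" "P \<subseteq> S" and \<sigma>: "sofic_approximation G V \<sigma>"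
  defines "C \<equiv> generated_partition (space M) (\<Union>g\<in>F. (\<lambda>A. {z \<in> space M. \<alpha> g z \<in> A}) ` S)"
  shows "finite_partition M C" "refines (space M) C P"
    "count_on P (sofic_homs M \<alpha> C F \<delta> V \<sigma>) \<le> card (names V P ` microstates M \<alpha> S F \<delta> V \<sigma>)"
proof -
  define S' where "S' = (\<Union>g\<in>F. (\<lambda>A. {z \<in> space M. \<alpha> g z \<in> A}) ` S)"
  have C: "C = generated_partition (space M) S'" by (simp add: C_def S'_def)
  have Sp: "A \<subseteq> space M" if "A \<in> S" for A using that S sets.sets_into_space by blast
  have S': "finite S'" "S' \<subseteq> sets M"
    unfolding S'_def using S F by (auto intro!: preimage_sets)
  have "A \<in> S'" if "A \<in> S" for A
  proof -
    have "{z \<in> space M. \<alpha> \<one> z \<in> A} = A" using Sp[OF that] by (auto simp: action_one)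
    then show ?thesis unfolding S'_def using F(3) that by (auto intro!: bexI[of _ "\<one>"] image_eqI[of _ _ A])
  qed
  then have SS': "S \<subseteq> S'" by auto
  show fC: "finite_partition M C"
    unfolding C by (rule finite_partition_generated_partition[OF S'])
  have P': "partition_on (space M) P" "finite P" "P \<subseteq> sets M" using P by (auto simp: finite_partition_def)
  show "refines (space M) C P"
    unfolding C by (rule refines_generated_partition[OF P'(1)]) (use P SS' in auto)
  have C': "partition_on (space M) C" "finite C" "C \<subseteq> sets M"
    using fC by (auto simp: finite_partition_def)
  define D where "D = translated_join \<alpha> F C"
  define S2 where "S2 = (\<Union>g\<in>F. (\<lambda>A. \<alpha> g ` A) ` C)"
  have D: "D = generated_partition (space M) S2"
    unfolding D_def S2_def by (rule translated_join_eq[OF F(2) _ C'(1)]) (use F in auto)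
  have fD: "finite_partition M D" unfolding D_def
    by (rule finite_partition_translated_join) (use F fC in auto)
  then have D': "partition_on (space M) D" "finite D" "D \<subseteq> sets M" by (auto simp: finite_partition_def)
  have V: "finite V" "V \<noteq> {}" and perm: "\<And>g. g \<in> carrier G \<Longrightarrow> \<sigma> g permutes V"
    using \<sigma> by (auto simp: sofic_approximation_def)
  have cV: "real (card V) > 0" using V by (simp add: card_gt_0_iff)
  have transl: "\<alpha> g ` c \<in> S2" if "g \<in> F" "c \<in> C" for g c using that by (auto simp: S2_def)
  have unionD: "\<exists>T\<subseteq>D. \<Union>T = A" if "A \<in> S2" "A \<subseteq> space M" for A
    using generated_partition_Union[OF that] by (intro exI[of _ "{B \<in> D. B \<subseteq> A}"]) (auto simp: D)
  have Cp: "c \<subseteq> space M" if "c \<in> C" for c using that C'(3) sets.sets_into_space by blast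
  have imgp: "\<alpha> g ` c \<subseteq> space M" if "g \<in> F" "c \<in> C" for g c
    using Cp[OF that(2)] F(2) that(1) by (auto intro!: action_closed)
  have one_img: "\<alpha> \<one> ` c = c" if "c \<in> C" for c using Cp[OF that] by (force simp: action_one)
  have unionDC: "\<exists>T\<subseteq>D. \<Union>T = c" if "c \<in> C" for c
    using unionD[of c] transl[OF F(3) that] Cp[OF that] by (simp add: one_img[OF that])
  have unionDS: "\<exists>T\<subseteq>D. \<Union>T = A" if A: "A \<in> S" for A
  proof -
    have "\<Union>{c \<in> C. c \<subseteq> A} = A"
      unfolding C by (rule generated_partition_Union) (use A SS' Sp in auto)
    moreover obtain T where T: "\<And>c. c \<in> C \<Longrightarrow> T c \<subseteq> D" "\<And>c. c \<in> C \<Longrightarrow> \<Union>(T c) = c"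
      using unionDC by metis
    moreover have "\<Union>(\<Union>c\<in>{c \<in> C. c \<subseteq> A}. T c) = (\<Union>c\<in>{c \<in> C. c \<subseteq> A}. \<Union>(T c))" by auto
    ultimately have "\<Union>(\<Union>c\<in>{c \<in> C. c \<subseteq> A}. T c) = A" by simp
    moreover have "(\<Union>c\<in>{c \<in> C. c \<subseteq> A}. T c) \<subseteq> D" using T(1) by auto
    ultimately show ?thesis by blast
  qed
  have point: "\<exists>x\<in>microstates M \<alpha> S F \<delta> V \<sigma>. \<forall>A\<in>P. \<phi> A = {v \<in> V. x v \<in> A}"
    if \<phi>: "\<phi> \<in> sofic_homs M \<alpha> C F \<delta> V \<sigma>" for \<phi>
  proof -
    have "\<phi> \<in> boolean_homs (space M) (generated_algebra (space M) D) V"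
      using \<phi> by (simp add: sofic_homs_def D_def)
    then obtain x where x: "x \<in> V \<rightarrow>\<^sub>E space M"
      and xT: "\<And>T. T \<subseteq> D \<Longrightarrow> \<phi> (\<Union>T) = {v \<in> V. x v \<in> \<Union>T}"
      using boolean_hom_point_map[OF _ D'(2,1)] by metis
    have xA: "\<phi> A = {v \<in> V. x v \<in> A}" if A: "A \<in> S \<union> C \<union> {\<alpha> g ` c |g c. g \<in> F \<and> c \<in> C}" for A
    proof -
      consider "A \<in> S" | "A \<in> C" | g c where "g \<in> F" "c \<in> C" "A = \<alpha> g ` c"
        using A by blast
      then have "\<exists>T\<subseteq>D. \<Union>T = A"
      proof cases
        case 3
        then show ?thesis using unionD[OF transl[of g c]] imgp[of g c] by simp
      qed (use unionDS unionDC in auto)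
      then show ?thesis using xT by blast
    qed
    have "real (card {v \<in> V. \<exists>A\<in>S. (x (\<sigma> g v) \<in> A) \<noteq> (\<alpha> g (x v) \<in> A)}) \<le> \<delta> * real (card V)"
      if g: "g \<in> F" for g
    proof -
      define bad where "bad = {v \<in> V. \<exists>A\<in>S. (x (\<sigma> g v) \<in> A) \<noteq> (\<alpha> g (x v) \<in> A)}"
      have gG: "g \<in> carrier G" using g F by auto
      define E where "E c = sym_diff (\<sigma> g ` \<phi> c) (\<phi> (\<alpha> g ` c))" for c
      have inj: "inj (\<sigma> g)" using perm[OF gG] by (rule permutes_inj)
      \<comment> \<open>Each bad \<open>v\<close> is charged to the part \<open>c\<close> of
        \<open>C\<close> that contains \<open>x v\<close>: its image \<open>\<sigma> g v\<close>
        lies in \<open>\<sigma> g\<close> applied to \<open>\<phi> c\<close>, but not in the value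
        of \<open>\<phi>\<close> at the translate of \<open>c\<close>.\<close>
      have "\<sigma> g ` bad \<subseteq> (\<Union>c\<in>C. E c)"
      proof
        fix w assume "w \<in> \<sigma> g ` bad"
        then obtain v A where v: "v \<in> V" "A \<in> S" "(x (\<sigma> g v) \<in> A) \<noteq> (\<alpha> g (x v) \<in> A)" "w = \<sigma> g v"
          by (auto simp: bad_def)
        have xv: "x v \<in> space M" using x v by auto
        then obtain c where c: "c \<in> C" "x v \<in> c" using C'(1) by (auto simp: partition_on_def)
        have 1: "w \<in> \<sigma> g ` \<phi> c" using c v xA[of c] by auto
        have 2: "w \<notin> \<phi> (\<alpha> g ` c)"
        proof
          assume "w \<in> \<phi> (\<alpha> g ` c)"
          then have "x w \<in> \<alpha> g ` c" using xA[of "\<alpha> g ` c"] g c by auto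
          then obtain z where z: "z \<in> c" "x w = \<alpha> g z" by auto
          \<comment> \<open>Since \<open>C\<close> refines the preimages of members of
            \<open>S\<close>, the part \<open>c\<close> lies on one side of this one, so
            \<open>z\<close> and \<open>x v\<close> cannot be told apart by it.\<close>
          have "{z \<in> space M. \<alpha> g z \<in> A} \<in> S'" using g v by (auto simp: S'_def)
          then have "\<alpha> g z \<in> A \<longleftrightarrow> \<alpha> g (x v) \<in> A"
            using generated_partition_cong[of c "space M" S' z "x v"] c z Cp[OF c(1)] xv C by auto
          then show False using v z by simp
        qed
        show "w \<in> (\<Union>c\<in>C. E c)" using 1 2 c by (auto simp: E_def)
      qed
      moreover have finE: "finite (E c)" if "c \<in> C" for c
      proof -
        have "\<phi> c \<subseteq> V" "\<phi> (\<alpha> g ` c) \<subseteq> V" using xA[of c] xA[of "\<alpha> g ` c"] that g by auto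
        then show ?thesis using V(1) by (auto simp: E_def intro: finite_subset)
      qed
      ultimately have "card (\<sigma> g ` bad) \<le> card (\<Union>c\<in>C. E c)"
        using C'(2) by (intro card_mono) auto
      also have "\<dots> \<le> (\<Sum>c\<in>C. card (E c))" by (rule card_UN_le[OF C'(2)])
      finally have "real (card bad) \<le> (\<Sum>c\<in>C. real (card (E c)))"
        by (metis card_image inj inj_on_subset of_nat_le_iff of_nat_sum subset_UNIV)
      also have "\<dots> = (\<Sum>c\<in>C. unif V (E c)) * real (card V)"
        using cV by (simp add: unif_def sum_distrib_right)
      also have "\<dots> \<le> \<delta> * real (card V)"
        using \<phi> g by (intro mult_right_mono) (auto simp: sofic_homs_def E_def intro: less_imp_le)
      finally show ?thesis by (simp add: bad_def)
    qed
    moreover have "\<bar>unif V {v \<in> V. x v \<in> A} - measure M A\<bar> \<le> \<delta>" if A: "A \<in> S" for A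
    proof -
      obtain T where T: "T \<subseteq> D" "\<Union>T = A" using unionDS[OF A] by auto
      have fT: "finite T" using T D'(2) finite_subset by blast
      have "disjoint D" using D'(1) by (simp add: partition_on_def)
      then have dT: "disjoint T" using T(1) unfolding disjoint_def by (meson subsetD)
      have "{v \<in> V. x v \<in> A} = (\<Union>d\<in>T. {v \<in> V. x v \<in> d})" using T by auto
      moreover have "card (\<Union>d\<in>T. {v \<in> V. x v \<in> d}) = (\<Sum>d\<in>T. card {v \<in> V. x v \<in> d})"
        by (rule card_UN_disjoint) (use fT V dT in \<open>auto simp: disjoint_def\<close>)
      ultimately have "unif V {v \<in> V. x v \<in> A} = (\<Sum>d\<in>T. unif V {v \<in> V. x v \<in> d})"
        by (simp add: unif_def sum_divide_distrib)
      also have "\<dots> = (\<Sum>d\<in>T. unif V (\<phi> d))"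
      proof (rule sum.cong[OF refl])
        fix d assume "d \<in> T"
        then show "unif V {v \<in> V. x v \<in> d} = unif V (\<phi> d)" using xT[of "{d}"] T by auto
      qed
      finally have 1: "unif V {v \<in> V. x v \<in> A} = (\<Sum>d\<in>T. unif V (\<phi> d))" .
      have 2: "measure M A = (\<Sum>d\<in>T. measure M d)"
      proof -
        have "measure M (\<Union>d\<in>T. d) = (\<Sum>d\<in>T. measure M d)"
          by (rule finite_measure_finite_Union)
             (use fT T D'(3) dT in \<open>auto simp: disjoint_family_on_def disjoint_def\<close>)
        then show ?thesis using T by simp
      qed
      have "\<bar>unif V {v \<in> V. x v \<in> A} - measure M A\<bar> \<le> (\<Sum>d\<in>T. \<bar>unif V (\<phi> d) - measure M d\<bar>)"
        unfolding 1 2 sum_subtractf[symmetric] by (rule sum_abs)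
      also have "\<dots> \<le> (\<Sum>d\<in>D. \<bar>unif V (\<phi> d) - measure M d\<bar>)"
        by (rule sum_mono2) (use T D' in auto)
      also have "\<dots> \<le> \<delta>" using \<phi> by (simp add: sofic_homs_def D_def)
      finally show ?thesis .
    qed
    ultimately have "x \<in> microstates M \<alpha> S F \<delta> V \<sigma>"
      using x by (simp add: microstates_def)
    then show ?thesis using xA P(2) by blast
  qed
  have "(\<lambda>\<phi>. restrict \<phi> P) ` sofic_homs M \<alpha> C F \<delta> V \<sigma>
      \<subseteq> (\<lambda>n. \<lambda>A\<in>P. {v \<in> V. A \<in> n v}) ` names V P ` microstates M \<alpha> S F \<delta> V \<sigma>"
  proof clarify
    fix \<phi> assume "\<phi> \<in> sofic_homs M \<alpha> C F \<delta> V \<sigma>"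
    then obtain x where x: "x \<in> microstates M \<alpha> S F \<delta> V \<sigma>" "\<forall>A\<in>P. \<phi> A = {v \<in> V. x v \<in> A}"
      using point by blast
    then have "restrict \<phi> P = (\<lambda>A\<in>P. {v \<in> V. A \<in> names V P x v})"
      by (auto simp: names_def fun_eq_iff)
    with x(1) show "restrict \<phi> P \<in> (\<lambda>n. \<lambda>A\<in>P. {v \<in> V. A \<in> n v}) ` names V P ` microstates M \<alpha> S F \<delta> V \<sigma>"
      by blast
  qed
  then show "count_on P (sofic_homs M \<alpha> C F \<delta> V \<sigma>) \<le> card (names V P ` microstates M \<alpha> S F \<delta> V \<sigma>)"
    unfolding count_on_def
    by (rule surj_card_le[rotated]) (rule finite_names_image[OF V(1) P'(2)])
qed

end

section \<open>Standard Borel spaces\<close>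

text \<open>Every open set is a countable union from a countable base, so the base generates the
  same sigma-algebra; being metrizable, the space is Hausdorff, and the base separates
  points.\<close>

lemma standard_borel_countable_base:
  assumes "standard_borel M"
  obtains U :: "nat \<Rightarrow> 'x set" where "sets M = sigma_sets (space M) (range U)"
    "\<And>i. U i \<in> sets M"
    "\<And>x y. x \<in> space M \<Longrightarrow> y \<in> space M \<Longrightarrow> x \<noteq> y \<Longrightarrow> \<exists>i. x \<in> U i \<and> y \<notin> U i"
proof -
  obtain T where T: "completely_metrizable_space T" "second_countable T" "topspace T = space M"
      "sets M = sigma_sets (space M) {U. openin T U}"
    using assms by (auto simp: standard_borel_def)
  obtain \<B> where B: "countable \<B>" "\<And>V. V \<in> \<B> \<Longrightarrow> openin T V"
      "\<And>U x. openin T U \<Longrightarrow> x \<in> U \<Longrightarrow> \<exists>V\<in>\<B>. x \<in> V \<and> V \<subseteq> U"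
    using T(2) unfolding second_countable_def by metis
  \<comment> \<open>The empty set is inserted so that there is something to enumerate even when the
    base is empty.\<close>
  define U where "U = from_nat_into (insert {} \<B>)"
  have rU: "range U = insert {} \<B>" unfolding U_def by (rule range_from_nat_into) (use B in auto)
  have open_U: "openin T V" if "V \<in> range U" for V using that B(2) by (auto simp: rU)
  have "sigma_sets (space M) {U. openin T U} = sigma_sets (space M) (range U)"
  proof (rule sigma_sets_eqI)
    fix V assume V: "V \<in> {U. openin T U}"
    then have "V = \<Union>{W \<in> range U. W \<subseteq> V}"
      using B(3)[of V] by (fastforce simp: rU)
    moreover have "countable (range U)" using B(1) by (simp add: rU)
    then have "countable {W \<in> range U. W \<subseteq> V}" by (rule countable_subset[rotated]) auto
    then have "\<Union>{W \<in> range U. W \<subseteq> V} \<in> sigma_sets (space M) (range U)"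
      by (rule sigma_sets_UNION) auto
    ultimately show "V \<in> sigma_sets (space M) (range U)" by simp
  next
    fix V assume "V \<in> range U"
    then show "V \<in> sigma_sets (space M) {U. openin T U}" using open_U by blast
  qed
  then have 1: "sets M = sigma_sets (space M) (range U)" using T(4) by simp
  have 2: "U i \<in> sets M" for i unfolding 1 by auto
  have 3: "\<exists>i. x \<in> U i \<and> y \<notin> U i" if xy: "x \<in> space M" "y \<in> space M" "x \<noteq> y" for x y
  proof -
    have "Hausdorff_space T"
      using T(1) completely_metrizable_imp_metrizable_space metrizable_imp_Hausdorff_space by blast
    then obtain V W where V: "openin T V" "openin T W" "x \<in> V" "y \<in> W" "disjnt V W"
      using xy T(3) unfolding Hausdorff_space_def by metis
    then obtain X where "X \<in> \<B>" "x \<in> X" "X \<subseteq> V" using B(3) by blast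
    moreover have "y \<notin> V" using V by (auto simp: disjnt_def)
    moreover have "X \<in> range U" using \<open>X \<in> \<B>\<close> rU by simp
    ultimately show ?thesis by blast
  qed
  show thesis by (rule that[OF 1 2 3])
qed

text \<open>Two values differ exactly if one of countably many measurable sets holds the first and
  not the second. This yields measurability of the level sets of the cocycles.\<close>

lemma sets_Collect_measurable_eq:
  fixes N :: "'b measure"
  assumes "standard_borel N" "f \<in> measurable M N" "g \<in> measurable M N"
  shows "{x \<in> space M. f x = g x} \<in> sets M"
proof -
  obtain U :: "nat \<Rightarrow> 'b set" where U: "\<And>i. U i \<in> sets N"
      "\<And>x y. x \<in> space N \<Longrightarrow> y \<in> space N \<Longrightarrow> x \<noteq> y \<Longrightarrow> \<exists>i. x \<in> U i \<and> y \<notin> U i"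
    using standard_borel_countable_base[OF assms(1)] by metis
  have "{x \<in> space M. f x = g x} = space M - (\<Union>i. (f -` U i \<inter> space M) - (g -` U i \<inter> space M))"
  proof (intro equalityI subsetI)
    fix x assume x: "x \<in> space M - (\<Union>i. (f -` U i \<inter> space M) - (g -` U i \<inter> space M))"
    have "f x = g x"
    proof (rule ccontr)
      assume "f x \<noteq> g x"
      moreover have "f x \<in> space N" "g x \<in> space N"
        using x assms(2,3) by (auto simp: measurable_def)
      ultimately show False using U(2)[of "f x" "g x"] x by auto
    qed
    then show "x \<in> {x \<in> space M. f x = g x}" using x by auto
  qed auto
  moreover have "(f -` U i \<inter> space M) - (g -` U i \<inter> space M) \<in> sets M" for i
    using U(1) assms(2,3) by (intro sets.Diff measurable_sets)
  ultimately show ?thesis by auto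
qed

section \<open>Entropy from microstates over a countable dense algebra\<close>

text \<open>The finite algebra generated by the first \<open>n\<close> sets, described by the points
  that its members cannot separate. As \<open>n\<close> grows, these algebras form a chain along
  which the conditions on microstates can be imposed one after another.\<close>

definition initial_algebra :: "'x set \<Rightarrow> (nat \<Rightarrow> 'x set) \<Rightarrow> nat \<Rightarrow> 'x set set" where
  "initial_algebra \<Omega> b n =
     {A \<in> Pow \<Omega>. \<forall>z\<in>\<Omega>. \<forall>w\<in>\<Omega>. (\<forall>i<n. z \<in> b i \<longleftrightarrow> w \<in> b i) \<longrightarrow> (z \<in> A \<longleftrightarrow> w \<in> A)}"

lemma initial_algebraI:
  assumes "A \<subseteq> \<Omega>"
    and "\<And>z w. z \<in> \<Omega> \<Longrightarrow> w \<in> \<Omega> \<Longrightarrow> (\<And>i. i < n \<Longrightarrow> z \<in> b i \<longleftrightarrow> w \<in> b i) \<Longrightarrow> z \<in> A \<Longrightarrow> w \<in> A"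
  shows "A \<in> initial_algebra \<Omega> b n"
  unfolding initial_algebra_def
proof (rule CollectI, intro conjI ballI impI)
  fix z w assume "z \<in> \<Omega>" "w \<in> \<Omega>" "\<forall>i<n. z \<in> b i \<longleftrightarrow> w \<in> b i"
  then show "z \<in> A \<longleftrightarrow> w \<in> A" using assms(2)[of z w] assms(2)[of w z] by metis
qed (use assms in simp)

lemma initial_algebra_subset: "A \<in> initial_algebra \<Omega> b n \<Longrightarrow> A \<subseteq> \<Omega>"
  by (simp add: initial_algebra_def)

lemma initial_algebra_cong:
  assumes "A \<in> initial_algebra \<Omega> b n" "z \<in> \<Omega>" "w \<in> \<Omega>" "\<And>i. i < n \<Longrightarrow> z \<in> b i \<longleftrightarrow> w \<in> b i"
  shows "z \<in> A \<longleftrightarrow> w \<in> A"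
proof -
  have "\<forall>z\<in>\<Omega>. \<forall>w\<in>\<Omega>. (\<forall>i<n. z \<in> b i \<longleftrightarrow> w \<in> b i) \<longrightarrow> (z \<in> A \<longleftrightarrow> w \<in> A)"
    using assms(1) unfolding initial_algebra_def by (rule CollectE) (rule conjunct2)
  moreover have "\<forall>i<n. z \<in> b i \<longleftrightarrow> w \<in> b i" using assms(4) by (intro allI impI)
  ultimately show ?thesis using assms(2,3) by blast
qed

lemma initial_algebra_mono:
  assumes "n \<le> m"
  shows "initial_algebra \<Omega> b n \<subseteq> initial_algebra \<Omega> b m"
proof
  fix A assume A: "A \<in> initial_algebra \<Omega> b n"
  show "A \<in> initial_algebra \<Omega> b m"
  proof (rule initial_algebraI[OF initial_algebra_subset[OF A]])
    fix z w assume h: "z \<in> \<Omega>" "w \<in> \<Omega>" "\<And>i. i < m \<Longrightarrow> z \<in> b i \<longleftrightarrow> w \<in> b i" "z \<in> A"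
    have "z \<in> A \<longleftrightarrow> w \<in> A"
      by (rule initial_algebra_cong[OF A h(1,2) h(3)]) (use assms in simp)
    with h(4) show "w \<in> A" by simp
  qed
qed

lemma initial_algebra_base:
  assumes "i < n" "b i \<subseteq> \<Omega>"
  shows "b i \<in> initial_algebra \<Omega> b n"
proof (rule initial_algebraI[OF assms(2)])
  fix z w assume "\<And>j. j < n \<Longrightarrow> z \<in> b j \<longleftrightarrow> w \<in> b j" "z \<in> b i"
  then show "w \<in> b i" using assms(1) by blast
qed

lemma initial_algebra_subset_Union:
  "initial_algebra \<Omega> b n \<subseteq> Union ` Pow (generated_partition \<Omega> (b ` {..<n}))"
proof
  fix A assume A: "A \<in> initial_algebra \<Omega> b n"
  have "\<Union>{B \<in> generated_partition \<Omega> (b ` {..<n}). B \<subseteq> A} = A"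
  proof
    show "A \<subseteq> \<Union>{B \<in> generated_partition \<Omega> (b ` {..<n}). B \<subseteq> A}"
    proof
      fix z assume z: "z \<in> A"
      define B where "B = {w \<in> \<Omega>. \<forall>A\<in>b ` {..<n}. w \<in> A \<longleftrightarrow> z \<in> A}"
      have "z \<in> \<Omega>" using initial_algebra_subset[OF A] z by auto
      then have "B \<in> generated_partition \<Omega> (b ` {..<n})" "z \<in> B"
        by (auto simp: B_def generated_partition_def)
      moreover have "B \<subseteq> A" 
      proof
        fix w assume "w \<in> B"
        then have "w \<in> A \<longleftrightarrow> z \<in> A"
          using \<open>z \<in> \<Omega>\<close> by (intro initial_algebra_cong[OF A]) (auto simp: B_def)
        with z show "w \<in> A" by simp
      qed
      ultimately show "z \<in> \<Union>{B \<in> generated_partition \<Omega> (b ` {..<n}). B \<subseteq> A}" by blast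
    qed
  qed auto
  then show "A \<in> Union ` Pow (generated_partition \<Omega> (b ` {..<n}))" by (intro image_eqI[OF sym]) auto
qed

lemma finite_initial_algebra: "finite (initial_algebra \<Omega> b n)"
  by (rule finite_subset[OF initial_algebra_subset_Union]) (simp add: finite_generated_partition)

lemma sets_initial_algebra:
  assumes "\<And>i. b i \<in> sets M"
  shows "initial_algebra (space M) b n \<subseteq> sets M"
proof
  fix A assume "A \<in> initial_algebra (space M) b n"
  then have "A \<in> Union ` Pow (generated_partition (space M) (b ` {..<n}))"
    by (rule subsetD[OF initial_algebra_subset_Union])
  then obtain T where T: "T \<subseteq> generated_partition (space M) (b ` {..<n})" "A = \<Union>T" by auto
  have "finite (b ` {..<n})" "b ` {..<n} \<subseteq> sets M" using assms by auto
  then have "finite (generated_partition (space M) (b ` {..<n}))"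
      "generated_partition (space M) (b ` {..<n}) \<subseteq> sets M"
    by (simp_all add: finite_generated_partition sets_generated_partition)
  then have "finite T" "T \<subseteq> sets M" using T(1) finite_subset by auto
  then show "A \<in> sets M" unfolding T(2) by (rule sets.finite_Union)
qed

text \<open>The sets that can be approximated form a sigma-algebra. For a countable union, a tail of
  small measure is dropped and the remaining finitely many members are approximated within one
  common algebra of the chain.\<close>

lemma (in prob_space) initial_algebra_dense:
  assumes b: "\<And>i. b i \<in> sets M" and gen: "sets M \<subseteq> sigma_sets (space M) (range b)"
    and A: "A \<in> sets M" and "\<epsilon> > 0"
  shows "\<exists>n. \<exists>B\<in>initial_algebra (space M) b n. measure M (sym_diff A B) < \<epsilon>"
proof -
  have algM: "B \<in> sets M" if "B \<in> initial_algebra (space M) b n" for B n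
    using that sets_initial_algebra[of b M n] b by blast
  have "A \<in> sigma_sets (space M) (range b)" using A gen by auto
  then have "A \<in> sets M \<and> (\<forall>\<epsilon>>0. \<exists>n. \<exists>B\<in>initial_algebra (space M) b n. measure M (sym_diff A B) < \<epsilon>)"
  proof (induction A rule: sigma_sets.induct)
    case (Basic a)
    then obtain i where a: "a = b i" by auto
    have "b i \<in> initial_algebra (space M) b (Suc i)"
      by (rule initial_algebra_base) (use b sets.sets_into_space in auto)
    moreover have "measure M (sym_diff a (b i)) = 0" by (simp add: a)
    ultimately show ?case using a b[of i] by force
  next
    case Empty
    have "{} \<in> initial_algebra (space M) b 0" by (auto intro: initial_algebraI)
    then show ?case by (intro conjI allI impI) (auto intro!: exI[of _ 0] bexI[of _ "{}"])
  next
    case (Compl a)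
    show ?case
    proof (intro conjI allI impI)
      show "space M - a \<in> sets M" using Compl by auto
      fix \<epsilon> :: real assume "\<epsilon> > 0"
      then obtain n B where B: "B \<in> initial_algebra (space M) b n" "measure M (sym_diff a B) < \<epsilon>"
        using Compl by blast
      have "a \<subseteq> space M" "B \<subseteq> space M" using Compl.IH algM[OF B(1)] sets.sets_into_space by auto
      then have "sym_diff (space M - a) (space M - B) = sym_diff a B" by auto
      moreover have "space M - B \<in> initial_algebra (space M) b n"
      proof (rule initial_algebraI)
        fix z w assume h: "z \<in> space M" "w \<in> space M" "\<And>i. i < n \<Longrightarrow> z \<in> b i \<longleftrightarrow> w \<in> b i" "z \<in> space M - B"
        then show "w \<in> space M - B" using initial_algebra_cong[OF B(1) h(1,2)] by simp
      qed auto
      ultimately show "\<exists>n. \<exists>B\<in>initial_algebra (space M) b n. measure M (sym_diff (space M - a) B) < \<epsilon>"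
        using B(2) by metis
    qed
  next
    case (Union a)
    have aM: "a i \<in> sets M" for i using Union by blast
    show ?case
    proof (intro conjI allI impI)
      show "\<Union>(range a) \<in> sets M" using aM by auto
      fix \<epsilon> :: real assume "\<epsilon> > 0"
      define D where "D m = (\<Union>i. a i) - (\<Union>i<m. a i)" for m
      have "(\<lambda>m. measure M (D m)) \<longlonglongrightarrow> measure M (\<Inter>m. D m)"
        by (rule finite_Lim_measure_decseq) (use aM in \<open>auto simp: D_def decseq_def\<close>)
      moreover have "(\<Inter>m. D m) = {}" by (auto simp: D_def)
      ultimately have "(\<lambda>m. measure M (D m)) \<longlonglongrightarrow> 0" by simp
      then have "eventually (\<lambda>m. measure M (D m) < \<epsilon> / 2) sequentially"
        by (rule order_tendstoD) (use \<open>\<epsilon> > 0\<close> in simp)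
      then obtain m where m: "measure M (D m) < \<epsilon> / 2" by (auto simp: eventually_sequentially)
      \<comment> \<open>The \<open>m\<close> approximations together may cost
        \<open>\<epsilon> / 2\<close>, the other half being spent on the tail; \<open>Suc m\<close>
        avoids division by zero.\<close>
      define \<eta> where "\<eta> = \<epsilon> / (2 * real (Suc m))"
      have "\<eta> > 0" using \<open>\<epsilon> > 0\<close> by (simp add: \<eta>_def)
      have "\<exists>p. snd p \<in> initial_algebra (space M) b (fst p) \<and> measure M (sym_diff (a i) (snd p)) < \<eta>" for i
      proof -
        obtain n B where "B \<in> initial_algebra (space M) b n" "measure M (sym_diff (a i) B) < \<eta>"
          using Union.IH[of i] \<open>\<eta> > 0\<close> by blast
        then show ?thesis by (intro exI[of _ "(n, B)"]) simp
      qed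
      then obtain p where p: "\<And>i. snd (p i) \<in> initial_algebra (space M) b (fst (p i)) \<and>
          measure M (sym_diff (a i) (snd (p i))) < \<eta>" by metis
      define n B where "n i = fst (p i)" and "B i = snd (p i)" for i
      have B: "\<And>i. B i \<in> initial_algebra (space M) b (n i)"
          "\<And>i. measure M (sym_diff (a i) (B i)) < \<eta>" using p by (auto simp: n_def B_def)
      define k where "k = (\<Sum>i<m. n i)"
      have "B i \<in> initial_algebra (space M) b k" if "i < m" for i
      proof -
        have "n i \<le> k" unfolding k_def by (rule member_le_sum) (use that in auto)
        then show ?thesis using B(1) initial_algebra_mono by blast
      qed
      then have Bk: "B i \<in> initial_algebra (space M) b k" if "i < m" for i
        using that by blast
      have "(\<Union>i<m. B i) \<in> initial_algebra (space M) b k"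
      proof (rule initial_algebraI)
        show "(\<Union>i<m. B i) \<subseteq> space M" using initial_algebra_subset[OF Bk] by auto
        fix z w assume h: "z \<in> space M" "w \<in> space M" "\<And>i. i < k \<Longrightarrow> z \<in> b i \<longleftrightarrow> w \<in> b i" "z \<in> (\<Union>i<m. B i)"
        then show "w \<in> (\<Union>i<m. B i)" using initial_algebra_cong[OF Bk h(1,2)] by auto
      qed
      moreover have "measure M (sym_diff (\<Union>i. a i) (\<Union>i<m. B i)) < \<epsilon>"
      proof -
        have "sym_diff (\<Union>i. a i) (\<Union>i<m. B i) \<subseteq> D m \<union> (\<Union>i<m. sym_diff (a i) (B i))"
          unfolding D_def by blast
        then have "measure M (sym_diff (\<Union>i. a i) (\<Union>i<m. B i))
            \<le> measure M (D m \<union> (\<Union>i<m. sym_diff (a i) (B i)))"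
          by (rule finite_measure_mono) (use aM algM B in \<open>auto simp: D_def\<close>)
        also have "\<dots> \<le> measure M (D m) + measure M (\<Union>i<m. sym_diff (a i) (B i))"
          by (rule measure_Un_le) (use aM algM B in \<open>auto simp: D_def\<close>)
        also have "measure M (\<Union>i<m. sym_diff (a i) (B i)) \<le> (\<Sum>i<m. measure M (sym_diff (a i) (B i)))"
          by (rule measure_UNION_le) (use aM algM B in auto)
        also have "\<dots> \<le> (\<Sum>i<m. \<eta>)" by (rule sum_mono) (use B less_imp_le in auto)
        also have "\<dots> = \<epsilon> / 2 * (real m / real (Suc m))" by (simp add: \<eta>_def)
        also have "\<dots> \<le> \<epsilon> / 2 * 1" by (rule mult_left_mono) (use \<open>\<epsilon> > 0\<close> in auto)
        finally show ?thesis using m by linarith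
      qed
      ultimately show "\<exists>n. \<exists>B\<in>initial_algebra (space M) b n. measure M (sym_diff (\<Union>(range a)) B) < \<epsilon>"
        by blast
    qed
  qed
  then show ?thesis using \<open>\<epsilon> > 0\<close> by blast
qed

lemma microstates_mono:
  assumes "finite V" "S' \<subseteq> S" "F' \<subseteq> F" "\<delta> \<le> \<delta>'"
  shows "microstates M \<alpha> S F \<delta> V \<sigma> \<subseteq> microstates M \<alpha> S' F' \<delta>' V \<sigma>"
proof
  fix x assume x: "x \<in> microstates M \<alpha> S F \<delta> V \<sigma>"
  have "real (card {v \<in> V. \<exists>A\<in>S'. (x (\<sigma> g v) \<in> A) \<noteq> (\<alpha> g (x v) \<in> A)}) \<le> \<delta>' * real (card V)"
    if "g \<in> F'" for g
  proof -
    have "card {v \<in> V. \<exists>A\<in>S'. (x (\<sigma> g v) \<in> A) \<noteq> (\<alpha> g (x v) \<in> A)}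
        \<le> card {v \<in> V. \<exists>A\<in>S. (x (\<sigma> g v) \<in> A) \<noteq> (\<alpha> g (x v) \<in> A)}"
      by (rule card_mono) (use assms in auto)
    also have "real \<dots> \<le> \<delta> * real (card V)"
      using x that assms by (auto simp: microstates_def)
    also have "\<dots> \<le> \<delta>' * real (card V)" using assms by (simp add: mult_right_mono)
    finally show ?thesis by simp
  qed
  moreover have "\<bar>unif V {v \<in> V. x v \<in> A} - measure M A\<bar> \<le> \<delta>'" if "A \<in> S'" for A
    using x that assms(2,4) by (fastforce simp: microstates_def)
  ultimately show "x \<in> microstates M \<alpha> S' F' \<delta>' V \<sigma>"
    using x by (simp add: microstates_def)
qed

lemma good_approximation_mono:
  "good_approximation G F \<delta> V \<sigma> \<Longrightarrow> F' \<subseteq> F \<Longrightarrow> \<delta> \<le> \<delta>' \<Longrightarrow> good_approximation G F' \<delta>' V \<sigma>"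
  unfolding good_approximation_def by (smt (verit) subset_iff)

lemma measure_diff_le_sym_diff:
  assumes "finite_measure M" "A \<in> sets M" "B \<in> sets M" "C \<in> sets M" "sym_diff A B \<subseteq> C"
  shows "\<bar>measure M A - measure M B\<bar> \<le> measure M C"
proof -
  interpret finite_measure M by fact
  have "measure M A \<le> measure M (B \<union> C)" "measure M B \<le> measure M (A \<union> C)"
    by (rule finite_measure_mono; use assms in auto)+
  moreover have "measure M (B \<union> C) \<le> measure M B + measure M C"
      "measure M (A \<union> C) \<le> measure M A + measure M C"
    using assms by (auto intro: measure_Un_le)
  ultimately show ?thesis by linarith
qed

lemma unif_diff_le_sym_diff:
  assumes "finite V" "A \<subseteq> V" "B \<subseteq> V" "C \<subseteq> V" "sym_diff A B \<subseteq> C"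
  shows "\<bar>unif V A - unif V B\<bar> \<le> unif V C"
proof -
  have "finite A" "finite B" "finite C" using assms by (auto intro: finite_subset)
  then have "card A \<le> card (B \<union> C)" "card B \<le> card (A \<union> C)"
    using assms(5) by (auto intro!: card_mono)
  then have "card A \<le> card B + card C" "card B \<le> card A + card C"
    using card_Un_le[of B C] card_Un_le[of A C] by linarith+
  then have "\<bar>real (card A) - real (card B)\<bar> \<le> real (card C)" by linarith
  then show ?thesis
    unfolding unif_def diff_divide_distrib[symmetric] abs_divide by (simp add: divide_right_mono)
qed

section \<open>From microstates back to homomorphisms, and criteria for entropy\<close>

context pmp_action
begin

text \<open>Homomorphisms are extensional, so their value at a translate is meaningful only once the
  translate is known to lie in the algebra.\<close>

lemma image_in_generated_algebra:
  assumes F: "finite F" "F \<subseteq> carrier G" "g \<in> F" and C: "finite_partition M C" "c \<in> C"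
  shows "\<alpha> g ` c \<in> generated_algebra (space M) (translated_join \<alpha> F C)"
proof -
  have part: "partition_on (space M) C" and "C \<subseteq> sets M" using C by (auto simp: finite_partition_def)
  have ne: "F \<noteq> {}" using F by auto
  have "finite_partition M (translated_join \<alpha> F C)"
    by (rule finite_partition_translated_join) (use F C in auto)
  then have D: "finite (translated_join \<alpha> F C)" "translated_join \<alpha> F C \<subseteq> Pow (space M)"
    using sets.sets_into_space by (auto simp: finite_partition_def)
  have "\<alpha> g ` c \<in> sets M" using C \<open>C \<subseteq> sets M\<close> F by (intro image_sets) auto
  then have "\<alpha> g ` c \<subseteq> space M" by (rule sets.sets_into_space)
  then have "\<Union>{d \<in> translated_join \<alpha> F C. d \<subseteq> \<alpha> g ` c} = \<alpha> g ` c"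
    unfolding translated_join_eq[OF F(2) ne part]
    by (intro generated_partition_Union) (use F C in auto)
  moreover have "\<Union>{d \<in> translated_join \<alpha> F C. d \<subseteq> \<alpha> g ` c} \<in> generated_algebra (space M) (translated_join \<alpha> F C)"
    by (rule generated_algebra_Union) (use D in auto)
  ultimately show ?thesis by simp
qed

text \<open>
  A microstate for the approximants \<open>q c\<close> of the parts \<open>c \<in> C\<close> is moved into the set \<open>E\<close> of
  points at which all relevant translates of \<open>c\<close> and \<open>q c\<close> agree, keeping its name. There the
  approximants may be replaced by the parts themselves.
\<close>

lemma count_microstates_le_sofic_homs:
  assumes b: "\<And>i. b i \<in> sets M" and gen: "sets M \<subseteq> sigma_sets (space M) (range b)"
    and transl: "\<And>i g. g \<in> carrier G \<Longrightarrow> \<exists>j. b j = \<alpha> g ` b i"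
    and R: "R \<subseteq> initial_algebra (space M) b n0"
    and C: "finite_partition M C" "refines (space M) C (generated_partition (space M) R)"
    and F: "finite F" "F \<subseteq> carrier G" "\<one> \<in> F" and \<delta>: "\<delta> > 0"
  shows "\<exists>n \<delta>'. \<delta>' > 0 \<and> (\<forall>(V::'v set) \<sigma>. sofic_approximation G V \<sigma> \<longrightarrow>
     card (names V R ` microstates M \<alpha> (initial_algebra (space M) b n) F \<delta>' V \<sigma>)
       \<le> count_on (generated_partition (space M) R) (sofic_homs M \<alpha> C F \<delta> V \<sigma>))"
proof -
  let ?\<A> = "initial_algebra (space M) b"
  define P where "P = generated_partition (space M) R"
  define D where "D = translated_join \<alpha> F C"
  have algM: "A \<in> sets M" if "A \<in> ?\<A> n" for A n using that sets_initial_algebra[of b M n] b by blast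
  have bsp: "b i \<subseteq> space M" for i using b sets.sets_into_space by blast
  have C': "partition_on (space M) C" "finite C" "C \<subseteq> sets M" using C by (auto simp: finite_partition_def)
  have Csp: "c \<subseteq> space M" if "c \<in> C" for c using that C' sets.sets_into_space by blast
  have Fne: "F \<noteq> {}" using F by auto
  have "finite_partition M D" unfolding D_def by (rule finite_partition_translated_join[OF F(2,1) Fne C(1)])
  then have D': "partition_on (space M) D" "finite D" "D \<subseteq> sets M" by (auto simp: finite_partition_def)
  have Dgen: "D = generated_partition (space M) (\<Union>g\<in>F. (\<lambda>A. \<alpha> g ` A) ` C)"
    unfolding D_def by (rule translated_join_eq[OF F(2) Fne C'(1)])
  have transl_alg: "\<exists>m. \<alpha> g ` A \<in> ?\<A> m" if g: "g \<in> carrier G" and A: "A \<in> ?\<A> n" for g A n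
  proof -
    obtain j where j: "\<And>i. b (j i) = \<alpha> g ` b i" using transl[OF g] by metis
    define m where "m = Suc (\<Sum>i<n. j i)"
    have jm: "j i < m" if "i < n" for i
      unfolding m_def using member_le_sum[of i "{..<n}" j] that by simp
    have Asp: "A \<subseteq> space M" by (rule initial_algebra_subset[OF A])
    have "\<alpha> g ` A \<in> ?\<A> m"
    proof (rule initial_algebraI)
      show "\<alpha> g ` A \<subseteq> space M" using Asp g by (auto intro: action_closed)
      fix z w assume h: "z \<in> space M" "w \<in> space M" "\<And>i. i < m \<Longrightarrow> z \<in> b i \<longleftrightarrow> w \<in> b i" "z \<in> \<alpha> g ` A"
      have ginv: "inv g \<in> carrier G" using g group.inv_closed[OF group_G] by simp
      have eq: "x \<in> \<alpha> g ` B \<longleftrightarrow> \<alpha> (inv g) x \<in> B" if "x \<in> space M" "B \<subseteq> space M" for x B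
        using image_eq_preimage[OF g that(2)] that(1) by simp
      have "\<alpha> (inv g) z \<in> A \<longleftrightarrow> \<alpha> (inv g) w \<in> A"
      proof (rule initial_algebra_cong[OF A])
        fix i assume "i < n"
        then show "\<alpha> (inv g) z \<in> b i \<longleftrightarrow> \<alpha> (inv g) w \<in> b i"
          using h(3)[OF jm[of i]] eq[OF h(1) bsp, of i] eq[OF h(2) bsp, of i] j[of i] by simp
      qed (use h ginv in \<open>auto intro: action_closed\<close>)
      then show "w \<in> \<alpha> g ` A" using h eq Asp by simp
    qed
    then show ?thesis by blast
  qed
  \<comment> \<open>\<open>K\<close> counts the pairs over which the errors \<open>\<eta>\<close>
    are summed to at most \<open>\<epsilon>\<close>. \<open>L\<close> dominates the number of terms
    in both sums defining \<open>sofic_homs\<close>; each term will be at most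
    \<open>5 * \<epsilon>\<close>, so dividing by 8 leaves a strict inequality.\<close>
  define K where "K = real (card F) * real (card C)"
  define L where "L = real (card C + card D + 1)"
  define \<epsilon> where "\<epsilon> = \<delta> / (8 * L)"
  define \<eta> where "\<eta> = \<epsilon> / (K + 1)"
  have L: "L \<ge> 1" "L \<ge> real (card C)" "L \<ge> real (card D)" by (auto simp: L_def)
  have K: "K \<ge> 0" by (simp add: K_def)
  have \<epsilon>: "\<epsilon> > 0" using \<delta> L by (simp add: \<epsilon>_def)
  have \<eta>: "\<eta> > 0" using \<epsilon> K by (simp add: \<eta>_def)
  have K\<eta>: "K * \<eta> \<le> \<epsilon>" using K \<epsilon> by (simp add: \<eta>_def pos_divide_le_eq field_simps)
  have "\<exists>B. (\<exists>n. B \<in> ?\<A> n) \<and> measure M (sym_diff c B) < \<eta>" if "c \<in> C" for c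
    using initial_algebra_dense[OF b gen _ \<eta>, of c] that C'(3) by blast
  then obtain q where q: "\<And>c. c \<in> C \<Longrightarrow> \<exists>n. q c \<in> ?\<A> n" "\<And>c. c \<in> C \<Longrightarrow> measure M (sym_diff c (q c)) < \<eta>"
    by metis
  have "\<forall>g\<in>F. \<forall>c\<in>C. \<exists>m. \<alpha> g ` q c \<in> ?\<A> m" using q(1) transl_alg F(2) by blast
  then obtain m where m: "\<And>g c. g \<in> F \<Longrightarrow> c \<in> C \<Longrightarrow> \<alpha> g ` q c \<in> ?\<A> (m g c)" by metis
  define n where "n = n0 + (\<Sum>g\<in>F. \<Sum>c\<in>C. m g c)"
  have qn: "\<alpha> g ` q c \<in> ?\<A> n" if "g \<in> F" "c \<in> C" for g c
  proof -
    have "m g c \<le> (\<Sum>c\<in>C. m g c)" by (rule member_le_sum) (use that C' in auto)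
    also have "\<dots> \<le> (\<Sum>g\<in>F. \<Sum>c\<in>C. m g c)"
      by (rule member_le_sum[where f = "\<lambda>g. \<Sum>c\<in>C. m g c"]) (use that F in auto)
    finally have "m g c \<le> n" by (simp add: n_def)
    then show ?thesis using m[OF that] initial_algebra_mono by blast
  qed
  have qsp: "q c \<subseteq> space M" if "c \<in> C" for c using q(1)[OF that] initial_algebra_subset by blast
  have qM: "q c \<in> sets M" if "c \<in> C" for c using q(1)[OF that] algM by blast
  have Rn: "R \<subseteq> ?\<A> n" using R initial_algebra_mono[of n0 n] by (auto simp: n_def)
  define \<T> where "\<T> = R \<union> (\<Union>g\<in>F. (\<lambda>c. \<alpha> g ` q c) ` C)"
  have \<T>: "\<T> \<subseteq> ?\<A> n" using Rn qn by (auto simp: \<T>_def)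
  define E where "E = {z \<in> space M. \<forall>g\<in>F. \<forall>c\<in>C. z \<in> \<alpha> g ` c \<longleftrightarrow> z \<in> \<alpha> g ` q c}"
  define Z where "Z = (\<Union>p\<in>F \<times> C. \<alpha> (fst p) ` sym_diff (snd p) (q (snd p)))"
  have sdM: "\<alpha> g ` sym_diff c (q c) \<in> sets M" if "g \<in> F" "c \<in> C" for g c
    using that F C' qM by (intro image_sets) auto
  have ZM: "Z \<in> sets M" unfolding Z_def
    by (rule sets.finite_UN) (use F C' sdM in auto)
  have mZ: "measure M Z \<le> \<epsilon>"
  proof -
    have "measure M Z \<le> (\<Sum>p\<in>F \<times> C. measure M (\<alpha> (fst p) ` sym_diff (snd p) (q (snd p))))"
      unfolding Z_def by (rule measure_UNION_le) (use F C' sdM in auto)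
    also have "\<dots> \<le> (\<Sum>p\<in>F \<times> C. \<eta>)"
    proof (rule sum_mono)
      fix p assume "p \<in> F \<times> C"
      then show "measure M (\<alpha> (fst p) ` sym_diff (snd p) (q (snd p))) \<le> \<eta>"
        using q(2) qM C' F by (subst measure_image) (auto intro: less_imp_le)
    qed
    also have "\<dots> = K * \<eta>" by (simp add: K_def card_cartesian_product)
    finally show ?thesis using K\<eta> by simp
  qed
  have EZ: "z \<in> E" if "z \<in> space M" "z \<notin> Z" for z
  proof -
    have "z \<in> \<alpha> g ` c \<longleftrightarrow> z \<in> \<alpha> g ` q c" if "g \<in> F" "c \<in> C" for g c
    proof -
      have "z \<notin> \<alpha> g ` (sym_diff c (q c))" using \<open>z \<notin> Z\<close> that by (auto simp: Z_def)
      moreover have gG: "g \<in> carrier G" and sub: "c \<subseteq> space M" "q c \<subseteq> space M"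
        using that F Csp qsp by auto
      moreover have "\<alpha> g ` (sym_diff c (q c)) = {z \<in> space M. \<alpha> (inv g) z \<in> sym_diff c (q c)}"
        by (rule image_eq_preimage[OF gG]) (use sub in auto)
      moreover have "\<alpha> g ` c = {z \<in> space M. \<alpha> (inv g) z \<in> c}" "\<alpha> g ` q c = {z \<in> space M. \<alpha> (inv g) z \<in> q c}"
        by (rule image_eq_preimage[OF gG sub(1)], rule image_eq_preimage[OF gG sub(2)])
      ultimately show ?thesis using \<open>z \<in> space M\<close> by auto
    qed
    then show ?thesis using that by (simp add: E_def)
  qed
  \<comment> \<open>Points whose \<open>\<T>\<close>-name is shared by no point of \<open>E\<close>
    cannot be moved there. Being defined through names, \<open>X\<close> belongs to the finite
    algebra that the microstates are tested on, so its frequency is controlled; this need not hold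
    for the larger set \<open>Z\<close>.\<close>
  define X where "X = {z \<in> space M. \<not> (\<exists>w\<in>E. \<forall>A\<in>\<T>. w \<in> A \<longleftrightarrow> z \<in> A)}"
  have \<T>cong: "z \<in> A \<longleftrightarrow> w \<in> A"
    if "A \<in> \<T>" "z \<in> space M" "w \<in> space M" "\<And>i. i < n \<Longrightarrow> z \<in> b i \<longleftrightarrow> w \<in> b i" for z w A
    by (rule initial_algebra_cong[OF subsetD[OF \<T> that(1)] that(2,3) that(4)])
  have Xn: "X \<in> ?\<A> n"
  proof (rule initial_algebraI)
    fix z w assume h: "z \<in> space M" "w \<in> space M" "\<And>i. i < n \<Longrightarrow> z \<in> b i \<longleftrightarrow> w \<in> b i" "z \<in> X"
    have "\<forall>A\<in>\<T>. z \<in> A \<longleftrightarrow> w \<in> A" using \<T>cong[OF _ h(1,2) h(3)] by blast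
    then show "w \<in> X" using h(2,4) by (simp add: X_def)
  qed (auto simp: X_def)
  have XZ: "X \<subseteq> Z" using EZ by (auto simp: X_def)
  have "measure M X \<le> measure M Z" by (rule finite_measure_mono[OF XZ ZM])
  then have mX: "measure M X \<le> \<epsilon>" using mZ by simp
  \<comment> \<open>Leaving the points of \<open>X\<close> where they are preserves
    \<open>R\<close>-names everywhere, which the final count relies on.\<close>
  define r where "r z = (if z \<in> X then z else SOME w. w \<in> E \<and> (\<forall>A\<in>\<T>. w \<in> A \<longleftrightarrow> z \<in> A))" for z
  have r: "r z \<in> E" "\<And>A. A \<in> \<T> \<Longrightarrow> r z \<in> A \<longleftrightarrow> z \<in> A" if "z \<in> space M" "z \<notin> X" for z
  proof -
    have "\<exists>w. w \<in> E \<and> (\<forall>A\<in>\<T>. w \<in> A \<longleftrightarrow> z \<in> A)" using that by (auto simp: X_def)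
    from someI_ex[OF this] that(2) show "r z \<in> E" "\<And>A. A \<in> \<T> \<Longrightarrow> r z \<in> A \<longleftrightarrow> z \<in> A"
      by (simp_all add: r_def)
  qed
  have rR: "r z \<in> A \<longleftrightarrow> z \<in> A" if "z \<in> space M" "A \<in> R" for z A
    using r(2)[of z A] that by (cases "z \<in> X") (simp_all add: r_def \<T>_def)
  have rsp: "r z \<in> space M" if "z \<in> space M" for z
    using r(1)[of z] that by (cases "z \<in> X") (simp_all add: r_def E_def)
  have rC: "r z \<in> \<alpha> g ` c \<longleftrightarrow> z \<in> \<alpha> g ` q c" if z: "z \<in> space M" "z \<notin> X" and g: "g \<in> F" and c: "c \<in> C" for z g c
  proof -
    have "r z \<in> \<alpha> g ` c \<longleftrightarrow> r z \<in> \<alpha> g ` q c" using r(1)[OF z] g c by (simp add: E_def)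
    also have "\<dots> \<longleftrightarrow> z \<in> \<alpha> g ` q c" using r(2)[OF z, of "\<alpha> g ` q c"] g c by (auto simp: \<T>_def)
    finally show ?thesis .
  qed
  have one_img: "\<alpha> \<one> ` c = c" if "c \<subseteq> space M" for c using that by (force simp: action_one)
  have Psp: "B \<subseteq> space M" if "B \<in> P" for B using that by (auto simp: P_def generated_partition_def)
  have dcong: "w \<in> d"
    if d: "d \<in> D" "z \<in> d" and w: "w \<in> space M" and same: "\<And>g c. g \<in> F \<Longrightarrow> c \<in> C \<Longrightarrow> z \<in> \<alpha> g ` c \<longleftrightarrow> w \<in> \<alpha> g ` c"
    for d z w
  proof -
    obtain x where x: "d = {w \<in> space M. \<forall>A\<in>(\<Union>g\<in>F. (\<lambda>A. \<alpha> g ` A) ` C). w \<in> A \<longleftrightarrow> x \<in> A}"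
      using d(1) unfolding Dgen generated_partition_def by blast
    have "w \<in> A \<longleftrightarrow> x \<in> A" if A: "A \<in> (\<Union>g\<in>F. (\<lambda>A. \<alpha> g ` A) ` C)" for A
    proof -
      obtain g c where "g \<in> F" "c \<in> C" "A = \<alpha> g ` c" using A by blast
      then have "z \<in> A \<longleftrightarrow> w \<in> A" using same by simp
      moreover have "z \<in> A \<longleftrightarrow> x \<in> A" using d(2) A unfolding x by blast
      ultimately show ?thesis by simp
    qed
    then have "\<forall>A\<in>(\<Union>g\<in>F. (\<lambda>A. \<alpha> g ` A) ` C). w \<in> A \<longleftrightarrow> x \<in> A" by (rule ballI)
    then show ?thesis unfolding x by (intro CollectI conjI w)
  qed
  have P_alg: "B \<in> generated_algebra (space M) D" if B: "B \<in> P" for B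
  proof -
    have "partition_on B {c \<in> C. c \<subseteq> B}"
      using refines_obtains_subset[OF C(2)] B by (simp add: P_def)
    then have "\<Union>{c \<in> C. c \<subseteq> B} = B" by (simp add: partition_on_def)
    moreover have "D \<subseteq> Pow (space M)" using D' sets.sets_into_space by auto
    interpret A: Sigma_Algebra.algebra "space M" "generated_algebra (space M) D"
      by (rule algebra_generated_algebra) fact
    have "c \<in> generated_algebra (space M) D" if "c \<in> C" for c
      using image_in_generated_algebra[OF F C(1) that] one_img[OF Csp[OF that]] by (simp add: D_def)
    then have "\<Union>{c \<in> C. c \<subseteq> B} \<in> generated_algebra (space M) D"
      by (intro A.finite_Union) (use C'(2) in auto)
    ultimately show ?thesis by simp
  qed
  have main: "card (names V R ` microstates M \<alpha> (?\<A> n) F \<epsilon> V \<sigma>) \<le> count_on P (sofic_homs M \<alpha> C F \<delta> V \<sigma>)"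
    if sof: "sofic_approximation G V \<sigma>" for V :: "'v set" and \<sigma>
  proof -
    have V: "finite V" "V \<noteq> {}" and perm: "\<And>g. g \<in> carrier G \<Longrightarrow> \<sigma> g permutes V"
      using sof by (auto simp: sofic_approximation_def)
    have cV: "real (card V) > 0" using V by (simp add: card_gt_0_iff)
    define \<phi> where "\<phi> y = (\<lambda>A\<in>generated_algebra (space M) D. {v \<in> V. r (y v) \<in> A})" for y
    have hom: "\<phi> y \<in> sofic_homs M \<alpha> C F \<delta> V \<sigma>" if y: "y \<in> microstates M \<alpha> (?\<A> n) F \<epsilon> V \<sigma>" for y
    proof -
      have ysp: "y v \<in> space M" if "v \<in> V" for v using y that by (auto simp: microstates_def)
      have emp: "\<bar>unif V {v \<in> V. y v \<in> A} - measure M A\<bar> \<le> \<epsilon>" if "A \<in> ?\<A> n" for A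
        using y that by (auto simp: microstates_def)
      have empX: "unif V {v \<in> V. y v \<in> X} \<le> 2 * \<epsilon>" using emp[OF Xn] mX by linarith
      then have cardX: "real (card {v \<in> V. y v \<in> X}) \<le> 2 * \<epsilon> * real (card V)"
        using cV by (simp add: unif_def pos_divide_le_eq)
      have "\<phi> y \<in> boolean_homs (space M) (generated_algebra (space M) D) V"
        unfolding \<phi>_def
        by (rule point_map_boolean_hom) (use D' sets.sets_into_space rsp ysp in auto)
      moreover have "(\<Sum>A\<in>C. unif V (sym_diff (\<sigma> g ` \<phi> y A) (\<phi> y (\<alpha> g ` A)))) < \<delta>" if g: "g \<in> F" for g
      proof -
        have gG: "g \<in> carrier G" using g F by auto
        define bad where "bad = {v \<in> V. y v \<in> X} \<union> {v \<in> V. y (\<sigma> g v) \<in> X} \<union>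
            {v \<in> V. \<exists>A\<in>?\<A> n. (y (\<sigma> g v) \<in> A) \<noteq> (\<alpha> g (y v) \<in> A)}"
        have fb: "finite bad" using V by (simp add: bad_def)
        have "card {v \<in> V. y (\<sigma> g v) \<in> X} = card {v \<in> V. y v \<in> X}"
          using card_vimage_permutes[OF perm[OF gG], of "{v \<in> V. y v \<in> X}"] permutes_in_image[OF perm[OF gG]]
          by simp
        moreover have "real (card {v \<in> V. \<exists>A\<in>?\<A> n. (y (\<sigma> g v) \<in> A) \<noteq> (\<alpha> g (y v) \<in> A)}) \<le> \<epsilon> * real (card V)"
          using y g by (simp add: microstates_def)
        moreover have "card bad \<le> card {v \<in> V. y v \<in> X} + card {v \<in> V. y (\<sigma> g v) \<in> X} +
            card {v \<in> V. \<exists>A\<in>?\<A> n. (y (\<sigma> g v) \<in> A) \<noteq> (\<alpha> g (y v) \<in> A)}"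
          unfolding bad_def
          by (intro order_trans[OF card_Un_le] add_mono) (auto intro: card_Un_le)
        \<comment> \<open>The set \<open>X\<close> has measure at most \<open>\<epsilon>\<close>,
          hence frequency at most \<open>2 * \<epsilon>\<close>. It is to be avoided at
          \<open>v\<close> and at \<open>\<sigma> g v\<close>, and failure of equivariance adds one
          more \<open>\<epsilon>\<close>.\<close>
        ultimately have cb: "real (card bad) \<le> 5 * \<epsilon> * real (card V)"
          using cardX by (simp add: algebra_simps)
        have sub: "sym_diff (\<sigma> g ` \<phi> y A) (\<phi> y (\<alpha> g ` A)) \<subseteq> \<sigma> g ` bad" if A: "A \<in> C" for A
        proof -
          have A_alg: "A \<in> generated_algebra (space M) D"
            using image_in_generated_algebra[OF F C(1) A] one_img[OF Csp[OF A]] by (simp add: D_def)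
          have gA_alg: "\<alpha> g ` A \<in> generated_algebra (space M) D"
            using image_in_generated_algebra[OF F(1,2) g C(1) A] by (simp add: D_def)
          have "\<sigma> g v \<in> \<sigma> g ` \<phi> y A \<longleftrightarrow> \<sigma> g v \<in> \<phi> y (\<alpha> g ` A)" if v: "v \<in> V" "v \<notin> bad" for v
          proof -
            have \<sigma>v: "\<sigma> g v \<in> V" using permutes_in_image[OF perm[OF gG]] v by simp
            have "inj (\<sigma> g)" using permutes_inj[OF perm[OF gG]] .
            then have "\<sigma> g v \<in> \<sigma> g ` \<phi> y A \<longleftrightarrow> v \<in> \<phi> y A" by (simp add: inj_image_mem_iff)
            also have "\<dots> \<longleftrightarrow> r (y v) \<in> \<alpha> \<one> ` A" using A_alg v one_img[OF Csp[OF A]] by (simp add: \<phi>_def)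
            also have "\<dots> \<longleftrightarrow> y v \<in> \<alpha> \<one> ` q A"
              by (rule rC) (use v ysp F A in \<open>auto simp: bad_def\<close>)
            also have "\<dots> \<longleftrightarrow> y v \<in> q A" by (simp add: one_img[OF qsp[OF A]])
            also have "\<dots> \<longleftrightarrow> \<alpha> g (y v) \<in> \<alpha> g ` q A"
              using action_in_image_iff[OF gG qsp[OF A] ysp] v by simp
            also have "\<dots> \<longleftrightarrow> y (\<sigma> g v) \<in> \<alpha> g ` q A" using v qn[OF g A] by (auto simp: bad_def)
            also have "\<dots> \<longleftrightarrow> r (y (\<sigma> g v)) \<in> \<alpha> g ` A"
              by (rule rC[symmetric]) (use v ysp \<sigma>v g A in \<open>auto simp: bad_def\<close>)
            also have "\<dots> \<longleftrightarrow> \<sigma> g v \<in> \<phi> y (\<alpha> g ` A)" using gA_alg \<sigma>v by (simp add: \<phi>_def)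
            finally show ?thesis .
          qed
          note iff = this
          have inV: "w \<in> \<sigma> g ` V" if "w \<in> sym_diff (\<sigma> g ` \<phi> y A) (\<phi> y (\<alpha> g ` A))" for w
          proof -
            have "\<phi> y A \<subseteq> V" "\<phi> y (\<alpha> g ` A) \<subseteq> V" using A_alg gA_alg by (auto simp: \<phi>_def)
            then show ?thesis using that permutes_image[OF perm[OF gG]] by auto
          qed
          show ?thesis
          proof
            fix w assume w: "w \<in> sym_diff (\<sigma> g ` \<phi> y A) (\<phi> y (\<alpha> g ` A))"
            obtain v where v: "v \<in> V" "w = \<sigma> g v" using inV[OF w] by auto
            have "v \<in> bad" using iff[OF v(1)] w unfolding v(2) by blast
            then show "w \<in> \<sigma> g ` bad" using v(2) by simp
          qed
        qed
        have "unif V (sym_diff (\<sigma> g ` \<phi> y A) (\<phi> y (\<alpha> g ` A))) \<le> 5 * \<epsilon>" if "A \<in> C" for A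
        proof -
          have "card (sym_diff (\<sigma> g ` \<phi> y A) (\<phi> y (\<alpha> g ` A))) \<le> card (\<sigma> g ` bad)"
            by (rule card_mono[OF finite_imageI[OF fb] sub[OF that]])
          also have "\<dots> \<le> card bad" by (rule card_image_le[OF fb])
          finally show ?thesis using cb cV by (simp add: unif_def pos_divide_le_eq)
        qed
        then have "(\<Sum>A\<in>C. unif V (sym_diff (\<sigma> g ` \<phi> y A) (\<phi> y (\<alpha> g ` A)))) \<le> (\<Sum>A\<in>C. 5 * \<epsilon>)"
          by (rule sum_mono)
        also have "\<dots> \<le> L * (5 * \<epsilon>)" using L \<epsilon> by (simp add: mult_right_mono)
        also have "\<dots> < \<delta>" using L \<delta> by (simp add: \<epsilon>_def)
        finally show ?thesis .
      qed
      moreover have "(\<Sum>d\<in>D. \<bar>unif V (\<phi> y d) - measure M d\<bar>) < \<delta>"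
      proof -
        have "\<bar>unif V (\<phi> y d) - measure M d\<bar> \<le> 4 * \<epsilon>" if d: "d \<in> D" for d
        proof -
          have dM: "d \<in> sets M" using d D' by auto
          \<comment> \<open>The part \<open>d\<close> itself is not tested by the microstates. Its
            preimage under \<open>r\<close> away from \<open>X\<close> is: by \<open>d'iff\<close>
            it depends on names only. Passing from \<open>d\<close> to \<open>d'\<close> costs
            \<open>\<epsilon>\<close> in measure and \<open>2 * \<epsilon>\<close> in frequency, and
            the test on \<open>d'\<close> costs another \<open>\<epsilon>\<close>.\<close>
          define d' where "d' = {z \<in> space M. z \<notin> X \<and> r z \<in> d}"
          have d'iff: "z \<in> d' \<longleftrightarrow> z \<notin> X \<and> (\<exists>w\<in>E \<inter> d. \<forall>A\<in>\<T>. w \<in> A \<longleftrightarrow> z \<in> A)" if z: "z \<in> space M" for z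
          proof
            assume "z \<in> d'"
            then show "z \<notin> X \<and> (\<exists>w\<in>E \<inter> d. \<forall>A\<in>\<T>. w \<in> A \<longleftrightarrow> z \<in> A)"
              using r[of z] by (auto simp: d'_def)
          next
            assume h: "z \<notin> X \<and> (\<exists>w\<in>E \<inter> d. \<forall>A\<in>\<T>. w \<in> A \<longleftrightarrow> z \<in> A)"
            then obtain w where w: "w \<in> E" "w \<in> d" "\<And>A. A \<in> \<T> \<Longrightarrow> w \<in> A \<longleftrightarrow> z \<in> A" by blast
            have same: "r z \<in> \<alpha> g ` c \<longleftrightarrow> w \<in> \<alpha> g ` c" if "g \<in> F" "c \<in> C" for g c
            proof -
              have "r z \<in> \<alpha> g ` c \<longleftrightarrow> z \<in> \<alpha> g ` q c" using rC[OF z _ that] h by simp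
              also have "\<dots> \<longleftrightarrow> w \<in> \<alpha> g ` q c" using w(3)[of "\<alpha> g ` q c"] that by (auto simp: \<T>_def)
              also have "\<dots> \<longleftrightarrow> w \<in> \<alpha> g ` c" using w(1) that by (simp add: E_def)
              finally show ?thesis .
            qed
            have "r z \<in> d"
              by (rule dcong[OF d w(2) rsp[OF z]]) (simp add: same)
            then show "z \<in> d'" using h z by (simp add: d'_def)
          qed
          have d'n: "d' \<in> ?\<A> n"
          proof (rule initial_algebraI)
            fix z w assume h: "z \<in> space M" "w \<in> space M" "\<And>i. i < n \<Longrightarrow> z \<in> b i \<longleftrightarrow> w \<in> b i" "z \<in> d'"
            have 1: "\<forall>A\<in>\<T>. z \<in> A \<longleftrightarrow> w \<in> A" using \<T>cong[OF _ h(1,2) h(3)] by blast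
            have 2: "z \<in> X \<longleftrightarrow> w \<in> X" by (rule initial_algebra_cong[OF Xn h(1,2) h(3)])
            show "w \<in> d'" using h(4) 1 2 unfolding d'iff[OF h(1)] d'iff[OF h(2)] by simp
          qed (auto simp: d'_def)
          have "sym_diff d' d \<subseteq> Z"
          proof
            fix z assume z: "z \<in> sym_diff d' d"
            show "z \<in> Z"
            proof (rule ccontr)
              assume nZ: "z \<notin> Z"
              have zsp: "z \<in> space M" using z sets.sets_into_space[OF dM] by (auto simp: d'_def)
              then have zE: "z \<in> E" and zX: "z \<notin> X" using nZ EZ XZ by auto
              have same: "r z \<in> \<alpha> g ` c \<longleftrightarrow> z \<in> \<alpha> g ` c" if "g \<in> F" "c \<in> C" for g c
                using rC[OF zsp zX that] zE that by (simp add: E_def)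
              have "r z \<in> d \<longleftrightarrow> z \<in> d"
                using dcong[OF d _ zsp, of "r z"] dcong[OF d _ rsp[OF zsp], of z] same by blast
              then show False using z zsp zX by (auto simp: d'_def)
            qed
          qed
          then have 1: "\<bar>measure M d' - measure M d\<bar> \<le> measure M Z"
            by (intro measure_diff_le_sym_diff algM[OF d'n] dM ZM) (auto intro: finite_measure_axioms)
          have \<phi>d: "\<phi> y d = {v \<in> V. r (y v) \<in> d}"
          proof -
            have "d \<in> generated_algebra (space M) D" using d by (auto simp: generated_algebra_def)
            then show ?thesis by (simp add: \<phi>_def)
          qed
          have 2: "\<bar>unif V (\<phi> y d) - unif V {v \<in> V. y v \<in> d'}\<bar> \<le> unif V {v \<in> V. y v \<in> X}"
            by (rule unif_diff_le_sym_diff[OF V(1)]) (use ysp in \<open>auto simp: \<phi>d d'_def\<close>)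
          show ?thesis using 1 2 emp[OF d'n] empX mZ by linarith
        qed
        then have "(\<Sum>d\<in>D. \<bar>unif V (\<phi> y d) - measure M d\<bar>) \<le> (\<Sum>d\<in>D. 4 * \<epsilon>)"
          by (rule sum_mono)
        also have "\<dots> \<le> L * (4 * \<epsilon>)" using L \<epsilon> by (simp add: mult_right_mono)
        also have "\<dots> < \<delta>" using L \<delta> by (simp add: \<epsilon>_def)
        finally show ?thesis .
      qed
      ultimately show ?thesis by (simp add: sofic_homs_def D_def)
    qed
    define Y where "Y = microstates M \<alpha> (?\<A> n) F \<epsilon> V \<sigma>"
    have \<phi>P: "restrict (\<phi> y) P = (\<lambda>B\<in>P. {v \<in> V. r (y v) \<in> B})" for y
      using P_alg by (auto simp: \<phi>_def fun_eq_iff)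
    have Pfin: "finite P" unfolding P_def
      by (rule finite_generated_partition, rule finite_subset[OF R finite_initial_algebra])
    have "finite ((\<lambda>y. restrict (\<phi> y) P) ` Y)"
      by (rule finite_subset[of _ "P \<rightarrow>\<^sub>E Pow V"]) (auto simp: \<phi>P V(1) Pfin intro!: finite_PiE)
    \<comment> \<open>The restriction of \<open>\<phi> y\<close> to \<open>P\<close> gives the
      \<open>R\<close>-name of \<open>r\<close> composed with \<open>y\<close>, and \<open>r\<close>
      does not change \<open>R\<close>-names.\<close>
    moreover have "names V R y = names V R y'"
      if y: "y \<in> Y" "y' \<in> Y" and eq: "restrict (\<phi> y) P = restrict (\<phi> y') P" for y y'
    proof (rule names_eqI)
      fix v A assume v: "v \<in> V" and A: "A \<in> R"
      have sp: "y v \<in> space M" "y' v \<in> space M" using y v by (auto simp: Y_def microstates_def)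
      have un: "\<Union>{B \<in> P. B \<subseteq> A} = A"
        unfolding P_def by (rule generated_partition_Union[OF A]) (use A R initial_algebra_subset in blast)
      have "r (y v) \<in> B \<longleftrightarrow> r (y' v) \<in> B" if "B \<in> P" for B
        using fun_cong[OF eq, of B] that v unfolding \<phi>P by auto
      then have "r (y v) \<in> \<Union>{B \<in> P. B \<subseteq> A} \<longleftrightarrow> r (y' v) \<in> \<Union>{B \<in> P. B \<subseteq> A}" by blast
      then show "y v \<in> A \<longleftrightarrow> y' v \<in> A" using rR[OF sp(1) A] rR[OF sp(2) A] un by simp
    qed
    ultimately have "card (names V R ` Y) \<le> card ((\<lambda>y. restrict (\<phi> y) P) ` Y)"
      by (rule card_image_le_of_kernel)
    also have "(\<lambda>y. restrict (\<phi> y) P) ` Y \<subseteq> (\<lambda>\<phi>. restrict \<phi> P) ` sofic_homs M \<alpha> C F \<delta> V \<sigma>"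
      using hom by (auto simp: Y_def)
    then have "card ((\<lambda>y. restrict (\<phi> y) P) ` Y) \<le> count_on P (sofic_homs M \<alpha> C F \<delta> V \<sigma>)"
      unfolding count_on_def
    proof (rule card_mono[rotated])
      have "(\<lambda>\<phi>. restrict \<phi> P) ` sofic_homs M \<alpha> C F \<delta> V \<sigma> \<subseteq> P \<rightarrow>\<^sub>E Pow V"
      proof clarify
        fix \<phi> assume "\<phi> \<in> sofic_homs M \<alpha> C F \<delta> V \<sigma>"
        then have "\<phi> \<in> generated_algebra (space M) D \<rightarrow>\<^sub>E Pow V"
          by (simp add: sofic_homs_def boolean_homs_def D_def)
        then have "\<phi> B \<in> Pow V" if "B \<in> P" for B using P_alg[OF that] by (rule PiE_mem)
        then show "restrict \<phi> P \<in> P \<rightarrow>\<^sub>E Pow V" by (simp add: restrict_PiE_iff)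
      qed
      then show "finite ((\<lambda>\<phi>. restrict \<phi> P) ` sofic_homs M \<alpha> C F \<delta> V \<sigma>)"
        by (rule finite_subset) (simp add: finite_PiE Pfin V(1))
    qed
    finally show ?thesis by (simp add: Y_def)
  qed
  show ?thesis
    by (rule exI[of _ n], rule exI[of _ \<epsilon>]) (use \<epsilon> main in \<open>simp add: P_def\<close>)
qed

text \<open>A countable base together with \<open>R\<close> stays countable when closed under
  translation by a countable group, so every translate of a base set is again tested at some
  stage.\<close>

lemma countable_invariant_base:
  assumes "countable (carrier G)" "finite R" "R \<subseteq> sets M"
  obtains b :: "nat \<Rightarrow> 'x set" and n where "\<And>i. b i \<in> sets M"
    "sets M \<subseteq> sigma_sets (space M) (range b)"
    "\<And>i g. g \<in> carrier G \<Longrightarrow> \<exists>j. b j = \<alpha> g ` b i"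
    "R \<subseteq> initial_algebra (space M) b n"
proof -
  interpret group G by (rule group_G)
  obtain U :: "nat \<Rightarrow> 'x set" where U: "sets M = sigma_sets (space M) (range U)" "\<And>i. U i \<in> sets M"
    using standard_borel_countable_base[OF standard_borel] by metis
  define \<B> where "\<B> = (\<Union>g\<in>carrier G. (\<lambda>A. \<alpha> g ` A) ` (range U \<union> R))"
  have cB: "countable \<B>" unfolding \<B>_def
    by (intro countable_UN assms(1) countable_image countable_Un countable_finite[OF assms(2)]) simp
  have one: "\<alpha> \<one> ` A = A" if "A \<in> sets M" for A
    using sets.sets_into_space[OF that] by (force simp: action_one)
  have sub: "range U \<union> R \<subseteq> \<B>"
  proof
    fix A assume A: "A \<in> range U \<union> R"
    then have "A \<in> sets M" using U assms(3) by auto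
    then show "A \<in> \<B>" unfolding \<B>_def using A one[of A] by (auto intro!: bexI[of _ \<one>] image_eqI[of _ _ A])
  qed
  have BM: "A \<in> sets M" if "A \<in> \<B>" for A
    using that U(2) assms(3) unfolding \<B>_def by (auto intro!: image_sets)
  have "\<B> \<noteq> {}" using sub by auto
  define b where "b = from_nat_into \<B>"
  have rb: "range b = \<B>" unfolding b_def by (rule range_from_nat_into[OF \<open>\<B> \<noteq> {}\<close> cB])
  have 1: "b i \<in> sets M" for i using BM rb by auto
  have 2: "sets M \<subseteq> sigma_sets (space M) (range b)"
    unfolding U(1) rb by (rule sigma_sets_mono') (use sub in auto)
  have 3: "\<exists>j. b j = \<alpha> g ` b i" if g: "g \<in> carrier G" for i g
  proof -
    have "b i \<in> \<B>" using rb by auto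
    then obtain h A where h: "h \<in> carrier G" "A \<in> range U \<union> R" "b i = \<alpha> h ` A"
      unfolding \<B>_def by blast
    have "A \<in> sets M" using h(2) U(2) assms(3) by auto
    then have "A \<subseteq> space M" by (rule sets.sets_into_space)
    then have "\<alpha> g ` b i = \<alpha> (g \<otimes> h) ` A"
      unfolding h(3) image_image by (intro image_cong refl) (use composition_rule g h in auto)
    moreover have "\<alpha> (g \<otimes> h) ` A \<in> \<B>"
      unfolding \<B>_def by (rule UN_I[OF m_closed[OF g h(1)] imageI[OF h(2)]])
    ultimately have "\<alpha> g ` b i \<in> \<B>" by simp
    then show ?thesis using rb by (metis imageE)
  qed
  have "\<exists>i. b i = A" if "A \<in> R" for A using sub rb that by (metis UnCI imageE subsetD)
  then obtain j where j: "\<And>A. A \<in> R \<Longrightarrow> b (j A) = A" by metis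
  define n where "n = Suc (\<Sum>A\<in>R. j A)"
  have 4: "R \<subseteq> initial_algebra (space M) b n"
  proof
    fix A assume A: "A \<in> R"
    have "j A < n" unfolding n_def using member_le_sum[OF A, of j] assms(2) by simp
    then have "b (j A) \<in> initial_algebra (space M) b n"
      by (rule initial_algebra_base) (use 1 sets.sets_into_space in auto)
    then show "A \<in> initial_algebra (space M) b n" using j[OF A] by simp
  qed
  show thesis by (rule that[OF 1 2 3 4])
qed

text \<open>A diagonal argument: the approximation chosen for the first \<open>n\<close> group
  elements, the first \<open>n\<close> base sets and tolerance \<open>1 / (n + 1)\<close> is the
  \<open>n\<close>-th term of a sequence. It is therefore enough to treat each test separately,
  provided that \<open>R\<close> does not depend on the test.\<close>

lemma max_sofic_entropy_ge:
  assumes cG: "countable (carrier G)" and R: "finite R" "R \<subseteq> sets M"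
    and ex: "\<And>S F \<delta>. finite S \<Longrightarrow> S \<subseteq> sets M \<Longrightarrow> finite F \<Longrightarrow> F \<subseteq> carrier G \<Longrightarrow> \<delta> > 0 \<Longrightarrow>
      \<exists>(V::nat set) \<sigma>. sofic_approximation G V \<sigma> \<and> good_approximation G F \<delta> V \<sigma> \<and>
        exp (c * real (card V)) \<le> real (card (names V R ` microstates M \<alpha> S F \<delta> V \<sigma>))"
  shows "ereal c \<le> max_sofic_entropy G M \<alpha>"
proof -
  interpret group G by (rule group_G)
  obtain b :: "nat \<Rightarrow> 'x set" and n0 where b: "\<And>i. b i \<in> sets M"
    "sets M \<subseteq> sigma_sets (space M) (range b)"
    "\<And>i g. g \<in> carrier G \<Longrightarrow> \<exists>j. b j = \<alpha> g ` b i"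
    "R \<subseteq> initial_algebra (space M) b n0"
    using countable_invariant_base[OF cG R] by metis
  let ?\<A> = "initial_algebra (space M) b"
  define F where "F n = from_nat_into (carrier G) ` {..n::nat}" for n
  have ne: "carrier G \<noteq> {}" using one_closed by blast
  have rF: "range (from_nat_into (carrier G)) = carrier G" by (rule range_from_nat_into[OF ne cG])
  have F: "finite (F n)" "F n \<subseteq> carrier G" for n using rF by (auto simp: F_def)
  have Fmono: "F n \<subseteq> F m" if "n \<le> m" for n m using that by (auto simp: F_def)
  have Fex: "\<exists>n. T \<subseteq> F n" if "finite T" "T \<subseteq> carrier G" for T
  proof -
    have "\<exists>i. from_nat_into (carrier G) i = g" if "g \<in> T" for g
      using rF that \<open>T \<subseteq> carrier G\<close> by (metis imageE subsetD)
    then obtain i where i: "\<And>g. g \<in> T \<Longrightarrow> from_nat_into (carrier G) (i g) = g" by metis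
    have "g \<in> F (\<Sum>g\<in>T. i g)" if "g \<in> T" for g
      unfolding F_def using i[OF that] member_le_sum[OF that, of i] \<open>finite T\<close>
      by (intro image_eqI[of _ _ "i g"]) auto
    then show ?thesis by blast
  qed
  define e where "e n = 1 / real (Suc n)" for n
  have e_pos: "e n > 0" for n by (simp add: e_def)
  have e_ex: "\<exists>n. e n \<le> \<delta>" if "\<delta> > 0" for \<delta>
    using reals_Archimedean[OF that] by (auto simp: e_def inverse_eq_divide intro: less_imp_le)
  have e_mono: "e m \<le> e n" if "n \<le> m" for n m using that by (simp add: e_def frac_le)
  have "\<exists>p. sofic_approximation G (fst p :: nat set) (snd p) \<and> good_approximation G (F n) (e n) (fst p) (snd p) \<and>
        exp (c * real (card (fst p))) \<le> real (card (names (fst p) R ` microstates M \<alpha> (?\<A> n) (F n) (e n) (fst p) (snd p)))"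
    for n
  proof -
    obtain V :: "nat set" and \<sigma> where "sofic_approximation G V \<sigma> \<and> good_approximation G (F n) (e n) V \<sigma> \<and>
        exp (c * real (card V)) \<le> real (card (names V R ` microstates M \<alpha> (?\<A> n) (F n) (e n) V \<sigma>))"
      using ex[OF finite_initial_algebra[of "space M" b n] sets_initial_algebra[of b M n, OF b(1)] F[of n] e_pos[of n]] by blast
    then show ?thesis by (intro exI[of _ "(V, \<sigma>)"]) simp
  qed
  then obtain p where p: "\<And>n. sofic_approximation G (fst (p n) :: nat set) (snd (p n)) \<and>
        good_approximation G (F n) (e n) (fst (p n)) (snd (p n)) \<and>
        exp (c * real (card (fst (p n)))) \<le> real (card (names (fst (p n)) R `
          microstates M \<alpha> (?\<A> n) (F n) (e n) (fst (p n)) (snd (p n))))"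
    by metis
  define V :: "nat \<Rightarrow> nat set" where "V n = fst (p n)" for n
  define \<sigma> where "\<sigma> n = snd (p n)" for n
  have sof: "sofic_approximation G (V n) (\<sigma> n)" and good: "good_approximation G (F n) (e n) (V n) (\<sigma> n)"
    and count: "exp (c * real (card (V n))) \<le> real (card (names (V n) R ` microstates M \<alpha> (?\<A> n) (F n) (e n) (V n) (\<sigma> n)))"
    for n using p[of n] by (auto simp: V_def \<sigma>_def)
  have seq: "sofic_approximation_sequence G V \<sigma>"
    unfolding sofic_approximation_sequence_def
  proof (intro conjI allI impI sof)
    fix T and \<delta> :: real assume h: "finite T \<and> T \<subseteq> carrier G \<and> \<delta> > 0"
    obtain n1 where n1: "T \<subseteq> F n1" using Fex h by blast
    obtain n2 where n2: "e n2 \<le> \<delta>" using e_ex h by blast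
    show "\<forall>\<^sub>F k in sequentially. good_approximation G T \<delta> (V k) (\<sigma> k)"
      unfolding eventually_sequentially
    proof (intro exI[of _ "max n1 n2"] allI impI)
      fix k assume "max n1 n2 \<le> k"
      then show "good_approximation G T \<delta> (V k) (\<sigma> k)"
        using n1 n2 Fmono[of n1 k] e_mono[of n2 k]
        by (intro good_approximation_mono[OF good[of k]]) auto
    qed
  qed
  define P where "P = generated_partition (space M) R"
  have "ereal c \<le> sofic_entropy G M \<alpha> V \<sigma>"
    unfolding sofic_entropy_def
  proof (rule SUP_upper2[of P], goal_cases)
    case 1
    then show ?case using finite_partition_generated_partition[OF R] by (simp add: P_def)
  next
    case 2
    show ?case
    proof (intro INF_greatest)
      fix C T and \<delta> :: real
      assume "C \<in> {C. finite_partition M C \<and> refines (space M) C P}"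
        and "T \<in> {F. finite F \<and> F \<subseteq> carrier G \<and> \<one> \<in> F}" and "\<delta> \<in> {0<..}"
      then have C: "finite_partition M C" "refines (space M) C P" and T: "finite T" "T \<subseteq> carrier G" "\<one> \<in> T"
        and \<delta>: "\<delta> > 0" by auto
      obtain m \<delta>' where \<delta>': "\<delta>' > 0" and le: "\<And>(V::nat set) \<sigma>. sofic_approximation G V \<sigma> \<Longrightarrow>
          card (names V R ` microstates M \<alpha> (?\<A> m) T \<delta>' V \<sigma>) \<le> count_on P (sofic_homs M \<alpha> C T \<delta> V \<sigma>)"
        using count_microstates_le_sofic_homs[OF b C(1) C(2)[unfolded P_def] T \<delta>, folded P_def, where 'v = nat] by blast
      obtain n1 where n1: "T \<subseteq> F n1" using Fex T by blast
      obtain n2 where n2: "e n2 \<le> \<delta>'" using e_ex \<delta>' by blast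
      have ev: "ereal c \<le> ereal (1 / real (card (V k))) * log_count (count_on P (sofic_homs M \<alpha> C T \<delta> (V k) (\<sigma> k)))"
        if k: "k \<ge> max m (max n1 n2)" for k
      proof -
        have Vk: "finite (V k)" "V k \<noteq> {}" using sof[of k] by (auto simp: sofic_approximation_def)
        then have cV: "real (card (V k)) > 0" by (simp add: card_gt_0_iff)
        have "microstates M \<alpha> (?\<A> k) (F k) (e k) (V k) (\<sigma> k) \<subseteq> microstates M \<alpha> (?\<A> m) T \<delta>' (V k) (\<sigma> k)"
          by (rule microstates_mono[OF Vk(1)])
             (use k subset_trans[OF n1 Fmono[of n1 k]] order_trans[OF e_mono[of n2 k] n2]
                initial_algebra_mono[of m k "space M" b] in simp_all)
        then have "card (names (V k) R ` microstates M \<alpha> (?\<A> k) (F k) (e k) (V k) (\<sigma> k))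
            \<le> card (names (V k) R ` microstates M \<alpha> (?\<A> m) T \<delta>' (V k) (\<sigma> k))"
          by (intro card_mono image_mono finite_names_image Vk R)
        also have "\<dots> \<le> count_on P (sofic_homs M \<alpha> C T \<delta> (V k) (\<sigma> k))" by (rule le[OF sof])
        finally have N: "exp (c * real (card (V k))) \<le> real (count_on P (sofic_homs M \<alpha> C T \<delta> (V k) (\<sigma> k)))"
          (is "_ \<le> real ?N") using count[of k] by linarith
        have N0: "?N > 0" using N exp_gt_zero[of "c * real (card (V k))"] by linarith
        then have "c * real (card (V k)) \<le> ln (real ?N)"
          using N by (simp add: ln_ge_iff)
        then have "c \<le> 1 / real (card (V k)) * ln (real ?N)"
          using cV by (simp add: pos_le_divide_eq)
        then show ?thesis using N0 by (simp add: log_count_def)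
      qed
      show "ereal c \<le> limsup (\<lambda>k. ereal (1 / real (card (V k))) * log_count (count_on P (sofic_homs M \<alpha> C T \<delta> (V k) (\<sigma> k))))"
        by (rule le_Limsup) (use ev in \<open>simp_all only: eventually_sequentially trivial_limit_sequentially, blast+\<close>)
    qed
  qed
  also have "\<dots> \<le> (SUP (V, \<sigma>) \<in> {(V, \<sigma>). sofic_approximation_sequence G V \<sigma>}. sofic_entropy G M \<alpha> V \<sigma>)"
    by (rule SUP_upper2[of "(V, \<sigma>)"]) (use seq in auto)
  also have "\<dots> = max_sofic_entropy G M \<alpha>"
    using seq by (auto simp: max_sofic_entropy_def sofic_group_def)
  finally show ?thesis .
qed

text \<open>The supremum over partitions stands outermost, so a single \<open>P\<close> serves every
  test. A limsup above \<open>c\<close> yields the lower bound only for infinitely many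
  \<open>k\<close>.\<close>

lemma frequently_many_microstates:
  assumes gt: "ereal c < sofic_entropy G M \<alpha> V \<sigma>" and seq: "\<And>k. sofic_approximation G (V k) (\<sigma> k)"
  shows "\<exists>P. finite_partition M P \<and> (\<forall>S F \<delta>. finite S \<and> S \<subseteq> sets M \<and> finite F \<and> F \<subseteq> carrier G \<and> \<delta> > 0 \<longrightarrow>
     (\<exists>\<^sub>F k in sequentially. exp (c * real (card (V k)))
        \<le> real (card (names (V k) P ` microstates M \<alpha> S F \<delta> (V k) (\<sigma> k)))))"
proof -
  interpret group G by (rule group_G)
  obtain P where P: "finite_partition M P" and "ereal c < (INF C \<in> {C. finite_partition M C \<and> refines (space M) C P}.
      INF F \<in> {F. finite F \<and> F \<subseteq> carrier G \<and> \<one> \<in> F}. INF \<delta> \<in> {0<..}.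
        limsup (\<lambda>k. ereal (1 / real (card (V k))) * log_count (count_on P (sofic_homs M \<alpha> C F \<delta> (V k) (\<sigma> k)))))"
    using gt unfolding sofic_entropy_def less_SUP_iff by blast
  then have inf: "ereal c < limsup (\<lambda>k. ereal (1 / real (card (V k))) * log_count (count_on P (sofic_homs M \<alpha> C F \<delta> (V k) (\<sigma> k))))"
    if "finite_partition M C" "refines (space M) C P" "finite F" "F \<subseteq> carrier G" "\<one> \<in> F" "\<delta> > 0" for C F \<delta>
    using that by (elim less_le_trans) (auto intro!: INF_lower2[of C] INF_lower2[of F] INF_lower2[of \<delta>])
  show ?thesis
  proof (rule exI[of _ P], intro conjI P allI impI, elim conjE)
    fix S F and \<delta> :: real
    assume S: "finite S" "S \<subseteq> sets M" and F: "finite F" "F \<subseteq> carrier G" and \<delta>: "\<delta> > 0"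
    \<comment> \<open>The comparison with homomorphisms wants \<open>P\<close> among the tested sets
      and the identity among the group elements; \<open>microstates_mono\<close> drops them
      again.\<close>
    define S' where "S' = S \<union> P"
    define F' where "F' = insert \<one> F"
    have S': "finite S'" "S' \<subseteq> sets M" "P \<subseteq> S'" using S P by (auto simp: S'_def finite_partition_def)
    have F': "finite F'" "F' \<subseteq> carrier G" "\<one> \<in> F'" using F by (auto simp: F'_def)
    define C where "C = generated_partition (space M) (\<Union>g\<in>F'. (\<lambda>A. {z \<in> space M. \<alpha> g z \<in> A}) ` S')"
    have C: "finite_partition M C" "refines (space M) C P"
      and le: "\<And>k. count_on P (sofic_homs M \<alpha> C F' \<delta> (V k) (\<sigma> k)) \<le> card (names (V k) P ` microstates M \<alpha> S' F' \<delta> (V k) (\<sigma> k))"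
      using count_sofic_homs_le_microstates[OF S'(1,2) F' P S'(3) seq, folded C_def] by auto
    have "\<exists>\<^sub>F k in sequentially. ereal c < ereal (1 / real (card (V k))) * log_count (count_on P (sofic_homs M \<alpha> C F' \<delta> (V k) (\<sigma> k)))"
    proof (rule ccontr)
      assume "\<not> ?thesis"
      then have "\<forall>\<^sub>F k in sequentially. ereal (1 / real (card (V k))) * log_count (count_on P (sofic_homs M \<alpha> C F' \<delta> (V k) (\<sigma> k))) \<le> ereal c"
        by (simp add: not_frequently not_less)
      then have "limsup (\<lambda>k. ereal (1 / real (card (V k))) * log_count (count_on P (sofic_homs M \<alpha> C F' \<delta> (V k) (\<sigma> k)))) \<le> ereal c"
        by (rule Limsup_bounded)
      with inf[OF C F' \<delta>] show False by simp
    qed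
    then show "\<exists>\<^sub>F k in sequentially. exp (c * real (card (V k)))
        \<le> real (card (names (V k) P ` microstates M \<alpha> S F \<delta> (V k) (\<sigma> k)))"
    proof (rule frequently_elim1)
      fix k assume h: "ereal c < ereal (1 / real (card (V k))) * log_count (count_on P (sofic_homs M \<alpha> C F' \<delta> (V k) (\<sigma> k)))"
        (is "_ < _ * log_count ?N")
      have Vk: "finite (V k)" "V k \<noteq> {}" using seq[of k] by (auto simp: sofic_approximation_def)
      then have cV: "real (card (V k)) > 0" by (simp add: card_gt_0_iff)
      have N0: "?N \<noteq> 0"
      proof
        assume "?N = 0"
        then show False using h cV by (simp add: log_count_def)
      qed
      then have "c < ln (real ?N) / real (card (V k))" using h by (simp add: log_count_def)
      then have "c * real (card (V k)) \<le> ln (real ?N)" using cV by (simp add: pos_less_divide_eq)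
      then have "exp (c * real (card (V k))) \<le> real ?N" using N0 by (simp add: ln_ge_iff)
      also have "real ?N \<le> real (card (names (V k) P ` microstates M \<alpha> S' F' \<delta> (V k) (\<sigma> k)))" using le by simp
      also have "\<dots> \<le> real (card (names (V k) P ` microstates M \<alpha> S F \<delta> (V k) (\<sigma> k)))"
        using P by (intro of_nat_mono card_mono image_mono finite_names_image microstates_mono Vk)
           (auto simp: S'_def F'_def finite_partition_def)
      finally show "exp (c * real (card (V k))) \<le> real (card (names (V k) P ` microstates M \<alpha> S F \<delta> (V k) (\<sigma> k)))" .
    qed
  qed
qed

end

section \<open>Cocycles of an orbit equivalence\<close>

lemma (in group) mult_inv_cancel:
  assumes "a \<in> carrier G" "c \<in> carrier G"
  shows "a \<otimes> (inv a \<otimes> c) = c" "inv a \<otimes> (a \<otimes> c) = c"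
  using assms by (simp_all add: m_assoc[symmetric])

lemma (in group) inv_mult_mult_cancel:
  assumes "a \<in> carrier G" "b \<in> carrier G" "c \<in> carrier G"
  shows "inv (a \<otimes> b) \<otimes> (a \<otimes> c) = inv b \<otimes> c"
  using assms by (simp add: inv_mult_group m_assoc mult_inv_cancel)

text \<open>
  On \<open>X\<close> both groups act freely with the same orbits: \<open>a l x = b (K l x) x\<close> for an action \<open>b\<close> of
  \<open>H\<close>, which is recovered as \<open>b t x = a (I t x) x\<close>.
\<close>

locale orbit_cocycles = L: group L + H: group H
  for L :: "('l, 'm) monoid_scheme" and H :: "('h, 'n) monoid_scheme" +
  fixes X :: "'x set" and a :: "'l \<Rightarrow> 'x \<Rightarrow> 'x" and K :: "'l \<Rightarrow> 'x \<Rightarrow> 'h" and I :: "'h \<Rightarrow> 'x \<Rightarrow> 'l"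
  assumes a_one: "x \<in> X \<Longrightarrow> a \<one>\<^bsub>L\<^esub> x = x"
    and a_closed: "l \<in> carrier L \<Longrightarrow> x \<in> X \<Longrightarrow> a l x \<in> X"
    and K_closed: "l \<in> carrier L \<Longrightarrow> x \<in> X \<Longrightarrow> K l x \<in> carrier H"
    and I_closed: "t \<in> carrier H \<Longrightarrow> x \<in> X \<Longrightarrow> I t x \<in> carrier L"
    and K_mult: "l \<in> carrier L \<Longrightarrow> l' \<in> carrier L \<Longrightarrow> x \<in> X \<Longrightarrow>
          K (l \<otimes>\<^bsub>L\<^esub> l') x = K l (a l' x) \<otimes>\<^bsub>H\<^esub> K l' x"
    and I_K: "l \<in> carrier L \<Longrightarrow> x \<in> X \<Longrightarrow> I (K l x) x = l"
    and K_I: "t \<in> carrier H \<Longrightarrow> x \<in> X \<Longrightarrow> K (I t x) x = t"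
begin

lemma K_eqD:
  assumes "K l x = K l' x" "l \<in> carrier L" "l' \<in> carrier L" "x \<in> X"
  shows "l = l'"
  using assms I_K by metis

lemma K_one:
  assumes x: "x \<in> X"
  shows "K \<one>\<^bsub>L\<^esub> x = \<one>\<^bsub>H\<^esub>"
proof -
  have "K \<one>\<^bsub>L\<^esub> x \<otimes>\<^bsub>H\<^esub> K \<one>\<^bsub>L\<^esub> x = K \<one>\<^bsub>L\<^esub> x"
    using K_mult[of "\<one>\<^bsub>L\<^esub>" "\<one>\<^bsub>L\<^esub>" x] x by (simp add: a_one)
  then show ?thesis using K_closed[of "\<one>\<^bsub>L\<^esub>" x] x by (metis H.l_cancel_one L.one_closed)
qed

lemma K_inv:
  assumes "l \<in> carrier L" "x \<in> X"
  shows "K (inv\<^bsub>L\<^esub> l) (a l x) = inv\<^bsub>H\<^esub> (K l x)"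
proof -
  have "K (inv\<^bsub>L\<^esub> l) (a l x) \<otimes>\<^bsub>H\<^esub> K l x = \<one>\<^bsub>H\<^esub>"
    using K_mult[of "inv\<^bsub>L\<^esub> l" l x] assms by (simp add: K_one)
  then show ?thesis
    using assms by (intro H.inv_equality[symmetric]) (simp_all add: K_closed a_closed)
qed

text \<open>
  The discrepancy is invariant along edges on which the cocycle takes the same values at \<open>z\<close> and
  \<open>w\<close>; this is how sparse data determine it globally.
\<close>

definition discrepancy :: "'x \<Rightarrow> 'x \<Rightarrow> 'l \<Rightarrow> 'h" where
  "discrepancy z w p = inv\<^bsub>H\<^esub> (K p z) \<otimes>\<^bsub>H\<^esub> K p w"

lemma discrepancy_step:
  assumes "l \<in> carrier L" "p \<in> carrier L" "z \<in> X" "w \<in> X" "K l (a p z) = K l (a p w)"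
  shows "discrepancy z w (l \<otimes>\<^bsub>L\<^esub> p) = discrepancy z w p"
  using assms H.inv_mult_mult_cancel[of "K l (a p w)" "K p z" "K p w"]
  by (simp add: discrepancy_def K_mult K_closed a_closed)

text \<open>Expand both discrepancies by the cocycle identity. With \<open>r\<close> the shift at
  \<open>\<sigma> g u\<close>, the result compares moving by \<open>g\<close> and then shifting with
  shifting at \<open>u\<close> and then applying \<open>K g z\<close>; the two agree once the
  discrepancies along \<open>s\<close> after \<open>g\<close> and along \<open>s u\<close>
  coincide.\<close>

lemma K_discrepancy:
  assumes c: "g \<in> carrier L" "s \<in> carrier L" "r \<in> carrier L" "z \<in> X" "w \<in> X"
    and r: "K r (a g w) = discrepancy (a g z) (a g w) s"
  shows "K (r \<otimes>\<^bsub>L\<^esub> g) w = K g z \<otimes>\<^bsub>H\<^esub> discrepancy z w (s \<otimes>\<^bsub>L\<^esub> g)"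
proof -
  have K: "K g z \<in> carrier H" "K g w \<in> carrier H" "K s (a g z) \<in> carrier H" "K s (a g w) \<in> carrier H"
    using c by (auto intro: K_closed a_closed)
  have "K (r \<otimes>\<^bsub>L\<^esub> g) w = inv\<^bsub>H\<^esub> (K s (a g z)) \<otimes>\<^bsub>H\<^esub> K s (a g w) \<otimes>\<^bsub>H\<^esub> K g w"
    using c r by (simp add: K_mult discrepancy_def)
  also have "\<dots> = K g z \<otimes>\<^bsub>H\<^esub> (inv\<^bsub>H\<^esub> (K s (a g z) \<otimes>\<^bsub>H\<^esub> K g z) \<otimes>\<^bsub>H\<^esub> (K s (a g w) \<otimes>\<^bsub>H\<^esub> K g w))"
    using K by (simp add: H.inv_mult_group H.m_assoc H.mult_inv_cancel)
  also have "\<dots> = K g z \<otimes>\<^bsub>H\<^esub> discrepancy z w (s \<otimes>\<^bsub>L\<^esub> g)"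
    using c by (simp add: discrepancy_def K_mult)
  finally show ?thesis .
qed

end

section \<open>Transporting microstates to the second group\<close>

text \<open>
  The finite sets \<open>Q\<close> and \<open>T\<close> are the windows through which maps \<open>U \<rightarrow> X\<close> are observed, and \<open>s u\<close>
  moves \<open>u\<close> to a base point \<open>\<sigma> (s u) u\<close> in a sparse set on which \<open>s\<close> is trivial.
\<close>

locale orbit_model = orbit_cocycles L H X a K I
  for L :: "('l, 'm) monoid_scheme" and H :: "('h, 'n) monoid_scheme"
    and X :: "'x set" and a :: "'l \<Rightarrow> 'x \<Rightarrow> 'x" and K :: "'l \<Rightarrow> 'x \<Rightarrow> 'h" and I :: "'h \<Rightarrow> 'x \<Rightarrow> 'l" +
  fixes U :: "'v set" and \<sigma> :: "'l \<Rightarrow> 'v \<Rightarrow> 'v" and Q Q' S :: "'l set" and T :: "'h set"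
    and \<N> :: "'x set set" and s :: "'v \<Rightarrow> 'l"
  assumes finite_U: "finite U"
    and \<sigma>_permutes: "l \<in> carrier L \<Longrightarrow> \<sigma> l permutes U"
    and Q: "Q \<subseteq> carrier L" and Q': "Q' \<subseteq> Q" and S: "S \<subseteq> Q" and one_S: "\<one>\<^bsub>L\<^esub> \<in> S"
    and inv_S: "p \<in> S \<Longrightarrow> inv\<^bsub>L\<^esub> p \<in> Q"
    and T: "T \<subseteq> carrier H"
    and I_T: "t \<in> T \<Longrightarrow> z \<in> X \<Longrightarrow> I t z \<in> Q'"
    and I_I_T: "t \<in> T \<Longrightarrow> t' \<in> T \<Longrightarrow> z \<in> X \<Longrightarrow> w \<in> X \<Longrightarrow> inv\<^bsub>L\<^esub> (I t z) \<otimes>\<^bsub>L\<^esub> I t' w \<in> Q'"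
    and discrepancy_T: "p \<in> S \<Longrightarrow> z \<in> X \<Longrightarrow> w \<in> X \<Longrightarrow> discrepancy z w p \<in> T"
    and s_S: "u \<in> U \<Longrightarrow> s u \<in> S"
begin

text \<open>At such a vertex identities between the cocycles on \<open>X\<close> can be read in the
  model. The condition controls \<open>x\<close> at all neighbours \<open>\<sigma> q u\<close>
  without requiring the neighbours to be good themselves.\<close>

definition good :: "('v \<Rightarrow> 'x) \<Rightarrow> 'v set" where
  "good x = {u \<in> U. u \<notin> inconsistent L Q U \<sigma> \<and> x u \<in> X \<and>
     (\<forall>q\<in>Q. x (\<sigma> q u) \<in> X \<and> (\<forall>l\<in>Q. K l (x (\<sigma> q u)) = K l (a q (x u))) \<and>
       (\<forall>t\<in>T. I t (x (\<sigma> q u)) = I t (a q (x u))) \<and> (\<forall>A\<in>\<N>. x (\<sigma> q u) \<in> A \<longleftrightarrow> a q (x u) \<in> A))}"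

lemma goodD:
  assumes "u \<in> good x"
  shows "u \<in> U" "x u \<in> X"
    and "p \<in> Q \<Longrightarrow> q \<in> Q \<Longrightarrow> \<sigma> (p \<otimes>\<^bsub>L\<^esub> q) u = \<sigma> p (\<sigma> q u)"
    and "p \<in> Q \<Longrightarrow> q \<in> Q \<Longrightarrow> \<sigma> p u = \<sigma> q u \<Longrightarrow> p = q"
    and "q \<in> Q \<Longrightarrow> x (\<sigma> q u) \<in> X"
    and "q \<in> Q \<Longrightarrow> p \<in> Q \<Longrightarrow> K p (x (\<sigma> q u)) = K p (a q (x u))"
    and "q \<in> Q \<Longrightarrow> t \<in> T \<Longrightarrow> I t (x (\<sigma> q u)) = I t (a q (x u))"
    and "q \<in> Q \<Longrightarrow> A \<in> \<N> \<Longrightarrow> x (\<sigma> q u) \<in> A \<longleftrightarrow> a q (x u) \<in> A"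
  using assms unfolding good_def inconsistent_def by blast+

lemma in_Q: "q \<in> S \<Longrightarrow> q \<in> Q" "q \<in> Q' \<Longrightarrow> q \<in> Q" "q \<in> Q \<Longrightarrow> q \<in> carrier L"
  using S Q Q' by auto

lemma \<sigma>_inj: "q \<in> carrier L \<Longrightarrow> \<sigma> q u = \<sigma> q v \<Longrightarrow> u = v"
  using permutes_inj[OF \<sigma>_permutes] by (simp add: inj_eq)

lemma \<sigma>_in_U: "q \<in> carrier L \<Longrightarrow> u \<in> U \<Longrightarrow> \<sigma> q u \<in> U"
  using permutes_in_image[OF \<sigma>_permutes] by simp

text \<open>A sofic approximation need not send the identity element to the identity map. Here
  multiplicativity at a good vertex, followed by cancelling an injective map, forces it
  locally.\<close>

lemma \<sigma>_one:
  assumes "u \<in> good x"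
  shows "\<sigma> \<one>\<^bsub>L\<^esub> u = u"
proof (rule \<sigma>_inj)
  show "\<sigma> \<one>\<^bsub>L\<^esub> (\<sigma> \<one>\<^bsub>L\<^esub> u) = \<sigma> \<one>\<^bsub>L\<^esub> u"
    using goodD(3)[OF assms, of "\<one>\<^bsub>L\<^esub>" "\<one>\<^bsub>L\<^esub>"] in_Q(1)[OF one_S] by simp
qed simp

text \<open>The action of \<open>H\<close> on the model that is read off from a microstate.\<close>

definition action_of :: "('v \<Rightarrow> 'x) \<Rightarrow> 'h \<Rightarrow> 'v \<Rightarrow> 'v" where
  "action_of x t u = \<sigma> (I t (x u)) u"

lemma action_of_in_U: "t \<in> T \<Longrightarrow> u \<in> good x \<Longrightarrow> action_of x t u \<in> U"
  using goodD(1,2)[of u x] I_T[of t "x u"] in_Q by (auto simp: action_of_def intro!: \<sigma>_in_U)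

text \<open>The product of the two displacements and the displacement for the product of
  \<open>t\<close> and \<open>t'\<close> have the same image under \<open>K\<close>, which is
  injective in the group element. Goodness of \<open>u\<close> alone suffices, since it also
  determines \<open>I t\<close> at the intermediate vertex.\<close>

lemma action_of_mult:
  assumes t: "t \<in> T" "t' \<in> T" "t \<otimes>\<^bsub>H\<^esub> t' \<in> T" and u: "u \<in> good x"
  shows "action_of x (t \<otimes>\<^bsub>H\<^esub> t') u = action_of x t (action_of x t' u)"
proof -
  let ?z = "x u"
  define g where "g = I t' ?z"
  have X: "?z \<in> X" using goodD[OF u] by simp
  have tH: "t \<in> carrier H" "t' \<in> carrier H" using t T by auto
  have g: "g \<in> Q'" using I_T[OF t(2) X] by (simp add: g_def)
  then have gL: "g \<in> carrier L" and gQ: "g \<in> Q" using in_Q by auto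
  define h where "h = I t (a g ?z)"
  have aX: "a g ?z \<in> X" using a_closed gL X by simp
  have h: "h \<in> Q'" using I_T[OF t(1) aX] by (simp add: h_def)
  then have hL: "h \<in> carrier L" and hQ: "h \<in> Q" using in_Q by auto
  have "K (h \<otimes>\<^bsub>L\<^esub> g) ?z = t \<otimes>\<^bsub>H\<^esub> t'"
    using K_mult[OF hL gL X] K_I[OF tH(1) aX] K_I[OF tH(2) X] by (simp add: h_def g_def)
  also have "\<dots> = K (I (t \<otimes>\<^bsub>H\<^esub> t') ?z) ?z" using K_I X tH by simp
  finally have "h \<otimes>\<^bsub>L\<^esub> g = I (t \<otimes>\<^bsub>H\<^esub> t') ?z"
    using K_eqD hL gL X tH I_closed by simp
  then have "action_of x (t \<otimes>\<^bsub>H\<^esub> t') u = \<sigma> h (\<sigma> g u)"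
    using goodD(3)[OF u hQ gQ] by (simp add: action_of_def)
  also have "h = I t (x (\<sigma> g u))" using goodD(7)[OF u gQ t(1)] by (simp add: h_def)
  finally show ?thesis by (simp add: action_of_def g_def)
qed

lemma action_of_free:
  assumes t: "t \<in> T" "t' \<in> T" and u: "u \<in> good x" and eq: "action_of x t u = action_of x t' u"
  shows "t = t'"
proof -
  have X: "x u \<in> X" using goodD[OF u] by simp
  have "I t (x u) = I t' (x u)"
    using eq goodD(4)[OF u] I_T[OF t(1) X] I_T[OF t(2) X] in_Q by (simp add: action_of_def)
  then show ?thesis using K_I[of t "x u"] K_I[of t' "x u"] t T X by auto
qed

text \<open>If \<open>u\<close> and \<open>v\<close> have equal images, then \<open>v\<close> is
  \<open>\<sigma> g u\<close> for the quotient \<open>g\<close> of the two displacements; this is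
  why \<open>Q'\<close> contains such quotients. The cocycle identity gives \<open>K g\<close> the
  value one at \<open>x u\<close>, so \<open>g\<close> is trivial.\<close>

lemma inj_on_action_of:
  assumes t: "t \<in> T"
  shows "inj_on (action_of x t) (good x)"
proof (rule inj_onI)
  fix u v assume u: "u \<in> good x" and v: "v \<in> good x" and eq: "action_of x t u = action_of x t v"
  let ?z = "x u"
  have X: "?z \<in> X" "x v \<in> X" using goodD u v by auto
  have tH: "t \<in> carrier H" using t T by auto
  define p where "p = I t ?z"
  define q where "q = I t (x v)"
  define g where "g = inv\<^bsub>L\<^esub> q \<otimes>\<^bsub>L\<^esub> p"
  have Q's: "p \<in> Q'" "q \<in> Q'" "g \<in> Q'" using I_T I_I_T t X by (auto simp: p_def q_def g_def)
  then have L: "p \<in> carrier L" "q \<in> carrier L" "g \<in> carrier L" and Qs: "p \<in> Q" "q \<in> Q" "g \<in> Q"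
    using in_Q by auto
  have qg: "q \<otimes>\<^bsub>L\<^esub> g = p" using L by (simp add: g_def L.m_assoc[symmetric])
  have "\<sigma> q (\<sigma> g u) = \<sigma> p u" using goodD(3)[OF u Qs(2,3)] by (simp add: qg)
  also have "\<dots> = \<sigma> q v" using eq by (simp add: action_of_def p_def q_def)
  finally have "\<sigma> q (\<sigma> g u) = \<sigma> q v" .
  then have vg: "v = \<sigma> g u" using \<sigma>_inj L by metis
  have aX: "a g ?z \<in> X" using a_closed L X by simp
  have "q = I t (a g ?z)" using goodD(7)[OF u Qs(3) t] by (simp add: q_def vg)
  then have "K q (a g ?z) = t" using K_I[OF tH aX] by simp
  then have "K p ?z = t \<otimes>\<^bsub>H\<^esub> K g ?z" using K_mult[OF L(2,3) X(1)] unfolding qg by simp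
  moreover have "K p ?z = t" using K_I tH X by (simp add: p_def)
  ultimately have "K g ?z = \<one>\<^bsub>H\<^esub>" using tH K_closed[OF L(3) X(1)] by simp
  then have "g = \<one>\<^bsub>L\<^esub>" using K_eqD[of g ?z "\<one>\<^bsub>L\<^esub>"] K_one X L by simp
  then show "u = v" using vg \<sigma>_one[OF u] by simp
qed

text \<open>
  The rearrangement carrying the action of \<open>H\<close> read off from \<open>x\<close> to the one read off from \<open>x0\<close>.
  It is the identity on the set of \<open>u\<close> with \<open>s u = \<one>\<close>.
\<close>

definition shift :: "('v \<Rightarrow> 'x) \<Rightarrow> ('v \<Rightarrow> 'x) \<Rightarrow> 'v \<Rightarrow> 'l" where
  "shift x x0 u = I (discrepancy (x u) (x0 u) (s u)) (x0 u)"

definition rearr :: "('v \<Rightarrow> 'x) \<Rightarrow> ('v \<Rightarrow> 'x) \<Rightarrow> 'v \<Rightarrow> 'v" where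
  "rearr x x0 u = \<sigma> (shift x x0 u) u"

lemma shift_props:
  assumes "u \<in> good x" "u \<in> good x0"
  shows "shift x x0 u \<in> Q'" "shift x x0 u \<in> Q" "shift x x0 u \<in> carrier L"
    and "discrepancy (x u) (x0 u) (s u) \<in> T"
    and "K (shift x x0 u) (x0 u) = discrepancy (x u) (x0 u) (s u)"
proof -
  have X: "x u \<in> X" "x0 u \<in> X" "u \<in> U" using assms goodD by auto
  show d: "discrepancy (x u) (x0 u) (s u) \<in> T" using discrepancy_T s_S X by simp
  show "shift x x0 u \<in> Q'" unfolding shift_def by (rule I_T[OF d X(2)])
  then show "shift x x0 u \<in> Q" "shift x x0 u \<in> carrier L" using in_Q by auto
  show "K (shift x x0 u) (x0 u) = discrepancy (x u) (x0 u) (s u)"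
    unfolding shift_def using K_I d T X by auto
qed

lemma rearr_in_U:
  assumes "u \<in> good x" "u \<in> good x0"
  shows "rearr x x0 u \<in> U"
  unfolding rearr_def using shift_props(3)[OF assms] goodD(1)[OF assms(1)] by (intro \<sigma>_in_U)

lemma rearr_fixed:
  assumes u: "u \<in> good x" "u \<in> good x0" and su: "s u = \<one>\<^bsub>L\<^esub>"
  shows "rearr x x0 u = u"
proof -
  have X: "x u \<in> X" "x0 u \<in> X" using goodD u by auto
  have "discrepancy (x u) (x0 u) (s u) = \<one>\<^bsub>H\<^esub>" using X by (simp add: su discrepancy_def K_one)
  moreover have "I \<one>\<^bsub>H\<^esub> (x0 u) = \<one>\<^bsub>L\<^esub>" using I_K[of "\<one>\<^bsub>L\<^esub>" "x0 u"] X by (simp add: K_one)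
  ultimately show ?thesis using \<sigma>_one[OF u(1)] by (simp add: rearr_def shift_def)
qed

text \<open>\<open>K_discrepancy\<close> carried to the vertices: goodness replaces \<open>x\<close>
  and \<open>x0\<close> at \<open>\<sigma> g u\<close> by the translates of \<open>x u\<close> and
  \<open>x0 u\<close>.\<close>

lemma shift_step:
  assumes u: "u \<in> good x" "u \<in> good x0" and g: "g \<in> Q'"
    and v: "\<sigma> g u \<in> good x" "\<sigma> g u \<in> good x0"
    and eq: "discrepancy (x u) (x0 u) (s (\<sigma> g u) \<otimes>\<^bsub>L\<^esub> g) = discrepancy (x u) (x0 u) (s u)"
  shows "K (shift x x0 (\<sigma> g u) \<otimes>\<^bsub>L\<^esub> g) (x0 u) = K g (x u) \<otimes>\<^bsub>H\<^esub> K (shift x x0 u) (x0 u)"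
proof -
  let ?v = "\<sigma> g u"
  have X: "x u \<in> X" "x0 u \<in> X" using goodD u by auto
  have gQ: "g \<in> Q" and gL: "g \<in> carrier L" using g in_Q by auto
  have sv: "s ?v \<in> Q" "s ?v \<in> carrier L" using s_S[OF goodD(1)[OF v(1)]] in_Q by auto
  have d: "discrepancy (x ?v) (x0 ?v) (s ?v) = discrepancy (a g (x u)) (a g (x0 u)) (s ?v)"
    using goodD(6)[OF u(1) gQ sv(1)] goodD(6)[OF u(2) gQ sv(1)] by (simp add: discrepancy_def)
  have "shift x x0 ?v = I (discrepancy (x ?v) (x0 ?v) (s ?v)) (a g (x0 u))"
    unfolding shift_def using goodD(7)[OF u(2) gQ shift_props(4)[OF v]] .
  then have "K (shift x x0 ?v) (a g (x0 u)) = discrepancy (x ?v) (x0 ?v) (s ?v)"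
    using K_I[OF _ a_closed[OF gL X(2)]] shift_props(4)[OF v] T by auto
  then have "K (shift x x0 ?v) (a g (x0 u)) = discrepancy (a g (x u)) (a g (x0 u)) (s ?v)"
    by (simp only: d)
  from K_discrepancy[OF gL sv(2) shift_props(3)[OF v] X this]
  show ?thesis by (simp only: eq shift_props(5)[OF u])
qed

text \<open>As for \<open>action_of\<close>, equal images give \<open>v = \<sigma> g u\<close>. By
  \<open>shift_step\<close> the factor \<open>K g (x u)\<close> can then be cancelled to one, whence
  \<open>g\<close> is trivial.\<close>

lemma inj_on_rearr:
  assumes W: "W \<subseteq> good x \<inter> good x0"
    and eq: "\<And>u g. u \<in> W \<Longrightarrow> g \<in> Q' \<Longrightarrow> \<sigma> g u \<in> W \<Longrightarrow>
      discrepancy (x u) (x0 u) (s (\<sigma> g u) \<otimes>\<^bsub>L\<^esub> g) = discrepancy (x u) (x0 u) (s u)"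
  shows "inj_on (rearr x x0) W"
proof (rule inj_onI)
  fix u v assume uv: "u \<in> W" "v \<in> W" and eq': "rearr x x0 u = rearr x x0 v"
  then have u: "u \<in> good x" "u \<in> good x0" and v: "v \<in> good x" "v \<in> good x0" using W by auto
  have X: "x u \<in> X" "x0 u \<in> X" "x v \<in> X" "x0 v \<in> X" using goodD u v by auto
  let ?p = "shift x x0 u" and ?q = "shift x x0 v"
  define g where "g = inv\<^bsub>L\<^esub> ?q \<otimes>\<^bsub>L\<^esub> ?p"
  have g: "g \<in> Q'"
    unfolding g_def shift_def by (rule I_I_T[OF shift_props(4)[OF v] shift_props(4)[OF u] X(4,2)])
  then have gQ: "g \<in> Q" and gL: "g \<in> carrier L" using in_Q by auto
  have qg: "?q \<otimes>\<^bsub>L\<^esub> g = ?p"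
    using shift_props(3)[OF u] shift_props(3)[OF v] by (simp add: g_def L.m_assoc[symmetric])
  have "\<sigma> ?q (\<sigma> g u) = \<sigma> ?q v"
    using goodD(3)[OF u(1) shift_props(2)[OF v] gQ] eq' by (simp add: qg rearr_def)
  then have vg: "v = \<sigma> g u" using \<sigma>_inj shift_props(3)[OF v] by metis
  have "K ?p (x0 u) = K g (x u) \<otimes>\<^bsub>H\<^esub> K ?p (x0 u)"
    using shift_step[OF u g] v eq[OF uv(1) g] uv(2) qg by (simp add: vg[symmetric])
  then have "K g (x u) = \<one>\<^bsub>H\<^esub>"
    using H.r_cancel_one'[OF K_closed[OF gL X(1)] K_closed[OF shift_props(3)[OF u] X(2)]]
      H.r_cancel_one'[OF K_closed[OF shift_props(3)[OF u] X(2)] K_closed[OF gL X(1)]] by blast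
  then have "g = \<one>\<^bsub>L\<^esub>" using K_eqD[of g "x u" "\<one>\<^bsub>L\<^esub>"] K_one X gL by simp
  then show "u = v" using vg \<sigma>_one[OF u(1)] by simp
qed

text \<open>Both sides arise from \<open>u\<close> by a product of two displacements. The products
  have the same value of \<open>K\<close> at \<open>x0 u\<close>, namely \<open>t\<close> times that
  of the shift at \<open>u\<close>, so they are equal.\<close>

lemma rearr_action_of:
  assumes t: "t \<in> T" and u: "u \<in> good x" "u \<in> good x0"
    and v: "action_of x t u \<in> good x" "action_of x t u \<in> good x0"
    and eq: "\<And>g. g \<in> Q' \<Longrightarrow> \<sigma> g u = action_of x t u \<Longrightarrow>
      discrepancy (x u) (x0 u) (s (\<sigma> g u) \<otimes>\<^bsub>L\<^esub> g) = discrepancy (x u) (x0 u) (s u)"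
  shows "rearr x x0 (action_of x t u) = action_of x0 t (rearr x x0 u)"
proof -
  let ?r = "shift x x0 u"
  define g where "g = I t (x u)"
  have X: "x u \<in> X" "x0 u \<in> X" using goodD u by auto
  have tH: "t \<in> carrier H" using t T by auto
  have g: "g \<in> Q'" using I_T[OF t X(1)] by (simp add: g_def)
  then have gQ: "g \<in> Q" and gL: "g \<in> carrier L" using in_Q by auto
  have vg: "action_of x t u = \<sigma> g u" by (simp add: action_of_def g_def)
  let ?r' = "shift x x0 (\<sigma> g u)"
  have v': "\<sigma> g u \<in> good x" "\<sigma> g u \<in> good x0" using v by (simp_all add: vg)
  define h where "h = I t (a ?r (x0 u))"
  have arX: "a ?r (x0 u) \<in> X" using a_closed shift_props(3)[OF u] X by simp
  have h: "h \<in> Q'" using I_T[OF t arX] by (simp add: h_def)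
  then have hQ: "h \<in> Q" and hL: "h \<in> carrier L" using in_Q by auto
  have "K (?r' \<otimes>\<^bsub>L\<^esub> g) (x0 u) = K g (x u) \<otimes>\<^bsub>H\<^esub> K ?r (x0 u)"
    by (rule shift_step[OF u g v' eq[OF g vg[symmetric]]])
  also have "\<dots> = t \<otimes>\<^bsub>H\<^esub> K ?r (x0 u)" using K_I[OF tH X(1)] by (simp add: g_def)
  also have "\<dots> = K (h \<otimes>\<^bsub>L\<^esub> ?r) (x0 u)"
    using K_mult[OF hL shift_props(3)[OF u] X(2)] K_I[OF tH arX] by (simp add: h_def)
  finally have "?r' \<otimes>\<^bsub>L\<^esub> g = h \<otimes>\<^bsub>L\<^esub> ?r"
    by (rule K_eqD) (use shift_props(3)[OF u] shift_props(3)[OF v'] gL hL X in auto)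
  then have "\<sigma> ?r' (\<sigma> g u) = \<sigma> h (\<sigma> ?r u)"
    using goodD(3)[OF u(1) shift_props(2)[OF v'] gQ] goodD(3)[OF u(1) hQ shift_props(2)[OF u]] by simp
  moreover have "h = I t (x0 (\<sigma> ?r u))"
    using goodD(7)[OF u(2) shift_props(2)[OF u] t] by (simp add: h_def)
  ultimately show ?thesis by (simp add: rearr_def action_of_def vg[unfolded action_of_def])
qed

text \<open>
  \<open>rearr x x0 u\<close> depends on \<open>x\<close> only through \<open>K (inv (s u))\<close> at \<open>x d\<close>, \<open>d = \<sigma> (s u) u\<close>, which is why
  \<open>x\<close> can be recovered from its rearrangement.
\<close>

lemma rearr_cong:
  assumes u: "u \<in> good x" "u \<in> good y"
    and eq: "K (inv\<^bsub>L\<^esub> (s u)) (x (\<sigma> (s u) u)) = K (inv\<^bsub>L\<^esub> (s u)) (y (\<sigma> (s u) u))"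
  shows "rearr x x0 u = rearr y x0 u"
proof -
  have X: "x u \<in> X" "y u \<in> X" using goodD u by auto
  have su: "s u \<in> S" using s_S goodD(1)[OF u(1)] by simp
  then have sQ: "s u \<in> Q" and sL: "s u \<in> carrier L" using in_Q by auto
  have "inv\<^bsub>H\<^esub> (K (s u) (x u)) = inv\<^bsub>H\<^esub> (K (s u) (y u))"
    using eq goodD(6)[OF u(1) sQ inv_S[OF su]] goodD(6)[OF u(2) sQ inv_S[OF su]] K_inv[OF sL X(1)] K_inv[OF sL X(2)]
    by simp
  then show ?thesis by (simp add: rearr_def shift_def discrepancy_def)
qed

end

section \<open>Sparse connectivity of product approximations\<close>

context group
begin

text \<open>Words grow on the left: in \<open>slide\<close> the next generator acts after the word
  already travelled.\<close>

primrec word_ball :: "'a set \<Rightarrow> nat \<Rightarrow> 'a set" where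
  "word_ball S 0 = {\<one>}"
| "word_ball S (Suc n) = word_ball S n \<union> (\<lambda>(s, k). s \<otimes> k) ` (S \<times> word_ball S n)"

lemma word_ball_closed: "S \<subseteq> carrier G \<Longrightarrow> word_ball S n \<subseteq> carrier G"
  by (induction n) auto

lemma finite_word_ball: "finite S \<Longrightarrow> finite (word_ball S n)"
  by (induction n) auto

lemma one_in_word_ball: "\<one> \<in> word_ball S n"
  by (induction n) auto

lemma word_ball_mult:
  assumes "S \<subseteq> carrier G" "h \<in> word_ball S n" "k \<in> word_ball S m"
  shows "h \<otimes> k \<in> word_ball S (n + m)"
  using assms(2)
proof (induction n arbitrary: h)
  case 0
  then show ?case using assms word_ball_closed[of S m] by auto
next
  case (Suc n)
  show ?case
  proof (cases "h \<in> word_ball S n")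
    case True
    then show ?thesis using Suc.IH by simp
  next
    case False
    then obtain s h' where h: "s \<in> S" "h' \<in> word_ball S n" "h = s \<otimes> h'" using Suc.prems by auto
    moreover have "h' \<in> carrier G" "k \<in> carrier G" "s \<in> carrier G"
      using word_ball_closed[OF assms(1)] h assms by blast+
    ultimately have "h \<otimes> k = s \<otimes> (h' \<otimes> k)" by (simp add: m_assoc)
    then show ?thesis using h(1) Suc.IH[OF h(2)] by auto
  qed
qed

lemma word_ball_inv:
  assumes S: "S \<subseteq> carrier G" "\<And>s. s \<in> S \<Longrightarrow> inv s \<in> S" and h: "h \<in> word_ball S n"
  shows "inv h \<in> word_ball S n"
  using h
proof (induction n arbitrary: h)
  case (Suc n)
  show ?case
  proof (cases "h \<in> word_ball S n")
    case False
    then obtain s h' where h: "s \<in> S" "h' \<in> word_ball S n" "h = s \<otimes> h'" using Suc.prems by auto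
    then have "inv s \<in> word_ball S (Suc 0)" using S by (force simp: image_iff)
    then have "inv h' \<otimes> inv s \<in> word_ball S (n + Suc 0)"
      using Suc.IH[OF h(2)] by (intro word_ball_mult S)
    moreover have "h' \<in> carrier G" "s \<in> carrier G"
      using word_ball_closed[OF S(1)] h S by blast+
    ultimately show ?thesis using h(3) by (simp add: inv_mult_group)
  qed (use Suc.IH in simp)
qed simp

lemma generate_subset_word_ball:
  assumes S: "S \<subseteq> carrier G" "\<And>s. s \<in> S \<Longrightarrow> inv s \<in> S"
  shows "generate G S \<subseteq> (\<Union>n. word_ball S n)"
proof
  fix h assume "h \<in> generate G S"
  then show "h \<in> (\<Union>n. word_ball S n)"
  proof induction
    case one
    then show ?case using one_in_word_ball by blast
  next
    case (incl h)
    then have "h \<in> word_ball S (Suc 0)" using S by (force simp: image_iff)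
    then show ?case by blast
  next
    case (inv h)
    then have "inv h \<in> word_ball S (Suc 0)" using S by (force simp: image_iff)
    then show ?case by blast
  next
    case (eng h1 h2)
    then show ?case using word_ball_mult[OF S(1)] by blast
  qed
qed

text \<open>The balls increase and exhaust an infinite group, so one of them contains any given
  finite number of its elements. The failure of local finiteness enters here.\<close>

lemma word_ball_unbounded:
  assumes S: "finite S" "S \<subseteq> carrier G" "\<And>s. s \<in> S \<Longrightarrow> inv s \<in> S" and inf: "infinite (generate G S)"
  shows "\<exists>n. m \<le> card (word_ball S n)"
proof (rule ccontr)
  assume "\<not> ?thesis"
  then have less: "card (word_ball S n) < m" for n by (simp add: not_le)
  have mono: "word_ball S n \<subseteq> word_ball S k" if "n \<le> k" for n k
    using that by (induction rule: dec_induct) auto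
  have "infinite (\<Union>n. word_ball S n)"
    using inf generate_subset_word_ball[OF S(2,3)] finite_subset by blast
  then obtain E where E: "E \<subseteq> (\<Union>n. word_ball S n)" "finite E" "card E = m"
    using infinite_arbitrarily_large by blast
  have "\<forall>x\<in>E. \<exists>n. x \<in> word_ball S n" using E(1) by blast
  then obtain n where n: "\<And>x. x \<in> E \<Longrightarrow> x \<in> word_ball S (n x)" by metis
  have "E \<subseteq> word_ball S (\<Sum>x\<in>E. n x)"
  proof
    fix x assume x: "x \<in> E"
    have "n x \<le> (\<Sum>x\<in>E. n x)" by (rule member_le_sum[OF x]) (use E in auto)
    then show "x \<in> word_ball S (\<Sum>x\<in>E. n x)" using mono n[OF x] by blast
  qed
  then have "m \<le> card (word_ball S (\<Sum>x\<in>E. n x))"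
    using card_mono[OF finite_word_ball[OF S(1)]] E(3) by blast
  with less show False by (simp add: not_le[symmetric])
qed

end

text \<open>A direct product given by abstract coordinate maps. The two factors play different roles
  below, and either of them may be the one that is not locally finite; this form allows the product
  to be read in both orders.\<close>

locale group_pair = G: group G + C: group C + L: group L
  for G :: "('g, 'i) monoid_scheme" and C :: "('c, 'j) monoid_scheme" and L :: "('l, 'm) monoid_scheme" +
  fixes pr1 :: "'l \<Rightarrow> 'g" and pr2 :: "'l \<Rightarrow> 'c" and mk :: "'g \<Rightarrow> 'c \<Rightarrow> 'l"
  assumes mk_closed: "g \<in> carrier G \<Longrightarrow> c \<in> carrier C \<Longrightarrow> mk g c \<in> carrier L"
    and pr_closed: "l \<in> carrier L \<Longrightarrow> pr1 l \<in> carrier G" "l \<in> carrier L \<Longrightarrow> pr2 l \<in> carrier C"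
    and pr_mk: "g \<in> carrier G \<Longrightarrow> c \<in> carrier C \<Longrightarrow> pr1 (mk g c) = g"
      "g \<in> carrier G \<Longrightarrow> c \<in> carrier C \<Longrightarrow> pr2 (mk g c) = c"
    and mk_pr: "l \<in> carrier L \<Longrightarrow> mk (pr1 l) (pr2 l) = l"
    and mk_mult: "g \<in> carrier G \<Longrightarrow> c \<in> carrier C \<Longrightarrow> g' \<in> carrier G \<Longrightarrow> c' \<in> carrier C \<Longrightarrow>
      mk g c \<otimes>\<^bsub>L\<^esub> mk g' c' = mk (g \<otimes>\<^bsub>G\<^esub> g') (c \<otimes>\<^bsub>C\<^esub> c')"

text \<open>
  \<open>B\<close> and \<open>B'\<close> are sparse sets of \<open>C\<close>-coordinates and \<open>A\<close> is a sparse set of \<open>G\<close>-coordinates. The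
  edges on which \<open>K\<close> is prescribed are: the \<open>S0\<close>-edges over \<open>B\<close>, the \<open>T2\<close>-edges over \<open>A\<close> and the
  \<open>T3\<close>-edges over \<open>B'\<close>. Along them one gets from \<open>mk g c\<close> to \<open>mk g' c'\<close> by sliding in the
  \<open>G\<close>-direction to \<open>A\<close>, jumping there in the \<open>C\<close>-direction, and sliding back.
\<close>

locale sparse_model = orbit_model L H X a K I U \<sigma> Q Q' S T \<N> s + group_pair G C L pr1 pr2 mk
  for G :: "('g, 'i) monoid_scheme" and C :: "('c, 'j) monoid_scheme"
    and L :: "('l, 'm) monoid_scheme" and H :: "('h, 'n) monoid_scheme"
    and X :: "'x set" and a :: "'l \<Rightarrow> 'x \<Rightarrow> 'x" and K :: "'l \<Rightarrow> 'x \<Rightarrow> 'h" and I :: "'h \<Rightarrow> 'x \<Rightarrow> 'l"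
    and U :: "'v set" and \<sigma> :: "'l \<Rightarrow> 'v \<Rightarrow> 'v" and Q Q' S :: "'l set" and T :: "'h set"
    and \<N> :: "'x set set" and s :: "'v \<Rightarrow> 'l"
    and pr1 :: "'l \<Rightarrow> 'g" and pr2 :: "'l \<Rightarrow> 'c" and mk :: "'g \<Rightarrow> 'c \<Rightarrow> 'l" +
  fixes V :: "'v1 set" and W :: "'v2 set"
    and \<sigma>1 :: "'g \<Rightarrow> 'v1 \<Rightarrow> 'v1" and \<sigma>2 :: "'c \<Rightarrow> 'v2 \<Rightarrow> 'v2"
    and pv :: "'v \<Rightarrow> 'v1" and pw :: "'v \<Rightarrow> 'v2"
    and A :: "'v1 set" and B B' :: "'v2 set"
    and S0 :: "'g set" and N :: nat and P1 Q1 T3 :: "'g set" and P2 R2 Q2 T2 F' :: "'c set"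
  assumes pv: "u \<in> U \<Longrightarrow> pv u \<in> V" "l \<in> carrier L \<Longrightarrow> u \<in> U \<Longrightarrow> pv (\<sigma> l u) = \<sigma>1 (pr1 l) (pv u)"
    and pw: "u \<in> U \<Longrightarrow> pw u \<in> W" "l \<in> carrier L \<Longrightarrow> u \<in> U \<Longrightarrow> pw (\<sigma> l u) = \<sigma>2 (pr2 l) (pw u)"
    and Q_eq: "Q = (\<lambda>(g, c). mk g c) ` (Q1 \<times> Q2)"
    and Q1: "Q1 \<subseteq> carrier G" and Q2: "Q2 \<subseteq> carrier C"
    and S0: "S0 \<subseteq> Q1" and P1: "\<And>k g. k \<in> G.word_ball S0 N \<Longrightarrow> g \<in> P1 \<Longrightarrow> k \<otimes>\<^bsub>G\<^esub> g \<in> Q1" "P1 \<subseteq> carrier G"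
    and ball_Q1: "G.word_ball S0 N \<subseteq> Q1"
    and T3: "T3 \<subseteq> Q1" "\<And>g g'. g \<in> P1 \<Longrightarrow> g' \<in> P1 \<Longrightarrow> g' \<otimes>\<^bsub>G\<^esub> inv\<^bsub>G\<^esub> g \<in> T3"
    and P2: "P2 \<subseteq> R2" "R2 \<subseteq> Q2" "F' \<subseteq> Q2" "\<And>f c. f \<in> F' \<Longrightarrow> c \<in> P2 \<Longrightarrow> f \<otimes>\<^bsub>C\<^esub> c \<in> R2" "\<one>\<^bsub>C\<^esub> \<in> Q2"
    and T2: "T2 \<subseteq> Q2" "\<And>c c'. c \<in> R2 \<Longrightarrow> c' \<in> R2 \<Longrightarrow> c' \<otimes>\<^bsub>C\<^esub> inv\<^bsub>C\<^esub> c \<in> T2"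
    and A: "\<And>v. v \<in> V \<Longrightarrow> v \<in> A \<or> (\<exists>k\<in>G.word_ball S0 N. \<sigma>1 k v \<in> A)"
    and B': "B' \<subseteq> B" "\<And>w. w \<in> B \<Longrightarrow> w \<in> B' \<or> (\<exists>f\<in>F'. \<sigma>2 f w \<in> B')"
begin

definition same_data :: "('v \<Rightarrow> 'x) \<Rightarrow> ('v \<Rightarrow> 'x) \<Rightarrow> bool" where
  "same_data x x0 \<longleftrightarrow> (\<forall>v\<in>U.
     (pw v \<in> B \<longrightarrow> (\<forall>g\<in>S0. K (mk g \<one>\<^bsub>C\<^esub>) (x v) = K (mk g \<one>\<^bsub>C\<^esub>) (x0 v))) \<and>
     (pv v \<in> A \<longrightarrow> (\<forall>c\<in>T2. K (mk \<one>\<^bsub>G\<^esub> c) (x v) = K (mk \<one>\<^bsub>G\<^esub> c) (x0 v))) \<and>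
     (pw v \<in> B' \<longrightarrow> (\<forall>g\<in>T3. K (mk g \<one>\<^bsub>C\<^esub>) (x v) = K (mk g \<one>\<^bsub>C\<^esub>) (x0 v))))"

lemma mk_Q: "g \<in> Q1 \<Longrightarrow> c \<in> Q2 \<Longrightarrow> mk g c \<in> Q"
  by (auto simp: Q_eq)

lemma P1_Q1: "g \<in> P1 \<Longrightarrow> g \<in> Q1"
  using P1(1)[OF G.one_in_word_ball, of g] P1(2) by auto

lemma one_Q1: "\<one>\<^bsub>G\<^esub> \<in> Q1"
  using ball_Q1 G.one_in_word_ball by blast

section \<open>Constancy of the discrepancy\<close>

context
  fixes x x0 u
  assumes data: "same_data x x0" and ux: "u \<in> good x" and ux0: "u \<in> good x0"
begin

lemma coord:
  assumes "g \<in> Q1" "c \<in> Q2"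
  shows "pv (\<sigma> (mk g c) u) = \<sigma>1 g (pv u)" "pw (\<sigma> (mk g c) u) = \<sigma>2 c (pw u)" "\<sigma> (mk g c) u \<in> U"
proof -
  have c: "g \<in> carrier G" "c \<in> carrier C" using assms Q1 Q2 by auto
  then have "mk g c \<in> carrier L" by (rule mk_closed)
  then show "pv (\<sigma> (mk g c) u) = \<sigma>1 g (pv u)" "pw (\<sigma> (mk g c) u) = \<sigma>2 c (pw u)" "\<sigma> (mk g c) u \<in> U"
    using pv(2) pw(2) pr_mk[OF c] goodD(1)[OF ux] \<sigma>_in_U by auto
qed

lemma agree_step:
  assumes q: "g \<in> Q1" "c \<in> Q2" and l: "g' \<in> Q1" "c' \<in> Q2"
    and eq: "K (mk g' c') (x (\<sigma> (mk g c) u)) = K (mk g' c') (x0 (\<sigma> (mk g c) u))"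
  shows "discrepancy (x u) (x0 u) (mk (g' \<otimes>\<^bsub>G\<^esub> g) (c' \<otimes>\<^bsub>C\<^esub> c)) = discrepancy (x u) (x0 u) (mk g c)"
proof -
  have c: "g \<in> carrier G" "c \<in> carrier C" "g' \<in> carrier G" "c' \<in> carrier C" using assms Q1 Q2 by auto
  have "K (mk g' c') (a (mk g c) (x u)) = K (mk g' c') (a (mk g c) (x0 u))"
    using eq goodD(6)[OF ux mk_Q[OF q] mk_Q[OF l]] goodD(6)[OF ux0 mk_Q[OF q] mk_Q[OF l]] by simp
  then have "discrepancy (x u) (x0 u) (mk g' c' \<otimes>\<^bsub>L\<^esub> mk g c) = discrepancy (x u) (x0 u) (mk g c)"
    using c goodD(2)[OF ux] goodD(2)[OF ux0] by (intro discrepancy_step mk_closed)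
  then show ?thesis using c by (simp add: mk_mult)
qed

text \<open>Each letter of the word \<open>k\<close> is an \<open>S0\<close>-edge that leaves the
  second coordinate unchanged. The path therefore stays over \<open>B\<close>, where these edges
  carry prescribed values.\<close>

lemma slide:
  assumes g: "g \<in> P1" and c: "c \<in> R2" and B: "\<sigma>2 c (pw u) \<in> B" and k: "k \<in> G.word_ball S0 N"
  shows "discrepancy (x u) (x0 u) (mk (k \<otimes>\<^bsub>G\<^esub> g) c) = discrepancy (x u) (x0 u) (mk g c)"
proof -
  have gG: "g \<in> carrier G" using g P1 by auto
  have S0G: "S0 \<subseteq> carrier G" using S0 Q1 by auto
  have cQ: "c \<in> Q2" "c \<in> carrier C" using c P2 Q2 by auto
  have mono: "G.word_ball S0 n \<subseteq> G.word_ball S0 N" if "n \<le> N" for n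
    using that by (induction rule: inc_induct) auto
  have "discrepancy (x u) (x0 u) (mk (k \<otimes>\<^bsub>G\<^esub> g) c) = discrepancy (x u) (x0 u) (mk g c)"
    if "n \<le> N" "k \<in> G.word_ball S0 n" for n k
    using that
  proof (induction n arbitrary: k)
    case 0
    then show ?case using gG by simp
  next
    case (Suc n)
    show ?case
    proof (cases "k \<in> G.word_ball S0 n")
      case True
      then show ?thesis using Suc by simp
    next
      case False
      then obtain h k' where k: "h \<in> S0" "k' \<in> G.word_ball S0 n" "k = h \<otimes>\<^bsub>G\<^esub> k'" using Suc.prems by auto
      have k'N: "k' \<in> G.word_ball S0 N" using mono[of n] k(2) Suc.prems by auto
      then have kg: "k' \<otimes>\<^bsub>G\<^esub> g \<in> Q1" using P1(1) g by blast
      have cl: "h \<in> carrier G" "k' \<in> carrier G"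
        using k S0G k'N G.word_ball_closed[OF S0G] by auto
      have "K (mk h \<one>\<^bsub>C\<^esub>) (x (\<sigma> (mk (k' \<otimes>\<^bsub>G\<^esub> g) c) u)) = K (mk h \<one>\<^bsub>C\<^esub>) (x0 (\<sigma> (mk (k' \<otimes>\<^bsub>G\<^esub> g) c) u))"
        using data coord[OF kg cQ(1)] B k(1) unfolding same_data_def by simp
      then have "discrepancy (x u) (x0 u) (mk (h \<otimes>\<^bsub>G\<^esub> (k' \<otimes>\<^bsub>G\<^esub> g)) (\<one>\<^bsub>C\<^esub> \<otimes>\<^bsub>C\<^esub> c))
          = discrepancy (x u) (x0 u) (mk (k' \<otimes>\<^bsub>G\<^esub> g) c)"
        using k(1) S0 P2(5) by (intro agree_step kg cQ(1)) auto
      also have "\<dots> = discrepancy (x u) (x0 u) (mk g c)"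
        using Suc.IH[OF _ k(2)] Suc.prems by simp
      finally show ?thesis using k(3) cl gG cQ by (simp add: G.m_assoc)
    qed
  qed
  then show ?thesis using k by blast
qed

text \<open>Slide in the fibre over \<open>c\<close> until the first coordinate reaches
  \<open>A\<close>, take the prescribed \<open>T2\<close>-edge to the fibre over \<open>c'\<close>,
  and slide back along the same word. Both fibres lie over \<open>B\<close>, so both slides are
  allowed.\<close>

lemma jump:
  assumes g: "g \<in> P1" and c: "c \<in> R2" "c' \<in> R2" and B: "\<sigma>2 c (pw u) \<in> B" "\<sigma>2 c' (pw u) \<in> B"
  shows "discrepancy (x u) (x0 u) (mk g c) = discrepancy (x u) (x0 u) (mk g c')"
proof -
  have gG: "g \<in> carrier G" using g P1 by auto
  have cQ: "c \<in> Q2" "c' \<in> Q2" using c P2 by auto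
  then have cC: "c \<in> carrier C" "c' \<in> carrier C" using Q2 by auto
  have S0G: "S0 \<subseteq> carrier G" using S0 Q1 by auto
  have "\<sigma>1 g (pv u) \<in> V"
    using coord[OF P1_Q1[OF g] P2(5)] pv(1) by metis
  then consider "\<sigma>1 g (pv u) \<in> A" | k where "k \<in> G.word_ball S0 N" "\<sigma>1 k (\<sigma>1 g (pv u)) \<in> A"
    using A by blast
  then obtain k where k: "k \<in> G.word_ball S0 N" "\<sigma>1 (k \<otimes>\<^bsub>G\<^esub> g) (pv u) \<in> A"
  proof cases
    case 1
    then show ?thesis using that[OF G.one_in_word_ball] gG by simp
  next
    case (2 k)
    have kQ: "k \<in> Q1" using 2 ball_Q1 by auto
    then have kG: "k \<in> carrier G" using Q1 by auto
    have "\<sigma> (mk k \<one>\<^bsub>C\<^esub> \<otimes>\<^bsub>L\<^esub> mk g \<one>\<^bsub>C\<^esub>) u = \<sigma> (mk k \<one>\<^bsub>C\<^esub>) (\<sigma> (mk g \<one>\<^bsub>C\<^esub>) u)"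
      by (rule goodD(3)[OF ux]) (use kQ P1_Q1[OF g] P2(5) in \<open>auto intro: mk_Q\<close>)
    then have "\<sigma> (mk (k \<otimes>\<^bsub>G\<^esub> g) \<one>\<^bsub>C\<^esub>) u = \<sigma> (mk k \<one>\<^bsub>C\<^esub>) (\<sigma> (mk g \<one>\<^bsub>C\<^esub>) u)"
      using kG gG by (simp add: mk_mult)
    then have "\<sigma>1 (k \<otimes>\<^bsub>G\<^esub> g) (pv u) = pv (\<sigma> (mk k \<one>\<^bsub>C\<^esub>) (\<sigma> (mk g \<one>\<^bsub>C\<^esub>) u))"
      using coord(1)[OF P1(1)[OF 2(1) g] P2(5)] by simp
    also have "\<dots> = \<sigma>1 k (\<sigma>1 g (pv u))"
      using coord[OF P1_Q1[OF g] P2(5)] pv(2)[OF mk_closed[OF kG C.one_closed]] pr_mk(1)[OF kG C.one_closed] by simp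
    finally show ?thesis using that 2 by simp
  qed
  have kg: "k \<otimes>\<^bsub>G\<^esub> g \<in> Q1" using P1(1) k g by blast
  then have kgG: "k \<otimes>\<^bsub>G\<^esub> g \<in> carrier G" using Q1 by auto
  have t: "c' \<otimes>\<^bsub>C\<^esub> inv\<^bsub>C\<^esub> c \<in> T2" using T2(2) c by blast
  have "K (mk \<one>\<^bsub>G\<^esub> (c' \<otimes>\<^bsub>C\<^esub> inv\<^bsub>C\<^esub> c)) (x (\<sigma> (mk (k \<otimes>\<^bsub>G\<^esub> g) c) u))
      = K (mk \<one>\<^bsub>G\<^esub> (c' \<otimes>\<^bsub>C\<^esub> inv\<^bsub>C\<^esub> c)) (x0 (\<sigma> (mk (k \<otimes>\<^bsub>G\<^esub> g) c) u))"
    using data coord[OF kg cQ(1)] k(2) t unfolding same_data_def by simp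
  then have "discrepancy (x u) (x0 u) (mk (\<one>\<^bsub>G\<^esub> \<otimes>\<^bsub>G\<^esub> (k \<otimes>\<^bsub>G\<^esub> g)) (c' \<otimes>\<^bsub>C\<^esub> inv\<^bsub>C\<^esub> c \<otimes>\<^bsub>C\<^esub> c))
      = discrepancy (x u) (x0 u) (mk (k \<otimes>\<^bsub>G\<^esub> g) c)"
    using t T2(1) one_Q1 by (intro agree_step kg cQ(1)) auto
  then have "discrepancy (x u) (x0 u) (mk (k \<otimes>\<^bsub>G\<^esub> g) c') = discrepancy (x u) (x0 u) (mk (k \<otimes>\<^bsub>G\<^esub> g) c)"
    using cC kgG by (simp add: C.m_assoc)
  then show ?thesis using slide[OF g c(1) B(1) k(1)] slide[OF g c(2) B(2) k(1)] by simp
qed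

text \<open>A change of the first coordinate may be too long for \<open>S0\<close>-words inside the
  window. It is done over \<open>B'\<close> instead: jump there, use a \<open>T3\<close>-edge, and
  jump back.\<close>

lemma cross:
  assumes g: "g \<in> P1" "g' \<in> P1" and c: "c \<in> P2" and B: "\<sigma>2 c (pw u) \<in> B"
  shows "discrepancy (x u) (x0 u) (mk g c) = discrepancy (x u) (x0 u) (mk g' c)"
proof -
  have gQ: "g \<in> Q1" "g' \<in> Q1" using g P1_Q1 by auto
  then have gG: "g \<in> carrier G" "g' \<in> carrier G" using Q1 by auto
  have cR: "c \<in> R2" and cQ: "c \<in> Q2" using c P2 by auto
  then have cC: "c \<in> carrier C" using Q2 by auto
  \<comment> \<open>The new second coordinate is \<open>c\<close> or a product \<open>f c\<close>
    with \<open>f\<close> in \<open>F'\<close>; \<open>R2\<close> has been enlarged beyond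
    \<open>P2\<close> for the sake of these products.\<close>
  consider "\<sigma>2 c (pw u) \<in> B'" | f where "f \<in> F'" "\<sigma>2 f (\<sigma>2 c (pw u)) \<in> B'"
    using B'(2)[OF B] by blast
  then obtain c' where c': "c' \<in> R2" "\<sigma>2 c' (pw u) \<in> B'"
  proof cases
    case 1
    then show ?thesis using that cR by blast
  next
    case (2 f)
    have fQ: "f \<in> Q2" using 2 P2 by auto
    then have fC: "f \<in> carrier C" using Q2 by auto
    have fcR: "f \<otimes>\<^bsub>C\<^esub> c \<in> R2" using P2(4) 2 c by blast
    then have fcQ: "f \<otimes>\<^bsub>C\<^esub> c \<in> Q2" using P2 by auto
    have "\<sigma> (mk \<one>\<^bsub>G\<^esub> f \<otimes>\<^bsub>L\<^esub> mk \<one>\<^bsub>G\<^esub> c) u = \<sigma> (mk \<one>\<^bsub>G\<^esub> f) (\<sigma> (mk \<one>\<^bsub>G\<^esub> c) u)"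
      by (rule goodD(3)[OF ux]) (use fQ cQ one_Q1 in \<open>auto intro: mk_Q\<close>)
    then have "\<sigma> (mk \<one>\<^bsub>G\<^esub> (f \<otimes>\<^bsub>C\<^esub> c)) u = \<sigma> (mk \<one>\<^bsub>G\<^esub> f) (\<sigma> (mk \<one>\<^bsub>G\<^esub> c) u)"
      using fC cC by (simp add: mk_mult)
    then have "\<sigma>2 (f \<otimes>\<^bsub>C\<^esub> c) (pw u) = pw (\<sigma> (mk \<one>\<^bsub>G\<^esub> f) (\<sigma> (mk \<one>\<^bsub>G\<^esub> c) u))"
      using coord(2)[OF one_Q1 fcQ] by simp
    also have "\<dots> = \<sigma>2 f (\<sigma>2 c (pw u))"
      using coord[OF one_Q1 cQ] pw(2)[OF mk_closed[OF G.one_closed fC]] pr_mk(2)[OF G.one_closed fC] by simp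
    finally show ?thesis using that[OF fcR] 2 by simp
  qed
  have c'Q: "c' \<in> Q2" using c' P2 by auto
  then have c'C: "c' \<in> carrier C" using Q2 by auto
  have c'B: "\<sigma>2 c' (pw u) \<in> B" using c' B' by auto
  have t: "g' \<otimes>\<^bsub>G\<^esub> inv\<^bsub>G\<^esub> g \<in> T3" using T3(2) g by blast
  have "K (mk (g' \<otimes>\<^bsub>G\<^esub> inv\<^bsub>G\<^esub> g) \<one>\<^bsub>C\<^esub>) (x (\<sigma> (mk g c') u))
      = K (mk (g' \<otimes>\<^bsub>G\<^esub> inv\<^bsub>G\<^esub> g) \<one>\<^bsub>C\<^esub>) (x0 (\<sigma> (mk g c') u))"
    using data coord[OF gQ(1) c'Q] c'(2) t unfolding same_data_def by simp
  then have "discrepancy (x u) (x0 u) (mk (g' \<otimes>\<^bsub>G\<^esub> inv\<^bsub>G\<^esub> g \<otimes>\<^bsub>G\<^esub> g) (\<one>\<^bsub>C\<^esub> \<otimes>\<^bsub>C\<^esub> c'))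
      = discrepancy (x u) (x0 u) (mk g c')"
    using t T3(1) P2(5) by (intro agree_step gQ(1) c'Q) auto
  then have "discrepancy (x u) (x0 u) (mk g' c') = discrepancy (x u) (x0 u) (mk g c')"
    using gG c'C by (simp add: G.m_assoc)
  then show ?thesis using jump[OF g(1) cR c'(1) B c'B] jump[OF g(2) cR c'(1) B c'B] by simp
qed

lemma discrepancy_constant:
  assumes p: "g \<in> P1" "c \<in> P2" "\<sigma>2 c (pw u) \<in> B" and q: "g' \<in> P1" "c' \<in> P2" "\<sigma>2 c' (pw u) \<in> B"
  shows "discrepancy (x u) (x0 u) (mk g c) = discrepancy (x u) (x0 u) (mk g' c')"
  using cross[OF p(1) q(1) p(2,3)] jump[OF q(1) _ _ p(3) q(3)] p(2) q(2) P2(1) by auto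

end

end

section \<open>Bounded orbit equivalence\<close>

text \<open>Here \<open>X\<close> is an invariant set of full measure on which both cocycles are
  defined everywhere. Finiteness of \<open>K\<close> is asked on the whole type, since a microstate
  may take values outside \<open>X\<close> and the recorded data read \<open>K\<close> there as
  well.\<close>

locale bounded_oe = A: pmp_action L M \<alpha> + B: pmp_action H N \<beta> + orbit_cocycles L H X \<alpha> K I
  for L :: "('l, 'm) monoid_scheme" and M :: "'x measure" and \<alpha> :: "'l \<Rightarrow> 'x \<Rightarrow> 'x"
    and H :: "('h, 'n) monoid_scheme" and N :: "'y measure" and \<beta> :: "'h \<Rightarrow> 'y \<Rightarrow> 'y"
    and X :: "'x set" and K :: "'l \<Rightarrow> 'x \<Rightarrow> 'h" and I :: "'h \<Rightarrow> 'x \<Rightarrow> 'l" +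
  fixes \<Psi> :: "'x \<Rightarrow> 'y"
  assumes X_sets: "X \<in> sets M" and X_conull: "measure M X = 1"
    and finite_K: "l \<in> carrier L \<Longrightarrow> finite (range (K l))"
    and finite_I: "t \<in> carrier H \<Longrightarrow> finite (I t ` X)"
    and K_sets: "l \<in> carrier L \<Longrightarrow> {z \<in> X. K l z = h} \<in> sets M"
    and inj_\<Psi>: "inj_on \<Psi> X"
    and \<Psi>_I: "t \<in> carrier H \<Longrightarrow> z \<in> X \<Longrightarrow> \<Psi> (\<alpha> (I t z) z) = \<beta> t (\<Psi> z)"
    and \<Psi>_space: "z \<in> X \<Longrightarrow> \<Psi> z \<in> space N"
    and \<Psi>_sets: "A \<in> sets N \<Longrightarrow> {z \<in> X. \<Psi> z \<in> A} \<in> sets M"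
    and \<Psi>_measure: "A \<in> sets N \<Longrightarrow> measure M {z \<in> X. \<Psi> z \<in> A} = measure N A"
    and \<Psi>_image_sets: "E \<in> sets M \<Longrightarrow> \<Psi> ` (E \<inter> X) \<in> sets N"
begin

lemma I_sets:
  assumes "t \<in> carrier H"
  shows "{z \<in> X. I t z = l} \<in> sets M"
proof (cases "l \<in> carrier L")
  case True
  then have "{z \<in> X. I t z = l} = {z \<in> X. K l z = t}" using I_K K_I assms by auto
  then show ?thesis using K_sets[OF True] by simp
next
  case False
  then have "{z \<in> X. I t z = l} = {}" using I_closed assms by auto
  then show ?thesis by (simp only: sets.empty_sets)
qed

end

text \<open>The given cocycles satisfy their equations on \<open>X0\<close> but are ambiguous at
  points with nontrivial stabilizers. Removing these points, and then every orbit that meets the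
  removed set, makes the cocycle identities hold without exception.\<close>

lemma boundedly_orbit_equivalent_cocycles:
  fixes L :: "('l, 'm) monoid_scheme" and H :: "('h, 'n) monoid_scheme"
    and M :: "'x measure" and N :: "'y measure"
  assumes L: "free_pmp_action L M \<alpha>" "countable (carrier L)"
    and H: "free_pmp_action H N \<beta>"
    and oe: "boundedly_orbit_equivalent L M \<alpha> H N \<beta>"
  obtains X K I \<Psi> where "bounded_oe L M \<alpha> H N \<beta> X K I \<Psi>"
proof -
  interpret A: free_pmp_action L M \<alpha> by fact
  interpret B: free_pmp_action H N \<beta> by fact
  interpret LG: group L by (rule A.group_G)
  interpret HG: group H by (rule B.group_G)
  obtain X0 Y0 \<Psi> \<kappa> \<theta> where oe': "orbit_equivalence L M \<alpha> H N \<beta> X0 Y0 \<Psi>"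
    and \<kappa>: "\<And>g x. g \<in> carrier L \<Longrightarrow> x \<in> X0 \<Longrightarrow> \<kappa> g x \<in> carrier H \<and> \<Psi> (\<alpha> g x) = \<beta> (\<kappa> g x) (\<Psi> x)"
    and \<theta>: "\<And>t y. t \<in> carrier H \<Longrightarrow> y \<in> Y0 \<Longrightarrow> \<theta> t y \<in> carrier L \<and>
          the_inv_into X0 \<Psi> (\<beta> t y) = \<alpha> (\<theta> t y) (the_inv_into X0 \<Psi> y)"
    and fin: "\<And>g. g \<in> carrier L \<Longrightarrow> finite (\<kappa> g ` X0)" "\<And>t. t \<in> carrier H \<Longrightarrow> finite (\<theta> t ` Y0)"
    using oe unfolding boundedly_orbit_equivalent_def orbit_cocycle_def by blast
  have X0: "X0 \<in> sets M" "emeasure M (space M - X0) = 0" "\<And>g x. g \<in> carrier L \<Longrightarrow> x \<in> X0 \<Longrightarrow> \<alpha> g x \<in> X0"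
    and Y0: "Y0 \<in> sets N" "emeasure N (space N - Y0) = 0" "\<And>t y. t \<in> carrier H \<Longrightarrow> y \<in> Y0 \<Longrightarrow> \<beta> t y \<in> Y0"
    using oe' unfolding orbit_equivalence_def invariant_conull_def by blast+
  have bij: "bij_betw \<Psi> X0 Y0"
    and \<Psi>m: "\<Psi> \<in> measurable (restrict_space M X0) (restrict_space N Y0)"
    and inv\<Psi>m: "the_inv_into X0 \<Psi> \<in> measurable (restrict_space N Y0) (restrict_space M X0)"
    and \<Psi>d: "distr (restrict_space M X0) (restrict_space N Y0) \<Psi> = restrict_space N Y0"
    using oe' unfolding orbit_equivalence_def measure_isomorphism_def by blast+
  have X0sp: "X0 \<subseteq> space M" and Y0sp: "Y0 \<subseteq> space N" using X0(1) Y0(1) sets.sets_into_space by auto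
  have inj: "inj_on \<Psi> X0" and \<Psi>Y: "\<And>x. x \<in> X0 \<Longrightarrow> \<Psi> x \<in> Y0" using bij by (auto simp: bij_betw_def)
  have spX0: "space (restrict_space M X0) = X0" and spY0: "space (restrict_space N Y0) = Y0"
    using X0sp Y0sp by (auto simp: space_restrict_space)
  have setsX0: "A \<in> sets M" if "A \<in> sets (restrict_space M X0)" for A
    using that X0(1) by (auto simp: sets_restrict_space_iff)
  have setsY0: "A \<in> sets N" if "A \<in> sets (restrict_space N Y0)" for A
    using that Y0(1) by (auto simp: sets_restrict_space_iff)
  have preS: "{z \<in> X0. \<Psi> z \<in> A} \<in> sets M" and preM: "measure M {z \<in> X0. \<Psi> z \<in> A} = measure N A"
    if A: "A \<in> sets N" for A
  proof -
    have AY: "A \<inter> Y0 \<in> sets (restrict_space N Y0)"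
      using A Y0(1) by (auto simp: sets_restrict_space_iff)
    have eq: "\<Psi> -` (A \<inter> Y0) \<inter> space (restrict_space M X0) = {z \<in> X0. \<Psi> z \<in> A}"
      using \<Psi>Y by (auto simp: spX0)
    have S: "{z \<in> X0. \<Psi> z \<in> A} \<in> sets (restrict_space M X0)"
      using measurable_sets[OF \<Psi>m AY] by (simp only: eq)
    then show "{z \<in> X0. \<Psi> z \<in> A} \<in> sets M" by (rule setsX0)
    have "measure (restrict_space N Y0) (A \<inter> Y0) = measure (restrict_space M X0) {z \<in> X0. \<Psi> z \<in> A}"
      using measure_distr[OF \<Psi>m AY] by (simp only: \<Psi>d eq)
    moreover have "measure (restrict_space M X0) {z \<in> X0. \<Psi> z \<in> A} = measure M {z \<in> X0. \<Psi> z \<in> A}"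
      by (rule measure_restrict_space) (use X0 in auto)
    moreover have "measure (restrict_space N Y0) (A \<inter> Y0) = measure N (A \<inter> Y0)"
      by (rule measure_restrict_space) (use Y0 in auto)
    moreover have "measure N (A \<inter> Y0) = measure N A"
    proof (rule B.finite_measure_eq_AE)
      have "AE y in N. y \<in> Y0" by (rule AE_I[of _ _ "space N - Y0"]) (use Y0 in auto)
      then show "AE x in N. x \<in> A \<inter> Y0 \<longleftrightarrow> x \<in> A" by eventually_elim auto
    qed (use A Y0 in auto)
    ultimately show "measure M {z \<in> X0. \<Psi> z \<in> A} = measure N A" by simp
  qed
  obtain Z1 where Z1: "Z1 \<in> null_sets M" "\<And>x. x \<in> space M - Z1 \<Longrightarrow> \<forall>g \<in> carrier L - {\<one>\<^bsub>L\<^esub>}. \<alpha> g x \<noteq> x"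
    using AE_E3[OF A.free] by blast
  obtain Z2 where Z2: "Z2 \<in> null_sets N" "\<And>y. y \<in> space N - Z2 \<Longrightarrow> \<forall>t \<in> carrier H - {\<one>\<^bsub>H\<^esub>}. \<beta> t y \<noteq> y"
    using AE_E3[OF B.free] by blast
  \<comment> \<open>The points with a nontrivial stabilizer in \<open>L\<close> go, and so do those
    whose image under \<open>\<Psi>\<close> has one in \<open>H\<close>.\<close>
  define X' where "X' = X0 - Z1 - {z \<in> X0. \<Psi> z \<in> Z2}"
  have X's: "X' \<in> sets M" unfolding X'_def using X0(1) Z1(1) preS[of Z2] Z2(1) by auto
  have AEX': "AE x in M. x \<in> X'"
  proof -
    have "AE x in M. x \<in> X0" by (rule AE_I[of _ _ "space M - X0"]) (use X0 in auto)
    moreover have "AE x in M. x \<notin> Z1" using Z1(1) by (rule AE_not_in)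
    moreover have "measure N Z2 = 0" using Z2(1) by (simp add: measure_eq_0_null_sets)
    then have "emeasure M {z \<in> X0. \<Psi> z \<in> Z2} = 0"
      using preM[OF null_setsD2[OF Z2(1)]] by (simp add: A.emeasure_eq_measure)
    then have "{z \<in> X0. \<Psi> z \<in> Z2} \<in> null_sets M"
      using preS[OF null_setsD2[OF Z2(1)]] by (rule null_setsI)
    then have "AE x in M. x \<notin> {z \<in> X0. \<Psi> z \<in> Z2}" by (rule AE_not_in)
    ultimately show ?thesis by eventually_elim (auto simp: X'_def)
  qed
  then have mX': "measure M X' = 1" using A.prob_eq_1[OF X's] by simp
  \<comment> \<open>The largest \<open>L\<close>-invariant part of \<open>X'\<close>; it stays
    measurable and conull because \<open>L\<close> is countable.\<close>
  define X where "X = {x \<in> space M. \<forall>l\<in>carrier L. \<alpha> l x \<in> X'}"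
  have "X = (\<Inter>l\<in>carrier L. {x \<in> space M. \<alpha> l x \<in> X'})"
    unfolding X_def using LG.one_closed by blast
  moreover have "(\<Inter>l\<in>carrier L. {x \<in> space M. \<alpha> l x \<in> X'}) \<in> sets M"
    by (rule sets.countable_INT'[OF L(2)]) (use A.preimage_sets[OF _ X's] LG.one_closed in blast)+
  ultimately have Xs: "X \<in> sets M" by simp
  have "AE x in M. \<forall>l\<in>carrier L. \<alpha> l x \<in> X'"
  proof (subst AE_ball_countable[OF L(2)], rule ballI)
    fix l assume l: "l \<in> carrier L"
    have "measure M {x \<in> space M. \<alpha> l x \<in> X'} = 1" using A.measure_preimage[OF l X's] mX' by simp
    then show "AE x in M. \<alpha> l x \<in> X'" using A.prob_Collect_eq_1[of "\<lambda>x. \<alpha> l x \<in> X'"] A.preimage_sets[OF l X's] by simp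
  qed
  then have AEX: "AE x in M. x \<in> X" by (rule AE_mp) (auto simp: X_def)
  then have mX: "measure M X = 1" using A.prob_eq_1[OF Xs] by simp
  have Xsp: "x \<in> space M" if "x \<in> X" for x using that by (simp add: X_def)
  have X_X': "x \<in> X'" if "x \<in> X" for x
  proof -
    have "\<alpha> \<one>\<^bsub>L\<^esub> x \<in> X'" using that LG.one_closed unfolding X_def by blast
    then show ?thesis using A.action_one[OF Xsp[OF that]] by simp
  qed
  have X_X0: "x \<in> X0" if "x \<in> X" for x using X_X'[OF that] by (simp add: X'_def)
  have X_inv: "\<alpha> l x \<in> X" if l: "l \<in> carrier L" and x: "x \<in> X" for l x
  proof -
    have "\<alpha> l' (\<alpha> l x) \<in> X'" if "l' \<in> carrier L" for l'
    proof -
      have "\<alpha> (l' \<otimes>\<^bsub>L\<^esub> l) x \<in> X'" using x that l by (simp add: X_def)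
      then show ?thesis using A.composition_rule[OF Xsp[OF x] that l] by simp
    qed
    then show ?thesis using A.action_closed[OF l Xsp[OF x]] by (simp add: X_def)
  qed
  have freeL: "l = l'" if "\<alpha> l x = \<alpha> l' x" "l \<in> carrier L" "l' \<in> carrier L" "x \<in> X" for l l' x
  proof (rule ccontr)
    assume ne: "l \<noteq> l'"
    let ?g = "inv\<^bsub>L\<^esub> l' \<otimes>\<^bsub>L\<^esub> l"
    have "?g \<noteq> \<one>\<^bsub>L\<^esub>" using ne that LG.inv_solve_left[of l "\<one>\<^bsub>L\<^esub>" l'] by (metis LG.inv_equality LG.inv_closed LG.inv_inv)
    moreover have "\<alpha> ?g x = x"
      using that A.composition_rule[OF Xsp[OF that(4)], of "inv\<^bsub>L\<^esub> l'" l] A.action_inv(1)[OF that(3) Xsp[OF that(4)]] by simp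
    ultimately show False using Z1(2)[of x] X_X'[OF that(4)] Xsp[OF that(4)] that(2,3) by (auto simp: X'_def)
  qed
  have freeH: "t = t'" if "\<beta> t (\<Psi> x) = \<beta> t' (\<Psi> x)" "t \<in> carrier H" "t' \<in> carrier H" "x \<in> X" for t t' x
  proof (rule ccontr)
    assume ne: "t \<noteq> t'"
    have y: "\<Psi> x \<in> space N" using \<Psi>Y X_X0 that Y0sp by auto
    let ?g = "inv\<^bsub>H\<^esub> t' \<otimes>\<^bsub>H\<^esub> t"
    have "?g \<noteq> \<one>\<^bsub>H\<^esub>" using ne that by (metis HG.inv_equality HG.inv_closed HG.inv_inv)
    moreover have "\<beta> ?g (\<Psi> x) = \<Psi> x"
      using that B.composition_rule[OF y, of "inv\<^bsub>H\<^esub> t'" t] B.action_inv(1)[OF that(3) y] by simp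
    ultimately show False using Z2(2)[of "\<Psi> x"] X_X'[OF that(4)] y that(2,3) by (auto simp: X'_def)
  qed
  \<comment> \<open>The constant value outside \<open>X\<close> adds only one element to the range
    of \<open>K l\<close>.\<close>
  define K where "K l x = (if x \<in> X then \<kappa> l x else \<one>\<^bsub>H\<^esub>)" for l x
  define I where "I t x = \<theta> t (\<Psi> x)" for t x
  have K: "K l x \<in> carrier H" "\<Psi> (\<alpha> l x) = \<beta> (K l x) (\<Psi> x)" if "l \<in> carrier L" "x \<in> X" for l x
    using \<kappa>[OF that(1) X_X0[OF that(2)]] that(2) by (auto simp: K_def)
  have I1: "I t x \<in> carrier L" if "t \<in> carrier H" "x \<in> X" for t x
    using \<theta>[OF that(1) \<Psi>Y[OF X_X0[OF that(2)]]] by (simp add: I_def)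
  have I2: "\<Psi> (\<alpha> (I t x) x) = \<beta> t (\<Psi> x)" if "t \<in> carrier H" "x \<in> X" for t x
  proof -
    have y: "\<Psi> x \<in> Y0" using \<Psi>Y X_X0 that by simp
    have "the_inv_into X0 \<Psi> (\<beta> t (\<Psi> x)) = \<alpha> (I t x) x"
      using \<theta>[OF that(1) y] the_inv_into_f_f[OF inj X_X0[OF that(2)]] by (simp add: I_def)
    moreover have "\<Psi> (the_inv_into X0 \<Psi> (\<beta> t (\<Psi> x))) = \<beta> t (\<Psi> x)"
      using Y0(3)[OF that(1) y] bij by (intro f_the_inv_into_f) (auto simp: bij_betw_def)
    ultimately show ?thesis by simp
  qed
  have \<alpha>r: "\<alpha> l \<in> measurable (restrict_space M X0) (restrict_space M X0)" if "l \<in> carrier L" for l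
    using X0(3)[OF that] A.action_measurable[OF that]
    by (intro measurable_restrict_space2 measurable_restrict_space1) (auto simp: spX0)
  have \<Psi>N: "\<Psi> \<in> measurable (restrict_space M X0) N"
    using measurable_restrict_space2_iff[of \<Psi> "restrict_space M X0" N Y0] \<Psi>m by simp
  have "bounded_oe L M \<alpha> H N \<beta> X K I \<Psi>"
  proof (unfold_locales)
    fix x assume "x \<in> X" then show "\<alpha> \<one>\<^bsub>L\<^esub> x = x" using A.action_one Xsp by simp
  next
    fix l l' x assume h: "l \<in> carrier L" "l' \<in> carrier L" "x \<in> X"
    have y: "\<Psi> x \<in> space N" using \<Psi>Y X_X0 h Y0sp by auto
    \<comment> \<open>Both elements of \<open>H\<close> carry \<open>\<Psi> x\<close> to the same
      point, and the action of \<open>H\<close> is free there.\<close>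
    show "K (l \<otimes>\<^bsub>L\<^esub> l') x = K l (\<alpha> l' x) \<otimes>\<^bsub>H\<^esub> K l' x"
    proof (rule freeH[OF _ _ _ h(3)])
      have "\<beta> (K (l \<otimes>\<^bsub>L\<^esub> l') x) (\<Psi> x) = \<Psi> (\<alpha> l (\<alpha> l' x))"
        using K(2)[of "l \<otimes>\<^bsub>L\<^esub> l'" x] A.composition_rule[OF Xsp h(1,2)] h by simp
      also have "\<dots> = \<beta> (K l (\<alpha> l' x)) (\<beta> (K l' x) (\<Psi> x))"
        using K(2) h X_inv by simp
      also have "\<dots> = \<beta> (K l (\<alpha> l' x) \<otimes>\<^bsub>H\<^esub> K l' x) (\<Psi> x)"
        using B.composition_rule[OF y] K(1) h X_inv by simp
      finally show "\<beta> (K (l \<otimes>\<^bsub>L\<^esub> l') x) (\<Psi> x) = \<beta> (K l (\<alpha> l' x) \<otimes>\<^bsub>H\<^esub> K l' x) (\<Psi> x)" .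
    qed (use h K(1) X_inv in auto)
  next
    fix l x assume h: "l \<in> carrier L" "x \<in> X"
    have "\<Psi> (\<alpha> (I (K l x) x) x) = \<Psi> (\<alpha> l x)" using I2[OF K(1)[OF h] h(2)] K(2)[OF h] by simp
    moreover have "\<alpha> (I (K l x) x) x \<in> X" "\<alpha> l x \<in> X" using I1 K h X_inv by auto
    ultimately have "\<alpha> (I (K l x) x) x = \<alpha> l x" using inj X_X0 by (meson inj_onD)
    then show "I (K l x) x = l" by (rule freeL) (use I1 K h in auto)
  next
    fix t x assume h: "t \<in> carrier H" "x \<in> X"
    show "K (I t x) x = t"
      by (rule freeH[OF _ K(1)[OF I1[OF h] h(2)] h]) (use I2[OF h] K(2)[OF I1[OF h] h(2)] in simp)
  next
    fix l assume l: "l \<in> carrier L"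
    have "range (K l) \<subseteq> insert \<one>\<^bsub>H\<^esub> (\<kappa> l ` X0)" using X_X0 by (auto simp: K_def)
    then show "finite (range (K l))" using fin(1)[OF l] finite_subset by blast
  next
    fix t assume t: "t \<in> carrier H"
    have "I t ` X \<subseteq> \<theta> t ` Y0" using X_X0 \<Psi>Y by (auto simp: I_def)
    then show "finite (I t ` X)" using fin(2)[OF t] finite_subset by blast
  next
    fix l h assume l: "l \<in> carrier L"
    show "{z \<in> X. K l z = h} \<in> sets M"
    proof (cases "h \<in> carrier H")
      case True
      \<comment> \<open>The cocycle \<open>\<kappa>\<close> comes without measurability, but by
        freeness its level set is the coincidence set of two measurable maps into
        \<open>N\<close>.\<close>
      have "{z \<in> X. K l z = h} = X \<inter> {z \<in> X0. \<Psi> (\<alpha> l z) = \<beta> h (\<Psi> z)}"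
        using K[OF l] freeH[OF _ K(1)[OF l] True] X_X0 by auto
      moreover have S: "{z \<in> space (restrict_space M X0). (\<Psi> \<circ> \<alpha> l) z = (\<beta> h \<circ> \<Psi>) z} \<in> sets (restrict_space M X0)"
        by (rule sets_Collect_measurable_eq[OF B.standard_borel measurable_comp[OF \<alpha>r[OF l] \<Psi>N]
              measurable_comp[OF \<Psi>N B.action_measurable[OF True]]])
      have "{z \<in> X0. \<Psi> (\<alpha> l z) = \<beta> h (\<Psi> z)} \<in> sets M" using setsX0[OF S] by (simp add: spX0)
      ultimately show ?thesis using Xs by auto
    next
      case False
      then have "{z \<in> X. K l z = h} = {}" using K(1)[OF l] by auto
      then show ?thesis by (simp only: sets.empty_sets)
    qed
  next
    show "inj_on \<Psi> X" using inj X_X0 by (meson inj_on_subset subsetI)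
  next
    fix A assume A: "A \<in> sets N"
    have eq: "{z \<in> X. \<Psi> z \<in> A} = X \<inter> {z \<in> X0. \<Psi> z \<in> A}" using X_X0 by auto
    then show "{z \<in> X. \<Psi> z \<in> A} \<in> sets M" using Xs preS[OF A] by auto
    have "measure M {z \<in> X. \<Psi> z \<in> A} = measure M {z \<in> X0. \<Psi> z \<in> A}"
      unfolding eq using AEX by (intro A.finite_measure_eq_AE) (use Xs preS[OF A] in auto)
    then show "measure M {z \<in> X. \<Psi> z \<in> A} = measure N A" using preM[OF A] by simp
  next
    fix A assume A: "A \<in> sets M"
    have AX: "A \<inter> X \<in> sets (restrict_space M X0)"
      using A Xs X0(1) X_X0 by (auto simp: sets_restrict_space_iff)
    have "the_inv_into X0 \<Psi> -` (A \<inter> X) \<inter> space (restrict_space N Y0) = \<Psi> ` (A \<inter> X)"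
    proof (intro equalityI subsetI)
      fix y assume y: "y \<in> the_inv_into X0 \<Psi> -` (A \<inter> X) \<inter> space (restrict_space N Y0)"
      then have "\<Psi> (the_inv_into X0 \<Psi> y) = y"
        using bij by (intro f_the_inv_into_f) (auto simp: bij_betw_def spY0)
      then show "y \<in> \<Psi> ` (A \<inter> X)" using y by (metis IntD1 imageI vimageE)
    next
      fix y assume "y \<in> \<Psi> ` (A \<inter> X)"
      then obtain z where "z \<in> A" "z \<in> X" "y = \<Psi> z" by auto
      then show "y \<in> the_inv_into X0 \<Psi> -` (A \<inter> X) \<inter> space (restrict_space N Y0)"
        using the_inv_into_f_f[OF inj X_X0] \<Psi>Y[OF X_X0] by (simp add: spY0)
    qed
    then show "\<Psi> ` (A \<inter> X) \<in> sets N" using measurable_sets[OF inv\<Psi>m AX] setsY0 by simp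
  qed (use Xs mX X_inv K I1 I2 X_X0 \<Psi>Y Y0sp in auto)
  then show thesis by (rule that)
qed

section \<open>Product approximations\<close>

text \<open>Approximation sequences live on sets of natural numbers, so pairs are coded by
  \<open>prod_encode\<close>. Off the coded product the map is the identity, as
  \<open>permutes\<close> demands.\<close>

definition product_model :: "('l \<Rightarrow> 'g) \<Rightarrow> ('l \<Rightarrow> 'c) \<Rightarrow> nat set \<Rightarrow> nat set \<Rightarrow>
    ('g \<Rightarrow> nat \<Rightarrow> nat) \<Rightarrow> ('c \<Rightarrow> nat \<Rightarrow> nat) \<Rightarrow> 'l \<Rightarrow> nat \<Rightarrow> nat" where
  "product_model pr1 pr2 V W \<tau> \<omega> l u =
     (if u \<in> prod_encode ` (V \<times> W)
      then prod_encode (map_prod (\<tau> (pr1 l)) (\<omega> (pr2 l)) (prod_decode u)) else u)"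

lemma product_model_encode:
  "v \<in> V \<Longrightarrow> w \<in> W \<Longrightarrow> product_model pr1 pr2 V W \<tau> \<omega> l (prod_encode (v, w))
     = prod_encode (\<tau> (pr1 l) v, \<omega> (pr2 l) w)"
  by (auto simp: product_model_def)

lemma card_prod_encode_image: "card (prod_encode ` A) = card A"
  by (rule card_image) (rule inj_prod_encode)

context group_pair
begin

lemma product_model_permutes:
  assumes V: "\<And>g. g \<in> carrier G \<Longrightarrow> \<tau> g permutes V" and W: "\<And>c. c \<in> carrier C \<Longrightarrow> \<omega> c permutes W"
    and l: "l \<in> carrier L"
  shows "product_model pr1 pr2 V W \<tau> \<omega> l permutes prod_encode ` (V \<times> W)"
proof (rule bij_imp_permutes)
  have p: "\<tau> (pr1 l) permutes V" "\<omega> (pr2 l) permutes W" using V W pr_closed l by auto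
  have "bij_betw (map_prod (\<tau> (pr1 l)) (\<omega> (pr2 l))) (V \<times> W) (V \<times> W)"
    using p by (intro bij_betw_map_prod permutes_imp_bij)
  moreover have "bij_betw prod_encode (V \<times> W) (prod_encode ` (V \<times> W))"
    by (simp add: bij_betw_def inj_prod_encode)
  moreover have "bij_betw prod_decode (prod_encode ` (V \<times> W)) (V \<times> W)"
    by (auto simp: bij_betw_def inj_on_def image_image)
  ultimately have "bij_betw (prod_encode \<circ> (map_prod (\<tau> (pr1 l)) (\<omega> (pr2 l)) \<circ> prod_decode))
      (prod_encode ` (V \<times> W)) (prod_encode ` (V \<times> W))"
    by (blast intro: bij_betw_trans)
  then show "bij_betw (product_model pr1 pr2 V W \<tau> \<omega> l) (prod_encode ` (V \<times> W)) (prod_encode ` (V \<times> W))"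
    by (rule iffD1[OF bij_betw_cong, rotated]) (simp add: product_model_def)
qed (simp add: product_model_def)

lemma sofic_approximation_product:
  assumes "sofic_approximation G V \<tau>" "sofic_approximation C W \<omega>"
  shows "sofic_approximation L (prod_encode ` (V \<times> W)) (product_model pr1 pr2 V W \<tau> \<omega>)"
  using assms product_model_permutes[of \<tau> V \<omega> W] by (auto simp: sofic_approximation_def)

text \<open>Multiplicativity fails at a pair only if it fails in one of the coordinates, and the two
  error densities add. Distinct elements differ in some coordinate, and that coordinate alone
  separates their images.\<close>

lemma good_approximation_product:
  assumes V: "sofic_approximation G V \<tau>" "good_approximation G (pr1 ` F) \<delta> V \<tau>"
    and W: "sofic_approximation C W \<omega>" "good_approximation C (pr2 ` F) \<delta> W \<omega>"
    and F: "F \<subseteq> carrier L"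
  shows "good_approximation L F (2 * \<delta>) (prod_encode ` (V \<times> W)) (product_model pr1 pr2 V W \<tau> \<omega>)"
proof -
  let ?U = "prod_encode ` (V \<times> W)" and ?\<sigma> = "product_model pr1 pr2 V W \<tau> \<omega>"
  have fin: "finite V" "V \<noteq> {}" "finite W" "W \<noteq> {}" using V(1) W(1) by (auto simp: sofic_approximation_def)
  then have c: "real (card V) > 0" "real (card W) > 0" by (auto simp: card_gt_0_iff)
  have cU: "real (card ?U) = real (card V) * real (card W)"
    by (simp add: card_prod_encode_image card_cartesian_product)
  have perm: "\<And>g. g \<in> carrier G \<Longrightarrow> \<tau> g permutes V" "\<And>c. c \<in> carrier C \<Longrightarrow> \<omega> c permutes W"
    using V(1) W(1) by (auto simp: sofic_approximation_def)
  have fst_hom: "pr1 (s \<otimes>\<^bsub>L\<^esub> t) = pr1 s \<otimes>\<^bsub>G\<^esub> pr1 t" "pr2 (s \<otimes>\<^bsub>L\<^esub> t) = pr2 s \<otimes>\<^bsub>C\<^esub> pr2 t"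
    if "s \<in> carrier L" "t \<in> carrier L" for s t
  proof -
    have "s \<otimes>\<^bsub>L\<^esub> t = mk (pr1 s \<otimes>\<^bsub>G\<^esub> pr1 t) (pr2 s \<otimes>\<^bsub>C\<^esub> pr2 t)"
      using mk_mult[of "pr1 s" "pr2 s" "pr1 t" "pr2 t"] that by (simp add: pr_closed mk_pr)
    then show "pr1 (s \<otimes>\<^bsub>L\<^esub> t) = pr1 s \<otimes>\<^bsub>G\<^esub> pr1 t" "pr2 (s \<otimes>\<^bsub>L\<^esub> t) = pr2 s \<otimes>\<^bsub>C\<^esub> pr2 t"
      using that by (simp_all add: pr_mk pr_closed)
  qed
  have mult: "hamming ?U (?\<sigma> (s \<otimes>\<^bsub>L\<^esub> t)) (?\<sigma> s \<circ> ?\<sigma> t) \<le> 2 * \<delta>" if s: "s \<in> F" and t: "t \<in> F" for s t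
  proof -
    have sL: "s \<in> carrier L" "t \<in> carrier L" using s t F by auto
    define D1 where "D1 = {v \<in> V. \<tau> (pr1 s \<otimes>\<^bsub>G\<^esub> pr1 t) v \<noteq> (\<tau> (pr1 s) \<circ> \<tau> (pr1 t)) v}"
    define D2 where "D2 = {w \<in> W. \<omega> (pr2 s \<otimes>\<^bsub>C\<^esub> pr2 t) w \<noteq> (\<omega> (pr2 s) \<circ> \<omega> (pr2 t)) w}"
    have D1: "real (card D1) \<le> \<delta> * real (card V)"
      using V(2) s t c unfolding good_approximation_def hamming_def D1_def
      by (auto simp: pos_divide_le_eq)
    have D2: "real (card D2) \<le> \<delta> * real (card W)"
      using W(2) s t c unfolding good_approximation_def hamming_def D2_def
      by (auto simp: pos_divide_le_eq)
    have "{u \<in> ?U. ?\<sigma> (s \<otimes>\<^bsub>L\<^esub> t) u \<noteq> (?\<sigma> s \<circ> ?\<sigma> t) u} \<subseteq> prod_encode ` (D1 \<times> W \<union> V \<times> D2)"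
    proof
      fix u assume "u \<in> {u \<in> ?U. ?\<sigma> (s \<otimes>\<^bsub>L\<^esub> t) u \<noteq> (?\<sigma> s \<circ> ?\<sigma> t) u}"
      then obtain v w where u: "u = prod_encode (v, w)" "v \<in> V" "w \<in> W"
        and ne: "?\<sigma> (s \<otimes>\<^bsub>L\<^esub> t) u \<noteq> ?\<sigma> s (?\<sigma> t u)" by auto
      have "\<tau> (pr1 t) v \<in> V" "\<omega> (pr2 t) w \<in> W"
        using perm pr_closed sL u by (auto simp: permutes_in_image)
      then have "v \<in> D1 \<or> w \<in> D2"
        using ne u by (auto simp: product_model_encode fst_hom[OF sL] D1_def D2_def)
      then show "u \<in> prod_encode ` (D1 \<times> W \<union> V \<times> D2)" using u by auto
    qed
    then have "card {u \<in> ?U. ?\<sigma> (s \<otimes>\<^bsub>L\<^esub> t) u \<noteq> (?\<sigma> s \<circ> ?\<sigma> t) u} \<le> card (D1 \<times> W \<union> V \<times> D2)"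
      unfolding card_prod_encode_image[of "D1 \<times> W \<union> V \<times> D2", symmetric]
      by (rule card_mono[rotated]) (use fin in \<open>auto simp: D1_def D2_def\<close>)
    also have "\<dots> \<le> card D1 * card W + card V * card D2"
      by (rule order_trans[OF card_Un_le]) (simp add: card_cartesian_product)
    finally have "real (card {u \<in> ?U. ?\<sigma> (s \<otimes>\<^bsub>L\<^esub> t) u \<noteq> (?\<sigma> s \<circ> ?\<sigma> t) u})
        \<le> real (card D1) * real (card W) + real (card V) * real (card D2)"
      by (simp flip: of_nat_mult of_nat_add)
    also have "\<dots> \<le> (\<delta> * real (card V)) * real (card W) + real (card V) * (\<delta> * real (card W))"
      using D1 D2 by (intro add_mono mult_right_mono mult_left_mono) auto
    finally show ?thesis using c by (simp add: hamming_def cU pos_divide_le_eq algebra_simps)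
  qed
  \<comment> \<open>Separation is obtained with \<open>1 - \<delta>\<close>; weakening it to
    \<open>1 - 2 * \<delta>\<close> needs \<open>\<delta>\<close> to be nonnegative, which the
    multiplicativity bound provides.\<close>
  have \<delta>0: "0 \<le> \<delta>" if "F \<noteq> {}"
  proof -
    obtain s where s: "s \<in> F" using \<open>F \<noteq> {}\<close> by auto
    have "hamming V (\<tau> (pr1 s \<otimes>\<^bsub>G\<^esub> pr1 s)) (\<tau> (pr1 s) \<circ> \<tau> (pr1 s)) \<le> \<delta>"
      using V(2) s unfolding good_approximation_def by blast
    moreover have "0 \<le> hamming V (\<tau> (pr1 s \<otimes>\<^bsub>G\<^esub> pr1 s)) (\<tau> (pr1 s) \<circ> \<tau> (pr1 s))" by (simp add: hamming_def)
    ultimately show ?thesis by linarith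
  qed
  have dist: "1 - 2 * \<delta> \<le> hamming ?U (?\<sigma> s) (?\<sigma> t)" if s: "s \<in> F" and t: "t \<in> F" and ne: "s \<noteq> t" for s t
  proof -
    have sL: "s \<in> carrier L" "t \<in> carrier L" using s t F by auto
    have "1 - \<delta> \<le> hamming ?U (?\<sigma> s) (?\<sigma> t)"
    proof (cases "pr1 s = pr1 t")
      case False
      define D1 where "D1 = {v \<in> V. \<tau> (pr1 s) v \<noteq> \<tau> (pr1 t) v}"
      have "1 - \<delta> \<le> hamming V (\<tau> (pr1 s)) (\<tau> (pr1 t))" using V(2) s t False by (auto simp: good_approximation_def)
      then have D1: "(1 - \<delta>) * real (card V) \<le> real (card D1)" using c by (simp add: hamming_def D1_def pos_le_divide_eq)
      have "prod_encode ` (D1 \<times> W) \<subseteq> {u \<in> ?U. ?\<sigma> s u \<noteq> ?\<sigma> t u}"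
        by (auto simp: D1_def product_model_encode)
      then have "card (D1 \<times> W) \<le> card {u \<in> ?U. ?\<sigma> s u \<noteq> ?\<sigma> t u}"
        using fin by (subst card_prod_encode_image[symmetric], intro card_mono) auto
      then have "real (card D1) * real (card W) \<le> real (card {u \<in> ?U. ?\<sigma> s u \<noteq> ?\<sigma> t u})"
        by (simp add: card_cartesian_product flip: of_nat_mult)
      moreover have "(1 - \<delta>) * real (card V) * real (card W) \<le> real (card D1) * real (card W)"
        using D1 by (rule mult_right_mono) simp
      ultimately have "(1 - \<delta>) * (real (card V) * real (card W)) \<le> real (card {u \<in> ?U. ?\<sigma> s u \<noteq> ?\<sigma> t u})"
        by (simp only: mult.assoc)
      then show ?thesis using c by (simp add: hamming_def cU pos_le_divide_eq)
    next
      case True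
      then have ne2: "pr2 s \<noteq> pr2 t" using ne mk_pr sL by metis
      define D2 where "D2 = {w \<in> W. \<omega> (pr2 s) w \<noteq> \<omega> (pr2 t) w}"
      have "1 - \<delta> \<le> hamming W (\<omega> (pr2 s)) (\<omega> (pr2 t))" using W(2) s t ne2 by (auto simp: good_approximation_def)
      then have D2: "(1 - \<delta>) * real (card W) \<le> real (card D2)" using c by (simp add: hamming_def D2_def pos_le_divide_eq)
      have "prod_encode ` (V \<times> D2) \<subseteq> {u \<in> ?U. ?\<sigma> s u \<noteq> ?\<sigma> t u}"
        by (auto simp: D2_def product_model_encode)
      then have "card (V \<times> D2) \<le> card {u \<in> ?U. ?\<sigma> s u \<noteq> ?\<sigma> t u}"
        using fin by (subst card_prod_encode_image[symmetric], intro card_mono) auto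
      then have "real (card V) * real (card D2) \<le> real (card {u \<in> ?U. ?\<sigma> s u \<noteq> ?\<sigma> t u})"
        by (simp add: card_cartesian_product flip: of_nat_mult)
      moreover have "real (card V) * ((1 - \<delta>) * real (card W)) \<le> real (card V) * real (card D2)"
        using D2 by (rule mult_left_mono) simp
      ultimately have "(1 - \<delta>) * (real (card V) * real (card W)) \<le> real (card {u \<in> ?U. ?\<sigma> s u \<noteq> ?\<sigma> t u})"
        by (simp only: mult.left_commute[of "real (card V)"])
      then show ?thesis using c by (simp add: hamming_def cU pos_le_divide_eq)
    qed
    then show ?thesis using \<delta>0 s by fastforce
  qed
  show ?thesis unfolding good_approximation_def using mult dist by blast
qed

lemma sofic_approximation_sequence_product:
  assumes V: "sofic_approximation_sequence G V \<tau>" and W: "sofic_approximation_sequence C W \<omega>"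
  shows "sofic_approximation_sequence L (\<lambda>k. prod_encode ` (V k \<times> W k))
     (\<lambda>k. product_model pr1 pr2 (V k) (W k) (\<tau> k) (\<omega> k))"
  unfolding sofic_approximation_sequence_def
proof (intro conjI allI impI)
  fix k
  show "sofic_approximation L (prod_encode ` (V k \<times> W k)) (product_model pr1 pr2 (V k) (W k) (\<tau> k) (\<omega> k))"
    using V W by (intro sofic_approximation_product) (auto simp: sofic_approximation_sequence_def)
next
  fix F and \<delta> :: real assume F: "finite F \<and> F \<subseteq> carrier L \<and> \<delta> > 0"
  have "\<forall>\<^sub>F k in sequentially. good_approximation G (pr1 ` F) (\<delta> / 2) (V k) (\<tau> k)"
    "\<forall>\<^sub>F k in sequentially. good_approximation C (pr2 ` F) (\<delta> / 2) (W k) (\<omega> k)"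
  proof -
    have "finite (pr1 ` F) \<and> pr1 ` F \<subseteq> carrier G \<and> \<delta> / 2 > 0" "finite (pr2 ` F) \<and> pr2 ` F \<subseteq> carrier C \<and> \<delta> / 2 > 0"
      using F pr_closed by auto
    then show "\<forall>\<^sub>F k in sequentially. good_approximation G (pr1 ` F) (\<delta> / 2) (V k) (\<tau> k)"
      "\<forall>\<^sub>F k in sequentially. good_approximation C (pr2 ` F) (\<delta> / 2) (W k) (\<omega> k)"
      using V W unfolding sofic_approximation_sequence_def by blast+
  qed
  then show "\<forall>\<^sub>F k in sequentially. good_approximation L F \<delta> (prod_encode ` (V k \<times> W k))
      (product_model pr1 pr2 (V k) (W k) (\<tau> k) (\<omega> k))"
  proof eventually_elim
    case (elim k)
    then show ?case
      using good_approximation_product[of "V k" "\<tau> k" F "\<delta> / 2" "W k" "\<omega> k"] V W F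
      by (simp add: sofic_approximation_sequence_def)
  qed
qed

end

section \<open>Transported microstates\<close>

context orbit_model
begin

lemma good_subset: "good x \<subseteq> U"
  using goodD(1) by blast

text \<open>Each \<open>action_of x0 t\<close> is injective on good vertices and can be completed to
  a permutation in any way. The choices made elsewhere are seen only at vertices that are not good
  or are sent to such vertices, hence \<open>2 * \<tau>\<close>.\<close>

lemma ex_action_model:
  assumes F: "F \<subseteq> T" "\<And>t t'. t \<in> F \<Longrightarrow> t' \<in> F \<Longrightarrow> t \<otimes>\<^bsub>H\<^esub> t' \<in> T" and U: "U \<noteq> {}"
    and c: "real (card (U - good x0)) \<le> \<tau> * real (card U)"
  obtains \<rho> where "\<And>t. t \<in> carrier H \<Longrightarrow> \<rho> t permutes U"
    "\<And>t u. t \<in> T \<Longrightarrow> u \<in> good x0 \<Longrightarrow> \<rho> t u = action_of x0 t u"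
    "good_approximation H F (2 * \<tau>) U \<rho>"
proof -
  have "\<forall>t. \<exists>p. p permutes U \<and> (t \<in> T \<longrightarrow> (\<forall>u\<in>good x0. p u = action_of x0 t u))"
  proof
    fix t
    show "\<exists>p. p permutes U \<and> (t \<in> T \<longrightarrow> (\<forall>u\<in>good x0. p u = action_of x0 t u))"
    proof (cases "t \<in> T")
      case True
      obtain p where "p permutes U" "\<And>u. u \<in> good x0 \<Longrightarrow> p u = action_of x0 t u"
        by (rule extend_to_permutation[OF finite_U good_subset inj_on_action_of[OF True]])
           (use action_of_in_U[OF True] in auto)
      then show ?thesis by blast
    next
      case False
      then show ?thesis using permutes_id by blast
    qed
  qed
  then obtain \<rho> where \<rho>: "\<And>t. \<rho> t permutes U" "\<And>t u. t \<in> T \<Longrightarrow> u \<in> good x0 \<Longrightarrow> \<rho> t u = action_of x0 t u"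
    by metis
  have cU: "real (card U) > 0" using U finite_U by (simp add: card_gt_0_iff)
  have \<tau>: "0 \<le> \<tau>" using c cU by (meson of_nat_0_le_iff order_trans zero_le_mult_iff not_less)
  have "hamming U (\<rho> (t \<otimes>\<^bsub>H\<^esub> t')) (\<rho> t \<circ> \<rho> t') \<le> 2 * \<tau>" if t: "t \<in> F" "t' \<in> F" for t t'
  proof -
    have tT: "t \<in> T" "t' \<in> T" "t \<otimes>\<^bsub>H\<^esub> t' \<in> T" using F t by auto
    \<comment> \<open>If \<open>u\<close> and \<open>\<rho> t' u\<close> are both good, every
      permutation involved agrees with \<open>action_of x0\<close> where it is evaluated.\<close>
    have "{u \<in> U. \<rho> (t \<otimes>\<^bsub>H\<^esub> t') u \<noteq> (\<rho> t \<circ> \<rho> t') u} \<subseteq> (U - good x0) \<union> {u \<in> U. \<rho> t' u \<in> U - good x0}"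
    proof (rule subsetI, rule ccontr)
      fix u assume u: "u \<in> {u \<in> U. \<rho> (t \<otimes>\<^bsub>H\<^esub> t') u \<noteq> (\<rho> t \<circ> \<rho> t') u}"
        and n: "u \<notin> (U - good x0) \<union> {u \<in> U. \<rho> t' u \<in> U - good x0}"
      have ug: "u \<in> good x0" and "\<rho> t' u \<in> good x0"
        using u n permutes_in_image[OF \<rho>(1), of t' u] by auto
      then have "\<rho> t (\<rho> t' u) = action_of x0 t (action_of x0 t' u)" using \<rho>(2) tT by simp
      then show False using u ug \<rho>(2) tT action_of_mult[OF tT ug] by simp
    qed
    then have "card {u \<in> U. \<rho> (t \<otimes>\<^bsub>H\<^esub> t') u \<noteq> (\<rho> t \<circ> \<rho> t') u}
        \<le> card ((U - good x0) \<union> {u \<in> U. \<rho> t' u \<in> U - good x0})"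
      using finite_U by (intro card_mono) auto
    also have "\<dots> \<le> card (U - good x0) + card {u \<in> U. \<rho> t' u \<in> U - good x0}" by (rule card_Un_le)
    also have "card {u \<in> U. \<rho> t' u \<in> U - good x0} = card (U - good x0)"
      by (rule card_vimage_permutes[OF \<rho>(1)]) simp
    finally have "real (card {u \<in> U. \<rho> (t \<otimes>\<^bsub>H\<^esub> t') u \<noteq> (\<rho> t \<circ> \<rho> t') u}) \<le> 2 * \<tau> * real (card U)"
      using c by simp
    then show ?thesis using cU by (simp add: hamming_def pos_divide_le_eq)
  qed
  moreover have "1 - 2 * \<tau> \<le> hamming U (\<rho> t) (\<rho> t')" if t: "t \<in> F" "t' \<in> F" "t \<noteq> t'" for t t'
  proof -
    have tT: "t \<in> T" "t' \<in> T" using F t by auto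
    have "good x0 \<subseteq> {u \<in> U. \<rho> t u \<noteq> \<rho> t' u}"
      using \<rho>(2) tT action_of_free[OF tT] t(3) goodD(1) by auto
    then have "card (good x0) \<le> card {u \<in> U. \<rho> t u \<noteq> \<rho> t' u}" using finite_U by (intro card_mono) auto
    moreover have "card U = card (U - good x0) + card (good x0)"
      using card_Diff_subset[OF finite_subset[OF good_subset finite_U] good_subset] card_mono[OF finite_U good_subset] by simp
    ultimately have "(1 - \<tau>) * real (card U) \<le> real (card {u \<in> U. \<rho> t u \<noteq> \<rho> t' u})"
      using c by (simp add: algebra_simps)
    then have "1 - \<tau> \<le> hamming U (\<rho> t) (\<rho> t')" using cU by (simp add: hamming_def pos_le_divide_eq)
    then show ?thesis using \<tau> by simp
  qed
  ultimately have "good_approximation H F (2 * \<tau>) U \<rho>" unfolding good_approximation_def by blast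
  then show thesis using \<rho> that by blast
qed

text \<open>A relation and not a function of \<open>x\<close> and \<open>x0\<close>, because the
  completion to a permutation is arbitrary off the common good vertices.\<close>

definition rearranges :: "('v \<Rightarrow> 'x) \<Rightarrow> ('v \<Rightarrow> 'x) \<Rightarrow> ('v \<Rightarrow> 'v) \<Rightarrow> bool" where
  "rearranges x x0 p \<longleftrightarrow> p permutes U \<and> (\<forall>u\<in>good x \<inter> good x0. p u = rearr x x0 u)"

text \<open>The condition under which \<open>shift_step\<close> applies along every displacement in
  \<open>Q'\<close>. Agreement of the recorded data will imply it.\<close>

definition coherent :: "('v \<Rightarrow> 'x) \<Rightarrow> ('v \<Rightarrow> 'x) \<Rightarrow> bool" where
  "coherent x x0 \<longleftrightarrow> (\<forall>u\<in>good x \<inter> good x0. \<forall>g\<in>Q'. \<sigma> g u \<in> good x \<inter> good x0 \<longrightarrow>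
     discrepancy (x u) (x0 u) (s (\<sigma> g u) \<otimes>\<^bsub>L\<^esub> g) = discrepancy (x u) (x0 u) (s u))"

lemma ex_rearranges:
  assumes "coherent x x0"
  shows "\<exists>p. rearranges x x0 p"
proof -
  let ?W = "good x \<inter> good x0"
  have "?W \<subseteq> U" using good_subset by blast
  moreover have "inj_on (rearr x x0) ?W"
    by (rule inj_on_rearr) (use assms in \<open>auto simp: coherent_def\<close>)
  moreover have "rearr x x0 ` ?W \<subseteq> U" using rearr_in_U by auto
  ultimately obtain p where "p permutes U" "\<And>u. u \<in> ?W \<Longrightarrow> p u = rearr x x0 u"
    using extend_to_permutation[OF finite_U] by metis
  then show ?thesis by (auto simp: rearranges_def)
qed

text \<open>Write \<open>w = p u\<close>. Failure forces \<open>u\<close> out of the common good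
  set, or \<open>action_of x t u\<close> out of it, or \<open>p u\<close> out of
  \<open>good x0\<close>. The second case is no more frequent than the first, because
  \<open>action_of x t\<close> is injective on good vertices.\<close>

lemma card_not_intertwining:
  assumes t: "t \<in> T" and coh: "coherent x x0" and p: "rearranges x x0 p"
    and \<rho>: "\<And>u. u \<in> good x0 \<Longrightarrow> \<rho> u = action_of x0 t u"
  shows "card {w \<in> U. \<not> (\<exists>u\<in>good x \<inter> good x0. w = p u \<and> action_of x t u \<in> good x \<inter> good x0 \<and> \<rho> w = p (action_of x t u))}
    \<le> 2 * card (U - good x \<inter> good x0) + card (U - good x0)"
proof -
  let ?W = "good x \<inter> good x0"
  have WU: "?W \<subseteq> U" using good_subset by blast
  have pU: "p permutes U" and pW: "\<And>u. u \<in> ?W \<Longrightarrow> p u = rearr x x0 u" using p by (auto simp: rearranges_def)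
  define D where "D = (U - ?W) \<union> {u \<in> ?W. action_of x t u \<notin> ?W} \<union> {u \<in> U. p u \<in> U - good x0}"
  have finD: "finite D" using finite_U WU by (auto simp: D_def intro: finite_subset)
  have "{w \<in> U. \<not> (\<exists>u\<in>?W. w = p u \<and> action_of x t u \<in> ?W \<and> \<rho> w = p (action_of x t u))} \<subseteq> p ` D"
  proof
    fix w assume w: "w \<in> {w \<in> U. \<not> (\<exists>u\<in>?W. w = p u \<and> action_of x t u \<in> ?W \<and> \<rho> w = p (action_of x t u))}"
    then obtain u where u: "u \<in> U" "w = p u" using permutes_image[OF pU] by auto
    have "u \<in> D"
    proof (rule ccontr)
      assume nD: "u \<notin> D"
      then have uW: "u \<in> ?W" and vW: "action_of x t u \<in> ?W" and pu: "p u \<in> good x0"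
        using u(1) permutes_in_image[OF pU] by (auto simp: D_def)
      have "rearr x x0 (action_of x t u) = action_of x0 t (rearr x x0 u)"
      proof (rule rearr_action_of[OF t])
        fix g assume "g \<in> Q'" "\<sigma> g u = action_of x t u"
        then show "discrepancy (x u) (x0 u) (s (\<sigma> g u) \<otimes>\<^bsub>L\<^esub> g) = discrepancy (x u) (x0 u) (s u)"
          using coh[unfolded coherent_def, rule_format, OF uW, of g] vW by simp
      qed (use uW vW in auto)
      then have "p (action_of x t u) = \<rho> w" using pW[OF uW] pW[OF vW] \<rho>[OF pu] u(2) by simp
      then show False using w u uW vW by auto
    qed
    then show "w \<in> p ` D" using u by auto
  qed
  then have "card {w \<in> U. \<not> (\<exists>u\<in>?W. w = p u \<and> action_of x t u \<in> ?W \<and> \<rho> w = p (action_of x t u))} \<le> card (p ` D)"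
    using finD by (intro card_mono) auto
  also have "\<dots> \<le> card D" by (rule card_image_le[OF finD])
  also have "\<dots> \<le> card (U - ?W) + card {u \<in> ?W. action_of x t u \<notin> ?W} + card {u \<in> U. p u \<in> U - good x0}"
    unfolding D_def by (intro order_trans[OF card_Un_le] add_mono card_Un_le order_refl)
  also have "card {u \<in> U. p u \<in> U - good x0} = card (U - good x0)"
    by (rule card_vimage_permutes[OF pU]) simp
  also have "card {u \<in> ?W. action_of x t u \<notin> ?W} \<le> card (U - ?W)"
  proof (rule card_inj_on_le[of "action_of x t"])
    show "inj_on (action_of x t) {u \<in> ?W. action_of x t u \<notin> ?W}"
      by (rule inj_on_subset[OF inj_on_action_of[OF t]]) auto
    show "action_of x t ` {u \<in> ?W. action_of x t u \<notin> ?W} \<subseteq> U - ?W"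
      using action_of_in_U[OF t] by auto
  qed (use finite_U in auto)
  finally show ?thesis by simp
qed

end

section \<open>Microstates on the space of the second group\<close>

locale oe_model = bounded_oe L M a H N \<beta> X K I \<Psi> + orbit_model L H X a K I U \<sigma> Q Q' S T \<N> s
  for L :: "('l, 'm) monoid_scheme" and M :: "'x measure" and a :: "'l \<Rightarrow> 'x \<Rightarrow> 'x"
    and H :: "('h, 'n) monoid_scheme" and N :: "'y measure" and \<beta> :: "'h \<Rightarrow> 'y \<Rightarrow> 'y"
    and X :: "'x set" and K :: "'l \<Rightarrow> 'x \<Rightarrow> 'h" and I :: "'h \<Rightarrow> 'x \<Rightarrow> 'l" and \<Psi> :: "'x \<Rightarrow> 'y"
    and U :: "'v set" and \<sigma> :: "'l \<Rightarrow> 'v \<Rightarrow> 'v" and Q Q' S :: "'l set" and T :: "'h set"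
    and \<N> :: "'x set set" and s :: "'v \<Rightarrow> 'l" +
  assumes U_ne: "U \<noteq> {}" and finite_Q: "finite Q"
begin

lemma card_U: "real (card U) > 0"
  using U_ne finite_U by (simp add: card_gt_0_iff)

text \<open>Every requirement in \<open>good\<close> on neighbours is membership in
  \<open>X\<close>, in a level set of \<open>K\<close> or \<open>I\<close>, or in a member of
  \<open>\<N>\<close>, all of which belong to \<open>\<S>\<close>. Each \<open>q\<close> in
  \<open>Q\<close> costs \<open>\<delta>\<close>, and one more \<open>\<delta>\<close> is lost where
  \<open>x u\<close> is outside \<open>X\<close>.\<close>

lemma card_not_good:
  assumes x: "x \<in> microstates M a \<S> Q \<delta> U \<sigma>"
    and \<S>: "X \<in> \<S>" "\<N> \<subseteq> \<S>" "\<And>l z. l \<in> Q \<Longrightarrow> z \<in> X \<Longrightarrow> {w \<in> X. K l w = K l z} \<in> \<S>"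
      "\<And>t z. t \<in> T \<Longrightarrow> z \<in> X \<Longrightarrow> {w \<in> X. I t w = I t z} \<in> \<S>"
    and inc: "real (card (inconsistent L Q U \<sigma>)) \<le> \<delta>' * real (card U)"
  shows "real (card (U - good x)) \<le> (\<delta>' + (real (card Q) + 1) * \<delta>) * real (card U)"
proof -
  define D where "D q = {u \<in> U. \<exists>A\<in>\<S>. (x (\<sigma> q u) \<in> A) \<noteq> (a q (x u) \<in> A)}" for q
  have D: "real (card (D q)) \<le> \<delta> * real (card U)" if "q \<in> Q" for q
    using x that by (simp add: microstates_def D_def)
  define E where "E = {u \<in> U. x u \<notin> X}"
  have cE: "real (card E) \<le> \<delta> * real (card U)"
  proof -
    have "\<bar>unif U {u \<in> U. x u \<in> X} - measure M X\<bar> \<le> \<delta>" using x \<S>(1) by (simp add: microstates_def)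
    then have "1 - \<delta> \<le> unif U {u \<in> U. x u \<in> X}" using X_conull by simp
    then have "(1 - \<delta>) * real (card U) \<le> real (card {u \<in> U. x u \<in> X})"
      using card_U by (simp add: unif_def pos_le_divide_eq)
    moreover have "card U = card {u \<in> U. x u \<in> X} + card E"
    proof -
      have "U = {u \<in> U. x u \<in> X} \<union> E" "{u \<in> U. x u \<in> X} \<inter> E = {}" by (auto simp: E_def)
      then show ?thesis using finite_U by (metis (no_types, lifting) card_Un_disjoint finite_Un)
    qed
    ultimately show ?thesis by (simp add: algebra_simps)
  qed
  have "U - good x \<subseteq> inconsistent L Q U \<sigma> \<union> E \<union> (\<Union>q\<in>Q. D q)"
  proof
    fix u assume u: "u \<in> U - good x"
    show "u \<in> inconsistent L Q U \<sigma> \<union> E \<union> (\<Union>q\<in>Q. D q)"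
    proof (rule ccontr)
      assume n: "u \<notin> inconsistent L Q U \<sigma> \<union> E \<union> (\<Union>q\<in>Q. D q)"
      then have xX: "x u \<in> X" using u by (auto simp: E_def)
      have same: "x (\<sigma> q u) \<in> A \<longleftrightarrow> a q (x u) \<in> A" if "q \<in> Q" "A \<in> \<S>" for q A
        using n u that by (auto simp: D_def)
      have aX: "a q (x u) \<in> X" if "q \<in> Q" for q using a_closed xX that Q by auto
      have 1: "x (\<sigma> q u) \<in> X" if "q \<in> Q" for q using same[OF that \<S>(1)] aX[OF that] by simp
      have 2: "K l (x (\<sigma> q u)) = K l (a q (x u))" if "q \<in> Q" "l \<in> Q" for q l
        using same[OF that(1) \<S>(3)[OF that(2) aX[OF that(1)]]] aX[OF that(1)] by simp
      have 3: "I t (x (\<sigma> q u)) = I t (a q (x u))" if "q \<in> Q" "t \<in> T" for q t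
        using same[OF that(1) \<S>(4)[OF that(2) aX[OF that(1)]]] aX[OF that(1)] by simp
      have "u \<in> good x"
        unfolding good_def
      proof (intro CollectI conjI ballI)
        show "x (\<sigma> q u) \<in> A \<longleftrightarrow> a q (x u) \<in> A" if "q \<in> Q" "A \<in> \<N>" for q A
          using same that \<S>(2) by blast
      qed (use u n xX 1 2 3 in auto)
      then show False using u by simp
    qed
  qed
  then have "card (U - good x) \<le> card (inconsistent L Q U \<sigma> \<union> E \<union> (\<Union>q\<in>Q. D q))"
    using finite_U finite_Q by (intro card_mono) (auto simp: inconsistent_def E_def D_def)
  also have "\<dots> \<le> card (inconsistent L Q U \<sigma>) + card E + card (\<Union>q\<in>Q. D q)"
    by (intro order_trans[OF card_Un_le] add_mono card_Un_le order_refl)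
  finally have "real (card (U - good x)) \<le> real (card (inconsistent L Q U \<sigma>)) + real (card E) + real (card (\<Union>q\<in>Q. D q))"
    by (simp flip: of_nat_add)
  also have "\<dots> \<le> \<delta>' * real (card U) + \<delta> * real (card U) + real (card Q) * (\<delta> * real (card U))"
    by (intro add_mono inc cE card_UN_le_mult finite_Q D)
  finally show ?thesis by (simp add: algebra_simps)
qed

text \<open>The composition of \<open>\<Psi>\<close>, \<open>x\<close> and the inverse of
  \<open>p\<close>. The arbitrary default keeps the values in \<open>space N\<close> where
  \<open>x\<close> leaves \<open>X\<close>, which does not happen at good vertices.\<close>

definition transport :: "('v \<Rightarrow> 'x) \<Rightarrow> ('v \<Rightarrow> 'v) \<Rightarrow> 'v \<Rightarrow> 'y" where
  "transport x p = (\<lambda>w\<in>U. if x (inv_into UNIV p w) \<in> X then \<Psi> (x (inv_into UNIV p w)) else SOME y. y \<in> space N)"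

lemma transport_space: "transport x p \<in> U \<rightarrow>\<^sub>E space N"
  using \<Psi>_space B.not_empty by (auto simp: transport_def some_in_eq)

lemma transport_image:
  assumes p: "p permutes U" and u: "u \<in> U" "x u \<in> X"
  shows "transport x p (p u) = \<Psi> (x u)"
  using assms permutes_inverses(2)[OF p] permutes_in_image[OF p] by (simp add: transport_def)

text \<open>At most \<open>2 * \<tau>\<close> of the vertices are not good for both \<open>x\<close>
  and \<open>x0\<close>. They enter \<open>card_not_intertwining\<close> twice, next to
  \<open>\<tau>\<close> for \<open>x0\<close>, hence \<open>5 * \<tau>\<close>. Frequencies are
  unaffected by the permutation, so they deviate by \<open>\<delta>\<close> from \<open>x\<close>
  and by \<open>\<tau>\<close> from bad vertices.\<close>

lemma transport_microstate:
  assumes x: "x \<in> microstates M a \<S> Q \<delta> U \<sigma>"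
    and R: "R \<subseteq> sets N" "\<And>A. A \<in> R \<Longrightarrow> {z \<in> X. \<Psi> z \<in> A} \<in> \<N>" and \<N>: "\<N> \<subseteq> \<S>"
    and coh: "coherent x x0" and p: "rearranges x x0 p"
    and F: "F \<subseteq> T" and \<rho>: "\<And>t u. t \<in> T \<Longrightarrow> u \<in> good x0 \<Longrightarrow> \<rho> t u = action_of x0 t u"
    and c: "real (card (U - good x)) \<le> \<tau> * real (card U)" "real (card (U - good x0)) \<le> \<tau> * real (card U)"
    and \<delta>': "5 * \<tau> \<le> \<delta>'" "\<tau> + \<delta> \<le> \<delta>'"
  shows "transport x p \<in> microstates N \<beta> R F \<delta>' U \<rho>"
proof -
  let ?W = "good x \<inter> good x0" and ?y = "transport x p"
  have pU: "p permutes U" using p by (simp add: rearranges_def)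
  have "card (U - ?W) \<le> card (U - good x) + card (U - good x0)"
    using card_Un_le[of "U - good x" "U - good x0"] by (simp add: Diff_Int)
  then have cW: "real (card (U - ?W)) \<le> 2 * \<tau> * real (card U)" using c by linarith
  have "real (card {w \<in> U. \<exists>A\<in>R. (?y (\<rho> t w) \<in> A) \<noteq> (\<beta> t (?y w) \<in> A)}) \<le> \<delta>' * real (card U)" if t: "t \<in> F" for t
  proof -
    have tT: "t \<in> T" using t F by auto
    have tH: "t \<in> carrier H" using tT T by auto
    have "{w \<in> U. \<exists>A\<in>R. (?y (\<rho> t w) \<in> A) \<noteq> (\<beta> t (?y w) \<in> A)}
      \<subseteq> {w \<in> U. \<not> (\<exists>u\<in>?W. w = p u \<and> action_of x t u \<in> ?W \<and> \<rho> t w = p (action_of x t u))}"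
    proof (clarify)
      fix w A u assume A: "A \<in> R" and ne: "(?y (\<rho> t (p u)) \<in> A) \<noteq> (\<beta> t (?y (p u)) \<in> A)"
        and u: "u \<in> good x" and v: "action_of x t u \<in> good x" and eq: "\<rho> t (p u) = p (action_of x t u)"
      have xX: "x u \<in> X" "x (action_of x t u) \<in> X" and uU: "u \<in> U" "action_of x t u \<in> U"
        using goodD(1,2)[OF u] goodD(1,2)[OF v] by auto
      let ?g = "I t (x u)"
      have g: "?g \<in> Q" using I_T[OF tT xX(1)] in_Q by auto
      have "?y (\<rho> t (p u)) = \<Psi> (x (\<sigma> ?g u))"
        using transport_image[where x = x, OF pU uU(2) xX(2)] eq by (simp add: action_of_def)
      then have "?y (\<rho> t (p u)) \<in> A \<longleftrightarrow> x (\<sigma> ?g u) \<in> {z \<in> X. \<Psi> z \<in> A}"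
        using xX(2) by (simp add: action_of_def)
      also have "\<dots> \<longleftrightarrow> a ?g (x u) \<in> {z \<in> X. \<Psi> z \<in> A}" by (rule goodD(8)[OF u g R(2)[OF A]])
      also have "\<dots> \<longleftrightarrow> \<beta> t (\<Psi> (x u)) \<in> A"
        using \<Psi>_I[OF tH xX(1)] a_closed[OF in_Q(3)[OF g] xX(1)] by simp
      also have "\<dots> \<longleftrightarrow> \<beta> t (?y (p u)) \<in> A" using transport_image[where x = x, OF pU uU(1) xX(1)] by simp
      finally show False using ne by simp
    qed
    then have "card {w \<in> U. \<exists>A\<in>R. (?y (\<rho> t w) \<in> A) \<noteq> (\<beta> t (?y w) \<in> A)}
        \<le> card {w \<in> U. \<not> (\<exists>u\<in>?W. w = p u \<and> action_of x t u \<in> ?W \<and> \<rho> t w = p (action_of x t u))}"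
      using finite_U by (intro card_mono) auto
    also have "\<dots> \<le> 2 * card (U - ?W) + card (U - good x0)"
      by (rule card_not_intertwining[OF tT coh p \<rho>[OF tT]])
    finally have "real (card {w \<in> U. \<exists>A\<in>R. (?y (\<rho> t w) \<in> A) \<noteq> (\<beta> t (?y w) \<in> A)})
        \<le> 2 * real (card (U - ?W)) + real (card (U - good x0))"
      by linarith
    also have "\<dots> \<le> 5 * \<tau> * real (card U)" using cW c by linarith
    also have "\<dots> \<le> \<delta>' * real (card U)" using \<delta>' by (simp add: mult_right_mono)
    finally show ?thesis .
  qed
  moreover have "\<bar>unif U {w \<in> U. ?y w \<in> A} - measure N A\<bar> \<le> \<delta>'" if A: "A \<in> R" for A
  proof -
    define A' where "A' = {z \<in> X. \<Psi> z \<in> A}"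
    have "A' \<in> \<S>" using R(2)[OF A] \<N> unfolding A'_def by blast
    then have "\<bar>unif U {u \<in> U. x u \<in> A'} - measure M A'\<bar> \<le> \<delta>"
      using x unfolding microstates_def by blast
    moreover have "measure M A' = measure N A" unfolding A'_def by (rule \<Psi>_measure) (use A R in auto)
    moreover have "card {w \<in> U. ?y w \<in> A} = card {u \<in> U. ?y (p u) \<in> A}"
      using card_vimage_permutes[OF pU, of "{w \<in> U. ?y w \<in> A}"] permutes_in_image[OF pU] by simp
    then have "unif U {w \<in> U. ?y w \<in> A} = unif U {u \<in> U. ?y (p u) \<in> A}" by (simp add: unif_def)
    moreover have "\<bar>unif U {u \<in> U. ?y (p u) \<in> A} - unif U {u \<in> U. x u \<in> A'}\<bar> \<le> unif U (U - good x)"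
    proof (rule unif_diff_le_sym_diff[OF finite_U])
      have "?y (p u) \<in> A \<longleftrightarrow> x u \<in> A'" if "u \<in> good x" for u
        using transport_image[where x = x, OF pU goodD(1,2)[OF that]] goodD(2)[OF that] by (simp add: A'_def)
      then show "sym_diff {u \<in> U. ?y (p u) \<in> A} {u \<in> U. x u \<in> A'} \<subseteq> U - good x" by blast
    qed auto
    moreover have "unif U (U - good x) \<le> \<tau>" using c(1) card_U by (simp add: unif_def pos_divide_le_eq)
    ultimately show ?thesis using \<delta>' by linarith
  qed
  ultimately show ?thesis using transport_space by (simp add: microstates_def)
qed

text \<open>
  On the set where \<open>s = \<one>\<close> the rearrangement is trivial, so the names of the transported
  microstate there reveal the rearrangement everywhere, and hence the names of \<open>x\<close>.
\<close>

lemma card_names_differ: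
  assumes P: "\<And>A. A \<in> P \<Longrightarrow> \<Psi> ` (A \<inter> X) \<in> R"
    and KR: "\<And>q h. q \<in> S \<Longrightarrow> h \<in> range (K (inv\<^bsub>L\<^esub> q)) \<Longrightarrow> \<Psi> ` ({z \<in> X. K (inv\<^bsub>L\<^esub> q) z = h} \<inter> X) \<in> R"
    and s1: "\<And>x u. u \<in> good x \<Longrightarrow> s (\<sigma> (s u) u) = \<one>\<^bsub>L\<^esub>"
    and p: "rearranges x x0 p" "rearranges x' x0 p'"
    and eq: "names U R (transport x p) = names U R (transport x' p')"
    and c: "real (card (U - good x)) \<le> \<tau> * real (card U)" "real (card (U - good x')) \<le> \<tau> * real (card U)"
      "real (card (U - good x0)) \<le> \<tau> * real (card U)"
  shows "real (card {u \<in> U. names U P x u \<noteq> names U P x' u}) \<le> 3 * \<tau> * (1 + real (card S)) * real (card U)"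
proof -
  define W where "W = good x \<inter> good x' \<inter> good x0"
  have WU: "W \<subseteq> U" using good_subset by (auto simp: W_def)
  have "card (U - W) \<le> card (U - good x) + card (U - good x') + card (U - good x0)"
  proof -
    have "U - W = (U - good x) \<union> (U - good x') \<union> (U - good x0)" by (auto simp: W_def)
    then show ?thesis using card_Un_le[of "U - good x \<union> (U - good x')" "U - good x0"]
        card_Un_le[of "U - good x" "U - good x'"] by simp
  qed
  then have cW: "real (card (U - W)) \<le> 3 * \<tau> * real (card U)" using c by linarith
  have pU: "p permutes U" "p' permutes U" using p by (auto simp: rearranges_def)
  \<comment> \<open>Since \<open>\<Psi>\<close> is injective on \<open>X\<close>, the image of
    \<open>E\<close> in \<open>N\<close> decides membership in \<open>E\<close> itself.\<close>
  have imp: "z \<in> E \<longleftrightarrow> z' \<in> E"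
    if "z \<in> X" "z' \<in> X" "\<Psi> ` (E \<inter> X) \<in> R" "w \<in> U" "transport x p w = \<Psi> z" "transport x' p' w = \<Psi> z'" for z z' E w
  proof -
    have "\<Psi> z \<in> \<Psi> ` (E \<inter> X) \<longleftrightarrow> \<Psi> z' \<in> \<Psi> ` (E \<inter> X)"
      using names_eqD[OF eq that(4,3)] that(5,6) by simp
    moreover have "\<Psi> z \<in> \<Psi> ` (E \<inter> X) \<longleftrightarrow> z \<in> E \<inter> X" "\<Psi> z' \<in> \<Psi> ` (E \<inter> X) \<longleftrightarrow> z' \<in> E \<inter> X"
      using inj_\<Psi> that(1,2) by (auto simp: inj_on_def)
    ultimately show ?thesis using that(1,2) by simp
  qed
  \<comment> \<open>Outside this set both \<open>u\<close> and its base point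
    \<open>\<sigma> (s u) u\<close> are good for \<open>x\<close>, \<open>x'\<close> and
    \<open>x0\<close>. The element \<open>s u\<close> of \<open>S\<close> varies with
    \<open>u\<close>, so all \<open>q\<close> in \<open>S\<close> are excluded; this gives the
    factor \<open>1 + real (card S)\<close>.\<close>
  have "{u \<in> U. names U P x u \<noteq> names U P x' u} \<subseteq> (U - W) \<union> (\<Union>q\<in>S. {u \<in> U. \<sigma> q u \<in> U - W})"
  proof
    fix u assume u: "u \<in> {u \<in> U. names U P x u \<noteq> names U P x' u}"
    show "u \<in> (U - W) \<union> (\<Union>q\<in>S. {u \<in> U. \<sigma> q u \<in> U - W})"
    proof (rule ccontr)
      assume n: "u \<notin> (U - W) \<union> (\<Union>q\<in>S. {u \<in> U. \<sigma> q u \<in> U - W})"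
      have uU: "u \<in> U" using u by simp
      have uW: "u \<in> W" using n u by auto
      have sS: "s u \<in> S" by (rule s_S[OF uU])
      let ?d = "\<sigma> (s u) u"
      have dU: "?d \<in> U" using \<sigma>_in_U[OF in_Q(3)[OF in_Q(1)[OF sS]] uU] .
      then have dW: "?d \<in> W" using n sS uU by auto
      have ug: "u \<in> good x" "u \<in> good x'" "u \<in> good x0" and dg: "?d \<in> good x" "?d \<in> good x'" "?d \<in> good x0"
        using uW dW by (auto simp: W_def)
      have xX: "x u \<in> X" "x' u \<in> X" "x ?d \<in> X" "x' ?d \<in> X" using goodD(2) ug dg by auto
      have sd: "s ?d = \<one>\<^bsub>L\<^esub>" by (rule s1[OF ug(1)])
      have "p ?d = ?d" "p' ?d = ?d"
        using p rearr_fixed[OF dg(1,3) sd] rearr_fixed[OF dg(2,3) sd] dg by (auto simp: rearranges_def)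
      then have td: "transport x p ?d = \<Psi> (x ?d)" "transport x' p' ?d = \<Psi> (x' ?d)"
        using transport_image[where x = x, OF pU(1) dU xX(3)] transport_image[where x = x', OF pU(2) dU xX(4)] by simp_all
      let ?k = "K (inv\<^bsub>L\<^esub> (s u)) (x ?d)"
      have "x ?d \<in> {z \<in> X. K (inv\<^bsub>L\<^esub> (s u)) z = ?k} \<longleftrightarrow> x' ?d \<in> {z \<in> X. K (inv\<^bsub>L\<^esub> (s u)) z = ?k}"
        by (rule imp[OF xX(3,4) KR[OF sS] dU td]) simp
      then have "K (inv\<^bsub>L\<^esub> (s u)) (x ?d) = K (inv\<^bsub>L\<^esub> (s u)) (x' ?d)" using xX by simp
      then have "rearr x x0 u = rearr x' x0 u" by (rule rearr_cong[OF ug(1,2)])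
      then have pu: "p u = p' u" using p ug by (auto simp: rearranges_def)
      have puU: "p u \<in> U" using permutes_in_image[OF pU(1)] uU by simp
      have tu: "transport x p (p u) = \<Psi> (x u)" "transport x' p' (p u) = \<Psi> (x' u)"
        using transport_image[where x = x, OF pU(1) uU xX(1)] transport_image[where x = x', OF pU(2) uU xX(2)] pu by simp_all
      have "x u \<in> A \<longleftrightarrow> x' u \<in> A" if "A \<in> P" for A
        by (rule imp[OF xX(1,2) P[OF that] puU tu])
      then have "names U P x u = names U P x' u" using uU by (auto simp: names_def)
      then show False using u by simp
    qed
  qed
  moreover have fS: "finite S" using S finite_Q finite_subset by blast
  ultimately have "card {u \<in> U. names U P x u \<noteq> names U P x' u} \<le> card ((U - W) \<union> (\<Union>q\<in>S. {u \<in> U. \<sigma> q u \<in> U - W}))"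
    using finite_U by (intro card_mono) auto
  also have "\<dots> \<le> card (U - W) + card (\<Union>q\<in>S. {u \<in> U. \<sigma> q u \<in> U - W})" by (rule card_Un_le)
  finally have "real (card {u \<in> U. names U P x u \<noteq> names U P x' u})
      \<le> real (card (U - W)) + real (card (\<Union>q\<in>S. {u \<in> U. \<sigma> q u \<in> U - W}))"
    by (simp flip: of_nat_add)
  also have "\<dots> \<le> 3 * \<tau> * real (card U) + real (card S) * (3 * \<tau> * real (card U))"
  proof (intro add_mono cW card_UN_le_mult fS)
    fix q assume "q \<in> S"
    then have "\<sigma> q permutes U" using in_Q \<sigma>_permutes by auto
    then show "real (card {u \<in> U. \<sigma> q u \<in> U - W}) \<le> 3 * \<tau> * real (card U)"
      using card_vimage_permutes[of "\<sigma> q" U "U - W"] cW by simp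
  qed
  finally show ?thesis by (simp add: algebra_simps)
qed

end

section \<open>Counting microstates with prescribed data\<close>

locale sparse_oe_model =
  oe_model L M a H N \<beta> X K I \<Psi> U \<sigma> Q Q' S T \<N> s +
  sparse_model G C L H X a K I U \<sigma> Q Q' S T \<N> s pr1 pr2 mk V W \<sigma>1 \<sigma>2 pv pw A B B' S0 m P1 Q1 T3 P2 R2 Q2 T2 F'
  for G :: "('g, 'i) monoid_scheme" and C :: "('c, 'j) monoid_scheme"
    and L :: "('l, 'm) monoid_scheme" and M :: "'x measure" and a :: "'l \<Rightarrow> 'x \<Rightarrow> 'x"
    and H :: "('h, 'n) monoid_scheme" and N :: "'y measure" and \<beta> :: "'h \<Rightarrow> 'y \<Rightarrow> 'y"
    and X :: "'x set" and K :: "'l \<Rightarrow> 'x \<Rightarrow> 'h" and I :: "'h \<Rightarrow> 'x \<Rightarrow> 'l" and \<Psi> :: "'x \<Rightarrow> 'y"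
    and U :: "'v set" and \<sigma> :: "'l \<Rightarrow> 'v \<Rightarrow> 'v" and Q Q' S :: "'l set" and T :: "'h set"
    and \<N> :: "'x set set" and s :: "'v \<Rightarrow> 'l"
    and pr1 :: "'l \<Rightarrow> 'g" and pr2 :: "'l \<Rightarrow> 'c" and mk :: "'g \<Rightarrow> 'c \<Rightarrow> 'l"
    and V :: "'v1 set" and W :: "'v2 set"
    and \<sigma>1 :: "'g \<Rightarrow> 'v1 \<Rightarrow> 'v1" and \<sigma>2 :: "'c \<Rightarrow> 'v2 \<Rightarrow> 'v2"
    and pv :: "'v \<Rightarrow> 'v1" and pw :: "'v \<Rightarrow> 'v2"
    and A :: "'v1 set" and B B' :: "'v2 set"
    and S0 :: "'g set" and m :: nat and P1 Q1 T3 :: "'g set" and P2 R2 Q2 T2 F' :: "'c set" +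
  assumes s_one: "u \<in> U \<Longrightarrow> pw u \<in> B \<Longrightarrow> s u = \<one>\<^bsub>L\<^esub>"
    and s_B: "u \<in> U \<Longrightarrow> pw u \<notin> B \<Longrightarrow> \<sigma>2 (pr2 (s u)) (pw u) \<in> B"
    and S_P: "p \<in> S \<Longrightarrow> pr1 p \<in> P1 \<and> pr2 p \<in> P2"
    and S_Q'_P: "p \<in> S \<Longrightarrow> g \<in> Q' \<Longrightarrow> pr1 (p \<otimes>\<^bsub>L\<^esub> g) \<in> P1 \<and> pr2 (p \<otimes>\<^bsub>L\<^esub> g) \<in> P2"
    and finite_edges: "finite S0" "finite T2" "finite T3"
begin

lemma pw_s:
  assumes u: "u \<in> good x"
  shows "pw (\<sigma> (s u) u) \<in> B"
proof (cases "pw u \<in> B")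
  case True
  then show ?thesis using s_one[OF goodD(1)[OF u]] \<sigma>_one[OF u] by simp
next
  case False
  have "s u \<in> carrier L" using s_S[OF goodD(1)[OF u]] in_Q by blast
  then show ?thesis using s_B[OF goodD(1)[OF u] False] pw(2)[OF _ goodD(1)[OF u]] by simp
qed

lemma s_s:
  assumes u: "u \<in> good x"
  shows "s (\<sigma> (s u) u) = \<one>\<^bsub>L\<^esub>"
proof (rule s_one[OF _ pw_s[OF u]])
  have "s u \<in> carrier L" using s_S[OF goodD(1)[OF u]] in_Q by blast
  then show "\<sigma> (s u) u \<in> U" by (rule \<sigma>_in_U[OF _ goodD(1)[OF u]])
qed

text \<open>The displacements \<open>s (\<sigma> g u)\<close> after \<open>g\<close> and
  \<open>s u\<close> both lead from \<open>u\<close> to vertices over \<open>B\<close>, with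
  coordinates in \<open>P1\<close> and \<open>P2\<close>. These are exactly the places between which
  \<open>discrepancy_constant\<close> applies.\<close>

lemma coherent:
  assumes data: "same_data x x0"
  shows "coherent x x0"
  unfolding coherent_def
proof (intro ballI impI)
  fix u g assume u: "u \<in> good x \<inter> good x0" and g: "g \<in> Q'" and v: "\<sigma> g u \<in> good x \<inter> good x0"
  let ?v = "\<sigma> g u"
  have ug: "u \<in> good x" "u \<in> good x0" and vg: "?v \<in> good x" using u v by auto
  have uU: "u \<in> U" "?v \<in> U" using goodD(1) ug vg by auto
  have gQ: "g \<in> Q" and gL: "g \<in> carrier L" using g in_Q by auto
  have su: "s u \<in> S" and sv: "s ?v \<in> S" using s_S uU by auto
  have suL: "s u \<in> carrier L" and svQ: "s ?v \<in> Q" and svL: "s ?v \<in> carrier L" using su sv in_Q by blast+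
  let ?p = "s ?v \<otimes>\<^bsub>L\<^esub> g"
  have pL: "?p \<in> carrier L" using svL gL by simp
  have "pw (\<sigma> ?p u) \<in> B" using pw_s[OF vg] goodD(3)[OF ug(1) svQ gQ] by simp
  then have 1: "\<sigma>2 (pr2 ?p) (pw u) \<in> B" using pw(2)[OF pL uU(1)] by simp
  have 2: "\<sigma>2 (pr2 (s u)) (pw u) \<in> B" using pw_s[OF ug(1)] pw(2)[OF suL uU(1)] by simp
  have "discrepancy (x u) (x0 u) (mk (pr1 ?p) (pr2 ?p)) = discrepancy (x u) (x0 u) (mk (pr1 (s u)) (pr2 (s u)))"
    by (rule discrepancy_constant[OF data ug]) (use S_Q'_P[OF sv g] S_P[OF su] 1 2 in auto)
  then show "discrepancy (x u) (x0 u) ?p = discrepancy (x u) (x0 u) (s u)"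
    using mk_pr[OF pL] mk_pr[OF suL] by simp
qed

text \<open>Away from the three sparse sets the entry is the same for all microstates, so only the
  vertices over \<open>B\<close>, \<open>A\<close> and \<open>B'\<close> contribute to the number of
  possible records.\<close>

definition data :: "('v \<Rightarrow> 'x) \<Rightarrow> 'v \<Rightarrow> ('g \<Rightarrow> 'h) \<times> ('c \<Rightarrow> 'h) \<times> ('g \<Rightarrow> 'h)" where
  "data x = (\<lambda>v\<in>U.
     (if pw v \<in> B then \<lambda>g\<in>S0. K (mk g \<one>\<^bsub>C\<^esub>) (x v) else undefined,
      if pv v \<in> A then \<lambda>c\<in>T2. K (mk \<one>\<^bsub>G\<^esub> c) (x v) else undefined,
      if pw v \<in> B' then \<lambda>g\<in>T3. K (mk g \<one>\<^bsub>C\<^esub>) (x v) else undefined))"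

lemma restrict_eqD: "restrict f D = restrict g D \<Longrightarrow> z \<in> D \<Longrightarrow> f z = g z"
  by (metis restrict_apply')

lemma same_data:
  assumes "data x = data x0"
  shows "same_data x x0"
  unfolding same_data_def
proof (intro ballI conjI impI)
  fix v assume v: "v \<in> U"
  note eq = fun_cong[OF assms, of v, unfolded data_def, unfolded restrict_apply'[OF v] prod.inject]
  show "K (mk g \<one>\<^bsub>C\<^esub>) (x v) = K (mk g \<one>\<^bsub>C\<^esub>) (x0 v)" if "pw v \<in> B" "g \<in> S0" for g
    using eq[THEN conjunct1] that(1) by (auto dest: restrict_eqD[OF _ that(2)])
  show "K (mk \<one>\<^bsub>G\<^esub> c) (x v) = K (mk \<one>\<^bsub>G\<^esub> c) (x0 v)" if "pv v \<in> A" "c \<in> T2" for c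
    using eq[THEN conjunct2, THEN conjunct1] that(1) by (auto dest: restrict_eqD[OF _ that(2)])
  show "K (mk g \<one>\<^bsub>C\<^esub>) (x v) = K (mk g \<one>\<^bsub>C\<^esub>) (x0 v)" if "pw v \<in> B'" "g \<in> T3" for g
    using eq[THEN conjunct2, THEN conjunct2] that(1) by (auto dest: restrict_eqD[OF _ that(2)])
qed

lemma card_data:
  shows "card (data ` \<X>)
     \<le> card (\<Pi>\<^sub>E g\<in>S0. range (K (mk g \<one>\<^bsub>C\<^esub>))) ^ card {v \<in> U. pw v \<in> B}
      * card (\<Pi>\<^sub>E c\<in>T2. range (K (mk \<one>\<^bsub>G\<^esub> c))) ^ card {v \<in> U. pv v \<in> A}
      * card (\<Pi>\<^sub>E g\<in>T3. range (K (mk g \<one>\<^bsub>C\<^esub>))) ^ card {v \<in> U. pw v \<in> B'}"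
proof -
  define D1 where "D1 = (\<Pi>\<^sub>E g\<in>S0. range (K (mk g \<one>\<^bsub>C\<^esub>)))"
  define D2 where "D2 = (\<Pi>\<^sub>E c\<in>T2. range (K (mk \<one>\<^bsub>G\<^esub> c)))"
  define D3 where "D3 = (\<Pi>\<^sub>E g\<in>T3. range (K (mk g \<one>\<^bsub>C\<^esub>)))"
  have cl: "mk g \<one>\<^bsub>C\<^esub> \<in> carrier L" if "g \<in> Q1" for g using that Q1 by (intro mk_closed) auto
  have cl2: "mk \<one>\<^bsub>G\<^esub> c \<in> carrier L" if "c \<in> Q2" for c using that Q2 by (intro mk_closed) auto
  have fin: "finite D1" "finite D2" "finite D3"
    unfolding D1_def D2_def D3_def using finite_edges S0 T2(1) T3(1) cl cl2
    by (auto intro!: finite_PiE finite_K)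
  define E where "E v = (if pw v \<in> B then D1 else {undefined}) \<times>
      (if pv v \<in> A then D2 else {undefined}) \<times> (if pw v \<in> B' then D3 else {undefined})" for v
  have "data ` \<X> \<subseteq> Pi\<^sub>E U E"
    by (auto simp: data_def E_def D1_def D2_def D3_def)
  moreover have "finite (Pi\<^sub>E U E)" by (rule finite_PiE[OF finite_U]) (use fin in \<open>auto simp: E_def\<close>)
  ultimately have "card (data ` \<X>) \<le> card (Pi\<^sub>E U E)" by (intro card_mono)
  also have "\<dots> = (\<Prod>v\<in>U. card (E v))" by (rule card_PiE[OF finite_U])
  also have "\<dots> = (\<Prod>v\<in>U. (if pw v \<in> B then card D1 else 1) * ((if pv v \<in> A then card D2 else 1) *
      (if pw v \<in> B' then card D3 else 1)))"
    by (rule prod.cong) (simp_all add: E_def card_cartesian_product)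
  also have "\<dots> = card D1 ^ card {v \<in> U. pw v \<in> B} * card D2 ^ card {v \<in> U. pv v \<in> A} * card D3 ^ card {v \<in> U. pw v \<in> B'}"
    using finite_U by (simp add: prod.distrib prod.inter_filter[symmetric] mult.assoc)
  finally show ?thesis by (simp add: D1_def D2_def D3_def)
qed

text \<open>There are two losses. Keeping only microstates with one common record costs
  \<open>e1\<close>, by the pigeonhole principle. Sending each of them to the name of its transport
  costs \<open>e2\<close>: by \<open>card_names_differ\<close> every fibre lies in a small Hamming
  ball, bounded by \<open>card_hamming_ball\<close>.\<close>

lemma ex_action_many_microstates:
  fixes n :: real
  defines "n \<equiv> real (card U)"
  assumes \<X>: "\<X> \<subseteq> microstates M a \<S> Q \<delta> U \<sigma>" "finite \<X>" "inj_on (names U P) \<X>"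
    and \<S>: "X \<in> \<S>" "\<N> \<subseteq> \<S>" "\<And>l z. l \<in> Q \<Longrightarrow> z \<in> X \<Longrightarrow> {w \<in> X. K l w = K l z} \<in> \<S>"
      "\<And>t z. t \<in> T \<Longrightarrow> z \<in> X \<Longrightarrow> {w \<in> X. I t w = I t z} \<in> \<S>"
    and inc: "real (card (inconsistent L Q U \<sigma>)) \<le> \<delta>' * n"
    and \<tau>: "\<delta>' + (real (card Q) + 1) * \<delta> \<le> \<tau>" "5 * \<tau> \<le> \<eta>" "\<tau> + \<delta> \<le> \<eta>" "0 \<le> \<tau>"
    and R\<N>: "RS \<subseteq> sets N" "\<And>A. A \<in> RS \<Longrightarrow> {z \<in> X. \<Psi> z \<in> A} \<in> \<N>"
    and F: "F \<subseteq> T" "\<And>t t'. t \<in> F \<Longrightarrow> t' \<in> F \<Longrightarrow> t \<otimes>\<^bsub>H\<^esub> t' \<in> T"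
    and PR: "\<And>A. A \<in> P \<Longrightarrow> \<Psi> ` (A \<inter> X) \<in> R"
      "\<And>q h. q \<in> S \<Longrightarrow> h \<in> range (K (inv\<^bsub>L\<^esub> q)) \<Longrightarrow> \<Psi> ` ({z \<in> X. K (inv\<^bsub>L\<^esub> q) z = h} \<inter> X) \<in> R"
    and fin: "finite P" "finite R"
    and data: "real (card (data ` \<X>)) \<le> exp (e1 * n)"
    and z: "0 < z" "z \<le> 1"
    and e2: "3 * \<tau> * (1 + real (card S)) * ln (2 ^ card P / z) + z \<le> e2"
    and large: "exp (c * n) \<le> real (card \<X>)"
  shows "\<exists>\<rho>. sofic_approximation H U \<rho> \<and> good_approximation H F \<eta> U \<rho> \<and>
     exp ((c - e1 - e2) * n) \<le> real (card (names U R ` microstates N \<beta> RS F \<eta> U \<rho>))"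
proof -
  have n: "n > 0" using card_U by (simp add: n_def)
  have "\<X> \<noteq> {}" using large exp_gt_zero[of "c * n"] by (auto simp: not_less)
  then obtain x0 where x0: "x0 \<in> \<X>" and ph: "real (card \<X>) \<le> exp (e1 * n) * real (card {x \<in> \<X>. data x = data x0})"
    using pigeonhole_real[OF \<X>(2) _ data] by blast
  \<comment> \<open>All of \<open>Y\<close> shares the data of \<open>x0\<close> and is therefore
    coherent with it, so the approximation of \<open>H\<close> built from \<open>x0\<close> alone
    serves every member.\<close>
  define Y where "Y = {x \<in> \<X>. data x = data x0}"
  have Ym: "x \<in> microstates M a \<S> Q \<delta> U \<sigma>" if "x \<in> Y" for x using that \<X> by (auto simp: Y_def)
  have x0Y: "x0 \<in> Y" using x0 by (simp add: Y_def)
  have good: "real (card (U - good x)) \<le> \<tau> * n" if "x \<in> Y" for x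
  proof -
    have "real (card (U - good x)) \<le> (\<delta>' + (real (card Q) + 1) * \<delta>) * n"
      unfolding n_def by (rule card_not_good[OF Ym[OF that] \<S> inc[unfolded n_def]])
    also have "\<dots> \<le> \<tau> * n" using \<tau>(1) n by (simp add: mult_right_mono)
    finally show ?thesis .
  qed
  obtain \<rho> where \<rho>: "\<And>t. t \<in> carrier H \<Longrightarrow> \<rho> t permutes U"
    "\<And>t u. t \<in> T \<Longrightarrow> u \<in> good x0 \<Longrightarrow> \<rho> t u = action_of x0 t u"
    "good_approximation H F (2 * \<tau>) U \<rho>"
    using ex_action_model[OF F U_ne good[OF x0Y, unfolded n_def]] by metis
  have sof: "sofic_approximation H U \<rho>" using \<rho>(1) U_ne finite_U by (simp add: sofic_approximation_def)
  have ga: "good_approximation H F \<eta> U \<rho>"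
    by (rule good_approximation_mono[OF \<rho>(3)]) (use \<tau> in auto)
  have coh: "coherent x x0" if "x \<in> Y" for x
    by (rule coherent[OF same_data]) (use that in \<open>simp add: Y_def\<close>)
  then have "\<forall>x\<in>Y. \<exists>p. rearranges x x0 p" using ex_rearranges by blast
  then obtain p where p: "\<And>x. x \<in> Y \<Longrightarrow> rearranges x x0 (p x)" by metis
  define f where "f x = names U R (transport x (p x))" for x
  have fY: "f ` Y \<subseteq> names U R ` microstates N \<beta> RS F \<eta> U \<rho>"
    unfolding f_def
    using transport_microstate[OF Ym R\<N> \<S>(2) coh p F(1) \<rho>(2) good[unfolded n_def] good[OF x0Y, unfolded n_def] \<tau>(2,3)]
    by auto
  have fib: "real (card {x \<in> Y. f x = f y}) \<le> exp (e2 * n)" if y: "y \<in> Y" for y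
  proof -
    let ?Z = "{x \<in> Y. f x = f y}"
    let ?m = "3 * \<tau> * (1 + real (card S)) * n"
    \<comment> \<open>Microstates in \<open>\<X>\<close> are told apart by their
      \<open>P\<close>-names, so the size of a fibre is the number of its names.\<close>
    have "inj_on (names U P) ?Z" using \<X>(3) by (rule inj_on_subset) (auto simp: Y_def)
    then have "card ?Z = card (names U P ` ?Z)" by (simp add: card_image)
    moreover have "real (card (names U P ` ?Z)) \<le> exp (?m * ln (real (card (Pow P)) / z) + z * real (card U))"
    proof (rule card_hamming_ball[OF finite_U _ _ z, where ?p0.0 = "names U P y"])
      fix q assume "q \<in> names U P ` ?Z"
      then obtain x where x: "x \<in> Y" "f x = f y" "q = names U P x" by auto
      show "real (card {u \<in> U. q u \<noteq> names U P y u}) \<le> ?m"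
        unfolding x(3) n_def
        by (rule card_names_differ[OF PR s_s p[OF x(1)] p[OF y] x(2)[unfolded f_def]
              good[OF x(1), unfolded n_def] good[OF y, unfolded n_def] good[OF x0Y, unfolded n_def]])
    qed (simp_all add: fin image_subset_iff names_in_PiE, use Pow_top in blast)
    moreover have "?m * ln (real (card (Pow P)) / z) + z * real (card U)
        = (3 * \<tau> * (1 + real (card S)) * ln (2 ^ card P / z) + z) * n"
      using fin(1) by (simp add: card_Pow n_def algebra_simps)
    moreover have "\<dots> \<le> e2 * n" using e2 n by (simp add: mult_right_mono)
    ultimately have "real (card ?Z) \<le> exp (?m * ln (real (card (Pow P)) / z) + z * real (card U))"
      and "exp (?m * ln (real (card (Pow P)) / z) + z * real (card U)) \<le> exp (e2 * n)" by simp_all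
    then show ?thesis by (rule order_trans)
  qed
  have finY: "finite Y" using \<X>(2) by (simp add: Y_def)
  have "exp (c * n) \<le> exp (e1 * n) * real (card Y)" using large ph by (simp add: Y_def)
  also have "real (card Y) \<le> exp (e2 * n) * real (card (f ` Y))"
    by (rule card_le_fibre_bound[OF finY fib])
  also have "card (f ` Y) \<le> card (names U R ` microstates N \<beta> RS F \<eta> U \<rho>)"
    by (rule card_mono[OF finite_names_image[OF finite_U fin(2)] fY])
  finally have "exp (c * n) \<le> exp (e1 * n) * (exp (e2 * n) * real (card (names U R ` microstates N \<beta> RS F \<eta> U \<rho>)))"
    by simp
  moreover have "exp (c * n) = exp (e1 * n) * (exp (e2 * n) * exp ((c - e1 - e2) * n))"
    by (simp add: exp_add[symmetric] algebra_simps)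
  ultimately have "exp ((c - e1 - e2) * n) \<le> real (card (names U R ` microstates N \<beta> RS F \<eta> U \<rho>))"
    by simp
  then show ?thesis using sof ga by blast
qed

end

section \<open>Sofic approximation sequences\<close>

lemma eventually_few_inconsistent:
  assumes seq: "sofic_approximation_sequence G V \<sigma>" and F: "finite F" "F \<subseteq> carrier G" and \<eta>: "\<eta> > 0"
  shows "\<forall>\<^sub>F k in sequentially. real (card (inconsistent G F (V k) (\<sigma> k))) \<le> \<eta> * real (card (V k))"
proof -
  \<comment> \<open>The added one keeps the quotient meaningful for empty \<open>F\<close>.\<close>
  define \<delta> where "\<delta> = \<eta> / (2 * real (card F) ^ 2 + 1)"
  have \<delta>: "\<delta> > 0" using \<eta> by (simp add: \<delta>_def add_nonneg_pos)
  have le: "2 * real (card F) ^ 2 * \<delta> \<le> \<eta>"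
    using \<eta> by (simp add: \<delta>_def divide_le_eq add_nonneg_pos)
  have "\<forall>\<^sub>F k in sequentially. good_approximation G F \<delta> (V k) (\<sigma> k)"
    using seq F \<delta> by (simp add: sofic_approximation_sequence_def)
  then show ?thesis
  proof eventually_elim
    case (elim k)
    have "finite (V k)" "V k \<noteq> {}"
      using seq by (auto simp: sofic_approximation_sequence_def sofic_approximation_def)
    from card_inconsistent[OF this F(1) elim]
    show ?case using mult_right_mono[OF le, of "real (card (V k))"] by linarith
  qed
qed

text \<open>Half of the factor 2 comes from packing, the other half from inconsistent points. The
  quantifier over \<open>V0\<close> stands inside \<open>eventually\<close> because
  \<open>B'\<close> is to be chosen inside \<open>B\<close>, which itself depends on
  \<open>k\<close>.\<close>

lemma (in group) eventually_sparse_syndetic_subset: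
  assumes seq: "sofic_approximation_sequence G V \<sigma>" and E: "finite E" "E \<noteq> {}" "E \<subseteq> carrier G"
  shows "\<forall>\<^sub>F k in sequentially. \<forall>V0\<subseteq>V k. \<exists>A\<subseteq>V0. real (card A) \<le> 2 / real (card E) * real (card (V k)) \<and>
           (\<forall>v\<in>V0. v \<in> A \<or> (\<exists>e\<in>E. \<exists>e'\<in>E. \<sigma> k (inv e' \<otimes> e) v \<in> A))"
proof -
  define F where "F = E \<union> (\<lambda>(e, e'). inv e' \<otimes> e) ` (E \<times> E)"
  have F: "finite F" "F \<subseteq> carrier G" using E by (auto simp: F_def)
  have F12: "E \<subseteq> F" "\<And>e e'. e \<in> E \<Longrightarrow> e' \<in> E \<Longrightarrow> inv e' \<otimes> e \<in> F"
    unfolding F_def by (blast, force)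
  have cE: "1 / real (card E) > 0" using E by (simp add: card_gt_0_iff)
  show ?thesis using eventually_few_inconsistent[OF seq F cE]
  proof eventually_elim
    case (elim k)
    show ?case
    proof (intro allI impI)
      fix V0 assume V0: "V0 \<subseteq> V k"
      have V: "finite (V k)" "\<And>g. g \<in> carrier G \<Longrightarrow> \<sigma> k g permutes V k"
        using seq by (auto simp: sofic_approximation_sequence_def sofic_approximation_def)
      obtain A where A: "A \<subseteq> V0"
        "real (card A) \<le> real (card (V k)) / real (card E) + real (card (inconsistent G F (V k) (\<sigma> k)))"
        "\<forall>v\<in>V0. v \<in> A \<or> (\<exists>e\<in>E. \<exists>e'\<in>E. \<sigma> k (inv e' \<otimes> e) v \<in> A)"
        using sparse_syndetic_subset[where V = "V k" and \<sigma> = "\<sigma> k" and F = F, OF V E V0 F12] by blast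
      have "real (card A) \<le> 2 / real (card E) * real (card (V k))" using A(2) elim by simp
      then show "\<exists>A\<subseteq>V0. real (card A) \<le> 2 / real (card E) * real (card (V k)) \<and>
           (\<forall>v\<in>V0. v \<in> A \<or> (\<exists>e\<in>E. \<exists>e'\<in>E. \<sigma> k (inv e' \<otimes> e) v \<in> A))"
        using A by blast
    qed
  qed
qed

section \<open>The entropy inequality\<close>

text \<open>To be read with \<open>y\<close> the logarithm of the number of values recorded at a
  vertex, and \<open>n\<close> the number of translates, so that \<open>2 / n\<close> is the density
  of the recording set.\<close>

lemma ex_degree:
  fixes e y :: real
  assumes "e > 0"
  shows "\<exists>m::nat. m \<ge> 1 \<and> (\<forall>n::nat. n \<ge> m \<longrightarrow> y * (2 / real n) \<le> e)"
proof -
  obtain m :: nat where m: "2 * y / e \<le> real m" using real_arch_simple by blast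
  have "y * (2 / real n) \<le> e" if "n \<ge> Suc m" for n
  proof -
    have "2 * y / e \<le> real n" using m that by linarith
    then have "2 * y \<le> e * real n" using assms by (simp add: pos_divide_le_eq mult.commute)
    then show ?thesis using that by (simp add: pos_divide_le_eq mult.commute)
  qed
  then show ?thesis by (intro exI[of _ "Suc m"]) auto
qed

lemma power_le_exp_sparse:
  assumes "\<kappa> \<ge> (1::real)" and "real j \<le> 2 / d * n" and "ln \<kappa> * (2 / d) \<le> e" and "n \<ge> 0"
  shows "\<kappa> ^ j \<le> exp (e * n)"
proof -
  have "\<kappa> ^ j = exp (ln \<kappa> * real j)"
    using assms(1) by (simp add: exp_of_nat2_mult)
  also have "ln \<kappa> * real j \<le> ln \<kappa> * (2 / d * n)"
    using assms by (intro mult_left_mono) auto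
  also have "\<dots> = ln \<kappa> * (2 / d) * n" by simp
  also have "\<dots> \<le> e * n" using assms by (intro mult_right_mono) auto
  finally show ?thesis by simp
qed

lemma image_case_prodI: "x \<in> A \<Longrightarrow> y \<in> B \<Longrightarrow> f x y \<in> (\<lambda>(x, y). f x y) ` (A \<times> B)"
  by force

locale product_oe = bounded_oe L M \<alpha> H N \<beta> X K I \<Psi> + group_pair G C L pr1 pr2 mk
  for G :: "('g, 'i) monoid_scheme" and C :: "('c, 'j) monoid_scheme"
    and L :: "('l, 'm) monoid_scheme" and M :: "'x measure" and \<alpha> :: "'l \<Rightarrow> 'x \<Rightarrow> 'x"
    and H :: "('h, 'n) monoid_scheme" and N :: "'y measure" and \<beta> :: "'h \<Rightarrow> 'y \<Rightarrow> 'y"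
    and X :: "'x set" and K :: "'l \<Rightarrow> 'x \<Rightarrow> 'h" and I :: "'h \<Rightarrow> 'x \<Rightarrow> 'l" and \<Psi> :: "'x \<Rightarrow> 'y"
    and pr1 :: "'l \<Rightarrow> 'g" and pr2 :: "'l \<Rightarrow> 'c" and mk :: "'g \<Rightarrow> 'c \<Rightarrow> 'l"
begin

lemma mk_one: "mk \<one>\<^bsub>G\<^esub> \<one>\<^bsub>C\<^esub> = \<one>\<^bsub>L\<^esub>"
proof -
  have "mk \<one>\<^bsub>G\<^esub> \<one>\<^bsub>C\<^esub> \<otimes>\<^bsub>L\<^esub> mk \<one>\<^bsub>G\<^esub> \<one>\<^bsub>C\<^esub> = mk \<one>\<^bsub>G\<^esub> \<one>\<^bsub>C\<^esub>"
    by (simp add: mk_mult)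
  then show ?thesis using mk_closed[of "\<one>\<^bsub>G\<^esub>" "\<one>\<^bsub>C\<^esub>"] by (simp add: L.l_cancel_one)
qed

lemma card_K_functions:
  assumes "finite D" "\<And>d. d \<in> D \<Longrightarrow> f d \<in> carrier L"
  shows "real (card (\<Pi>\<^sub>E d\<in>D. range (K (f d)))) \<ge> 1"
proof -
  have "finite (\<Pi>\<^sub>E d\<in>D. range (K (f d)))" by (intro finite_PiE assms(1) finite_K assms(2))
  moreover have "(\<Pi>\<^sub>E d\<in>D. range (K (f d))) \<noteq> {}" by (simp add: PiE_eq_empty_iff)
  ultimately show ?thesis by (simp add: Suc_le_eq card_gt_0_iff)
qed

lemma max_sofic_entropy_ge_product:
  assumes seqG: "sofic_approximation_sequence G V \<tau>" and seqC: "sofic_approximation_sequence C W \<omega>"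
    and infC: "infinite (carrier C)"
    and S0: "finite S0" "S0 \<subseteq> carrier G" "\<And>g. g \<in> S0 \<Longrightarrow> inv\<^bsub>G\<^esub> g \<in> S0" "infinite (generate G S0)"
    and H: "countable (carrier H)"
    and gt: "ereal c < sofic_entropy L M \<alpha> (\<lambda>k. prod_encode ` (V k \<times> W k))
        (\<lambda>k. product_model pr1 pr2 (V k) (W k) (\<tau> k) (\<omega> k))"
    and \<epsilon>: "\<epsilon> > 0"
  shows "ereal (c - \<epsilon>) \<le> max_sofic_entropy H N \<beta>"
proof -
  define U where "U k = prod_encode ` (V k \<times> W k)" for k
  define \<sigma> where "\<sigma> k = product_model pr1 pr2 (V k) (W k) (\<tau> k) (\<omega> k)" for k
  have seqL: "sofic_approximation_sequence L U \<sigma>"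
    using sofic_approximation_sequence_product[OF seqG seqC] by (simp add: U_def[abs_def] \<sigma>_def[abs_def])
  have sofL: "sofic_approximation L (U k) (\<sigma> k)" for k
    using seqL by (simp add: sofic_approximation_sequence_def)
  obtain P where P: "finite_partition M P" and freq0: "\<forall>\<S> F \<delta>. finite \<S> \<and> \<S> \<subseteq> sets M \<and> finite F \<and>
      F \<subseteq> carrier L \<and> \<delta> > 0 \<longrightarrow> (\<exists>\<^sub>F k in sequentially. exp (c * real (card (U k)))
        \<le> real (card (names (U k) P ` microstates M \<alpha> \<S> F \<delta> (U k) (\<sigma> k))))"
    by (rule exE[OF A.frequently_many_microstates[OF gt[folded U_def \<sigma>_def] sofL]], elim conjE, rule that)
  have freq: "\<exists>\<^sub>F k in sequentially. exp (c * real (card (U k)))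
        \<le> real (card (names (U k) P ` microstates M \<alpha> \<S> F \<delta> (U k) (\<sigma> k)))"
    if "finite \<S>" "\<S> \<subseteq> sets M" "finite F" "F \<subseteq> carrier L" "\<delta> > 0" for \<S> F \<delta>
    by (rule freq0[rule_format]) (intro conjI that)
  have P': "finite P" "P \<subseteq> sets M" using P by (auto simp: finite_partition_def)
  \<comment> \<open>Half of the loss \<open>\<epsilon>\<close> is shared by the three families of
    prescribed edges, the other half is reserved for recovering \<open>x\<close>.\<close>
  define e1 where "e1 = \<epsilon> / 6"
  have e1: "e1 > 0" using \<epsilon> by (simp add: e1_def)

  define \<kappa>1 where "\<kappa>1 = real (card (\<Pi>\<^sub>E g\<in>S0. range (K (mk g \<one>\<^bsub>C\<^esub>))))"
  obtain m1 where m1: "m1 \<ge> 1" "\<And>n. n \<ge> m1 \<Longrightarrow> ln \<kappa>1 * (2 / real n) \<le> e1"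
    using ex_degree[OF e1, of "ln \<kappa>1"] by blast
  obtain E1 where E1: "E1 \<subseteq> carrier C" "finite E1" "card E1 = m1"
    using infinite_arbitrarily_large[OF infC] by blast
  define F1 where "F1 = (\<lambda>(e, e'). inv\<^bsub>C\<^esub> e' \<otimes>\<^bsub>C\<^esub> e) ` (E1 \<times> E1)"
  have F1: "finite F1" "F1 \<subseteq> carrier C" using E1 by (auto simp: F1_def)
  \<comment> \<open>Base points are reached in the direction of \<open>C\<close> only, by quotients
    of elements of \<open>E1\<close>; the identity is for vertices already over
    \<open>B\<close>.\<close>
  define S where "S = mk \<one>\<^bsub>G\<^esub> ` insert \<one>\<^bsub>C\<^esub> F1"
  have S: "finite S" "S \<subseteq> carrier L" "\<one>\<^bsub>L\<^esub> \<in> S"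
    using F1 mk_one by (auto simp: S_def intro!: mk_closed)
  \<comment> \<open>The images of \<open>P\<close> reveal the names of \<open>x\<close>, and the
    level sets of the inverse displacements reveal the rearrangement. Nothing here may depend on the
    tests introduced next.\<close>
  define R where "R = (\<lambda>A. \<Psi> ` (A \<inter> X)) ` P \<union>
      (\<Union>p\<in>S. (\<lambda>h. \<Psi> ` ({z \<in> X. K (inv\<^bsub>L\<^esub> p) z = h} \<inter> X)) ` range (K (inv\<^bsub>L\<^esub> p)))"
  have R: "finite R" "R \<subseteq> sets N"
  proof -
    show "finite R" unfolding R_def using P'(1) S finite_K by auto
    show "R \<subseteq> sets N" unfolding R_def using P'(2) S K_sets \<Psi>_image_sets by auto
  qed
  show ?thesis
  proof (rule B.max_sofic_entropy_ge[OF H R])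
    fix RS F and \<delta> :: real
    assume RS: "finite RS" "RS \<subseteq> sets N" and F: "finite F" "F \<subseteq> carrier H" and \<delta>: "\<delta> > 0"
    \<comment> \<open>\<open>F\<close> and its products serve multiplicativity; the remaining
      elements are all possible discrepancies along \<open>S\<close>, to which \<open>I\<close> is
      applied in \<open>shift\<close>.\<close>
    define T where "T = F \<union> (\<lambda>(t, t'). t \<otimes>\<^bsub>H\<^esub> t') ` (F \<times> F) \<union>
        (\<Union>p\<in>S. (\<lambda>(h, h'). inv\<^bsub>H\<^esub> h \<otimes>\<^bsub>H\<^esub> h') ` (K p ` X \<times> K p ` X))"
    have KX: "K p ` X \<subseteq> carrier H" "finite (K p ` X)" if "p \<in> carrier L" for p
      using K_closed that finite_subset[OF _ finite_K[OF that], of "K p ` X"] by auto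
    have T: "finite T" "T \<subseteq> carrier H"
    proof -
      show "finite T" unfolding T_def using F S KX(2) by (auto intro!: finite_cartesian_product)
      have "inv\<^bsub>H\<^esub> K p z \<otimes>\<^bsub>H\<^esub> K p w \<in> carrier H" if "p \<in> S" "z \<in> X" "w \<in> X" for p z w
        using K_closed S(2) that by auto
      then show "T \<subseteq> carrier H" using F(2) by (auto simp: T_def)
    qed
    have FT: "F \<subseteq> T" "\<And>t t'. t \<in> F \<Longrightarrow> t' \<in> F \<Longrightarrow> t \<otimes>\<^bsub>H\<^esub> t' \<in> T" by (auto simp: T_def)
    have dT: "discrepancy z w p \<in> T" if "p \<in> S" "z \<in> X" "w \<in> X" for p z w
      unfolding T_def discrepancy_def
      using that by (intro UnI2 UN_I[of p] image_case_prodI[of _ _ _ _ "\<lambda>h h'. inv\<^bsub>H\<^esub> h \<otimes>\<^bsub>H\<^esub> h'"]) auto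
    define J where "J = (\<Union>t\<in>T. I t ` X)"
    have J: "finite J" "J \<subseteq> carrier L" unfolding J_def using T finite_I I_closed by auto
    \<comment> \<open>All displacements made by elements of \<open>T\<close>, with the quotients
      that occur in the two injectivity proofs.\<close>
    define Q' where "Q' = J \<union> (\<lambda>(r, r'). inv\<^bsub>L\<^esub> r \<otimes>\<^bsub>L\<^esub> r') ` (J \<times> J)"
    have Q': "finite Q'" "Q' \<subseteq> carrier L" unfolding Q'_def using J by auto
    have IT: "I t z \<in> Q'" if "t \<in> T" "z \<in> X" for t z using that by (auto simp: Q'_def J_def)
    have IIT: "inv\<^bsub>L\<^esub> (I t z) \<otimes>\<^bsub>L\<^esub> I t' w \<in> Q'" if "t \<in> T" "t' \<in> T" "z \<in> X" "w \<in> X" for t t' z w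
      unfolding Q'_def J_def
      using that by (intro UnI2 image_case_prodI[of _ _ _ _ "\<lambda>r r'. inv\<^bsub>L\<^esub> r \<otimes>\<^bsub>L\<^esub> r'"]) auto
    \<comment> \<open>The displacements whose discrepancies are compared in
      \<open>coherent\<close>.\<close>
    define Q0 where "Q0 = S \<union> (\<lambda>(p, g). p \<otimes>\<^bsub>L\<^esub> g) ` (S \<times> Q')"
    have Q0: "finite Q0" "Q0 \<subseteq> carrier L" unfolding Q0_def using S Q' by auto
    define P1 where "P1 = pr1 ` Q0"
    define P2 where "P2 = pr2 ` Q0"
    have P12: "finite P1" "P1 \<subseteq> carrier G" "finite P2" "P2 \<subseteq> carrier C"
      using Q0 pr_closed by (auto simp: P1_def P2_def)
    have SP: "pr1 p \<in> P1 \<and> pr2 p \<in> P2" if "p \<in> S" for p using that by (auto simp: P1_def P2_def Q0_def)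
    have SQP: "pr1 (p \<otimes>\<^bsub>L\<^esub> g) \<in> P1 \<and> pr2 (p \<otimes>\<^bsub>L\<^esub> g) \<in> P2" if "p \<in> S" "g \<in> Q'" for p g
      using that image_case_prodI[of p S g Q' "\<lambda>p g. p \<otimes>\<^bsub>L\<^esub> g"] unfolding P1_def P2_def Q0_def by blast

    \<comment> \<open>These edges depend on \<open>F\<close> through \<open>P1\<close>, so they are
      too many to be prescribed over \<open>B\<close>; their number fixes how sparse
      \<open>B'\<close> has to be.\<close>
    define T3 where "T3 = (\<lambda>(g, g'). g' \<otimes>\<^bsub>G\<^esub> inv\<^bsub>G\<^esub> g) ` (P1 \<times> P1)"
    have T3: "finite T3" "T3 \<subseteq> carrier G" using P12 by (auto simp: T3_def)
    define \<kappa>3 where "\<kappa>3 = real (card (\<Pi>\<^sub>E g\<in>T3. range (K (mk g \<one>\<^bsub>C\<^esub>))))"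
    obtain m3 where m3: "m3 \<ge> 1" "\<And>n. n \<ge> m3 \<Longrightarrow> ln \<kappa>3 * (2 / real n) \<le> e1"
      using ex_degree[OF e1, of "ln \<kappa>3"] by blast
    obtain E3 where E3: "E3 \<subseteq> carrier C" "finite E3" "card E3 = m3"
      using infinite_arbitrarily_large[OF infC] by blast
    define F' where "F' = (\<lambda>(e, e'). inv\<^bsub>C\<^esub> e' \<otimes>\<^bsub>C\<^esub> e) ` (E3 \<times> E3)"
    have F': "finite F'" "F' \<subseteq> carrier C" using E3 by (auto simp: F'_def)
    define R2 where "R2 = P2 \<union> (\<lambda>(f, c). f \<otimes>\<^bsub>C\<^esub> c) ` (F' \<times> P2)"
    have R2: "finite R2" "R2 \<subseteq> carrier C" using P12 F' by (auto simp: R2_def)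
    define T2 where "T2 = (\<lambda>(c, c'). c' \<otimes>\<^bsub>C\<^esub> inv\<^bsub>C\<^esub> c) ` (R2 \<times> R2)"
    have T2: "finite T2" "T2 \<subseteq> carrier C" using R2 by (auto simp: T2_def)
    define \<kappa>2 where "\<kappa>2 = real (card (\<Pi>\<^sub>E c\<in>T2. range (K (mk \<one>\<^bsub>G\<^esub> c))))"
    obtain m2 where m2: "m2 \<ge> 1" "\<And>n. n \<ge> m2 \<Longrightarrow> ln \<kappa>2 * (2 / real n) \<le> e1"
      using ex_degree[OF e1, of "ln \<kappa>2"] by blast
    \<comment> \<open>The density of \<open>A\<close> is governed by the size of a ball, and its
      elements must be \<open>S0\<close>-words. A quotient of two of them has length at most
      \<open>n0 + n0\<close>, hence \<open>m\<close>.\<close>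
    obtain n0 where n0: "m2 \<le> card (G.word_ball S0 n0)"
      using G.word_ball_unbounded[OF S0] by blast
    define m where "m = n0 + n0"
    have ball: "finite (G.word_ball S0 j)" "G.word_ball S0 j \<subseteq> carrier G" for j
      by (rule G.finite_word_ball[OF S0(1)], rule G.word_ball_closed[OF S0(2)])

    define S' where "S' = S \<union> m_inv L ` S"
    have S': "finite S'" "S' \<subseteq> carrier L" using S by (auto simp: S'_def)
    define Q1 where "Q1 = G.word_ball S0 m \<union> S0 \<union> T3 \<union> (\<lambda>(k, g). k \<otimes>\<^bsub>G\<^esub> g) ` (G.word_ball S0 m \<times> P1) \<union> pr1 ` (Q' \<union> S')"
    define Q2 where "Q2 = R2 \<union> F' \<union> T2 \<union> {\<one>\<^bsub>C\<^esub>} \<union> pr2 ` (Q' \<union> S')"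
    have Q12: "finite Q1" "Q1 \<subseteq> carrier G" "finite Q2" "Q2 \<subseteq> carrier C"
    proof -
      show "finite Q1" unfolding Q1_def using ball S0 T3 P12 Q' S' by auto
      have "k \<otimes>\<^bsub>G\<^esub> g \<in> carrier G" if "k \<in> G.word_ball S0 m" "g \<in> P1" for k g
        using that ball(2) P12(2) by blast
      then show "Q1 \<subseteq> carrier G" unfolding Q1_def using ball(2)[of m] S0 T3 Q' S' pr_closed by auto
      show "finite Q2" unfolding Q2_def using R2 F' T2 Q' S' by auto
      show "Q2 \<subseteq> carrier C" unfolding Q2_def using R2 F' T2 Q' S' pr_closed by auto
    qed
    define Q where "Q = (\<lambda>(g, c). mk g c) ` (Q1 \<times> Q2)"
    have Q: "finite Q" "Q \<subseteq> carrier L" unfolding Q_def using Q12 mk_closed by auto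
    have Q'S': "Q' \<union> S' \<subseteq> Q"
    proof
      fix l assume l: "l \<in> Q' \<union> S'"
      then have "l = mk (pr1 l) (pr2 l)" using Q' S' mk_pr by auto
      moreover have "pr1 l \<in> Q1" "pr2 l \<in> Q2" using l by (auto simp: Q1_def Q2_def)
      ultimately show "l \<in> Q" unfolding Q_def by force
    qed

    define \<N> where "\<N> = (\<lambda>A. {z \<in> X. \<Psi> z \<in> A}) ` RS"
    define \<S> where "\<S> = insert X \<N> \<union> (\<Union>l\<in>Q. (\<lambda>h. {w \<in> X. K l w = h}) ` range (K l)) \<union>
        (\<Union>t\<in>T. (\<lambda>l. {w \<in> X. I t w = l}) ` (I t ` X))"
    have \<S>fin: "finite \<S>" unfolding \<S>_def \<N>_def using RS Q T finite_K finite_I by auto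
    have \<S>sets: "\<S> \<subseteq> sets M"
    proof -
      have "{w \<in> X. K l w = h} \<in> sets M" if "l \<in> Q" for l h using K_sets Q that by auto
      moreover have "{w \<in> X. I t w = l} \<in> sets M" if "t \<in> T" for t l using I_sets T that by auto
      moreover have "{z \<in> X. \<Psi> z \<in> A} \<in> sets M" if "A \<in> RS" for A using \<Psi>_sets RS that by auto
      ultimately show ?thesis unfolding \<S>_def \<N>_def using X_sets by blast
    qed
    have \<S>mem: "X \<in> \<S>" "\<N> \<subseteq> \<S>" "\<And>l z. l \<in> Q \<Longrightarrow> z \<in> X \<Longrightarrow> {w \<in> X. K l w = K l z} \<in> \<S>"
      "\<And>t z. t \<in> T \<Longrightarrow> z \<in> X \<Longrightarrow> {w \<in> X. I t w = I t z} \<in> \<S>"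
      unfolding \<S>_def by blast+

    \<comment> \<open>The term \<open>z\<close> in the Hamming bound uses
      \<open>\<epsilon> / 4\<close>; the logarithmic term will get the other quarter.\<close>
    define z where "z = min 1 (\<epsilon> / 4)"
    have z: "0 < z" "z \<le> 1" "z \<le> \<epsilon> / 4" using \<epsilon> by (auto simp: z_def)
    define \<Lambda> where "\<Lambda> = ln (2 ^ card P / z)"
    have "1 \<le> 2 ^ card P / z" using z by (simp add: pos_le_divide_eq order_trans[OF z(2)])
    then have \<Lambda>: "\<Lambda> \<ge> 0" by (simp add: \<Lambda>_def)
    \<comment> \<open>The first bound serves \<open>5 * \<tau>'\<close> and
      \<open>\<tau>' + \<delta>m\<close>. The second makes
      \<open>3 * \<tau>' * (1 + real (card S)) * \<Lambda>\<close> at most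
      \<open>\<epsilon> / 4\<close>; adding one to \<open>\<Lambda>\<close> allows it to
      vanish.\<close>
    define \<tau>' where "\<tau>' = min (\<delta> / 10) (\<epsilon> / (12 * (1 + real (card S)) * (\<Lambda> + 1)))"
    have cS: "1 + real (card S) > 0" by (simp add: add_pos_nonneg)
    have \<tau>'pos: "\<tau>' > 0" using \<delta> \<epsilon> \<Lambda> cS by (simp add: \<tau>'_def)
    have "\<tau>' \<le> \<delta> / 10" unfolding \<tau>'_def by (rule min.cobounded1)
    then have \<tau>'\<delta>: "10 * \<tau>' \<le> \<delta>" by simp
    have e2: "3 * \<tau>' * (1 + real (card S)) * ln (2 ^ card P / z) + z \<le> \<epsilon> / 2"
    proof -
      have "\<tau>' \<le> \<epsilon> / (12 * (1 + real (card S)) * (\<Lambda> + 1))"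
        unfolding \<tau>'_def by (rule min.cobounded2)
      then have "\<tau>' * (12 * (1 + real (card S)) * (\<Lambda> + 1)) \<le> \<epsilon>"
        using cS \<Lambda> by (simp add: pos_le_divide_eq)
      moreover have "\<tau>' * (12 * (1 + real (card S)) * \<Lambda>) \<le> \<tau>' * (12 * (1 + real (card S)) * (\<Lambda> + 1))"
        using \<tau>'pos cS \<Lambda> by (intro mult_left_mono) auto
      ultimately have "12 * (\<tau>' * (1 + real (card S)) * \<Lambda>) \<le> \<epsilon>" by (simp only: mult.assoc mult.left_commute[of 12])
      then show ?thesis using z(3) unfolding \<Lambda>_def[symmetric] by linarith
    qed
    \<comment> \<open>Half of \<open>\<tau>'\<close> is for inconsistent vertices, the other half
      for the \<open>card Q + 1\<close> errors in \<open>card_not_good\<close>.\<close>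
    define \<delta>m where "\<delta>m = \<tau>' / (2 * (real (card Q) + 1))"
    have \<delta>m: "\<delta>m > 0" "(real (card Q) + 1) * \<delta>m = \<tau>' / 2" "\<delta>m \<le> \<tau>'"
      using \<tau>'pos by (auto simp: \<delta>m_def field_simps add_pos_nonneg)

    have balls_ne: "G.word_ball S0 n0 \<noteq> {}" using G.one_in_word_ball by blast
    have ev: "\<forall>\<^sub>F k in sequentially.
        real (card (inconsistent L Q (U k) (\<sigma> k))) \<le> \<tau>' / 2 * real (card (U k)) \<and>
        (\<forall>V0\<subseteq>W k. \<exists>A\<subseteq>V0. real (card A) \<le> 2 / real (card E1) * real (card (W k)) \<and>
           (\<forall>v\<in>V0. v \<in> A \<or> (\<exists>e\<in>E1. \<exists>e'\<in>E1. \<omega> k (inv\<^bsub>C\<^esub> e' \<otimes>\<^bsub>C\<^esub> e) v \<in> A))) \<and>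
        (\<forall>V0\<subseteq>W k. \<exists>A\<subseteq>V0. real (card A) \<le> 2 / real (card E3) * real (card (W k)) \<and>
           (\<forall>v\<in>V0. v \<in> A \<or> (\<exists>e\<in>E3. \<exists>e'\<in>E3. \<omega> k (inv\<^bsub>C\<^esub> e' \<otimes>\<^bsub>C\<^esub> e) v \<in> A))) \<and>
        (\<forall>V0\<subseteq>V k. \<exists>A\<subseteq>V0. real (card A) \<le> 2 / real (card (G.word_ball S0 n0)) * real (card (V k)) \<and>
           (\<forall>v\<in>V0. v \<in> A \<or> (\<exists>e\<in>G.word_ball S0 n0. \<exists>e'\<in>G.word_ball S0 n0. \<tau> k (inv\<^bsub>G\<^esub> e' \<otimes>\<^bsub>G\<^esub> e) v \<in> A)))"
    proof (intro eventually_conj)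
      show "\<forall>\<^sub>F k in sequentially. real (card (inconsistent L Q (U k) (\<sigma> k))) \<le> \<tau>' / 2 * real (card (U k))"
        by (rule eventually_few_inconsistent[OF seqL Q]) (use \<tau>'pos in simp)
      have ne: "E1 \<noteq> {}" "E3 \<noteq> {}" using E1 E3 m1 m3 by auto
      show "\<forall>\<^sub>F k in sequentially. \<forall>V0\<subseteq>W k. \<exists>A\<subseteq>V0. real (card A) \<le> 2 / real (card E1) * real (card (W k)) \<and>
           (\<forall>v\<in>V0. v \<in> A \<or> (\<exists>e\<in>E1. \<exists>e'\<in>E1. \<omega> k (inv\<^bsub>C\<^esub> e' \<otimes>\<^bsub>C\<^esub> e) v \<in> A))"
        "\<forall>\<^sub>F k in sequentially. \<forall>V0\<subseteq>W k. \<exists>A\<subseteq>V0. real (card A) \<le> 2 / real (card E3) * real (card (W k)) \<and>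
           (\<forall>v\<in>V0. v \<in> A \<or> (\<exists>e\<in>E3. \<exists>e'\<in>E3. \<omega> k (inv\<^bsub>C\<^esub> e' \<otimes>\<^bsub>C\<^esub> e) v \<in> A))"
        by (rule C.eventually_sparse_syndetic_subset[OF seqC E1(2) ne(1) E1(1)],
            rule C.eventually_sparse_syndetic_subset[OF seqC E3(2) ne(2) E3(1)])
      show "\<forall>\<^sub>F k in sequentially. \<forall>V0\<subseteq>V k. \<exists>A\<subseteq>V0. real (card A) \<le> 2 / real (card (G.word_ball S0 n0)) * real (card (V k)) \<and>
           (\<forall>v\<in>V0. v \<in> A \<or> (\<exists>e\<in>G.word_ball S0 n0. \<exists>e'\<in>G.word_ball S0 n0. \<tau> k (inv\<^bsub>G\<^esub> e' \<otimes>\<^bsub>G\<^esub> e) v \<in> A))"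
        by (rule G.eventually_sparse_syndetic_subset[OF seqG ball(1) balls_ne ball(2)])
    qed
    \<comment> \<open>Many microstates are available for infinitely many \<open>k\<close>,
      everything else for all large \<open>k\<close>, so some \<open>k\<close> meets all
      demands.\<close>
    obtain k where
      k: "exp (c * real (card (U k))) \<le> real (card (names (U k) P ` microstates M \<alpha> \<S> Q \<delta>m (U k) (\<sigma> k)))"
      and inc: "real (card (inconsistent L Q (U k) (\<sigma> k))) \<le> \<tau>' / 2 * real (card (U k))"
      and k1: "\<forall>V0\<subseteq>W k. \<exists>A\<subseteq>V0. real (card A) \<le> 2 / real (card E1) * real (card (W k)) \<and>
           (\<forall>v\<in>V0. v \<in> A \<or> (\<exists>e\<in>E1. \<exists>e'\<in>E1. \<omega> k (inv\<^bsub>C\<^esub> e' \<otimes>\<^bsub>C\<^esub> e) v \<in> A))"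
      and k3: "\<forall>V0\<subseteq>W k. \<exists>A\<subseteq>V0. real (card A) \<le> 2 / real (card E3) * real (card (W k)) \<and>
           (\<forall>v\<in>V0. v \<in> A \<or> (\<exists>e\<in>E3. \<exists>e'\<in>E3. \<omega> k (inv\<^bsub>C\<^esub> e' \<otimes>\<^bsub>C\<^esub> e) v \<in> A))"
      and k2: "\<forall>V0\<subseteq>V k. \<exists>A\<subseteq>V0. real (card A) \<le> 2 / real (card (G.word_ball S0 n0)) * real (card (V k)) \<and>
           (\<forall>v\<in>V0. v \<in> A \<or> (\<exists>e\<in>G.word_ball S0 n0. \<exists>e'\<in>G.word_ball S0 n0. \<tau> k (inv\<^bsub>G\<^esub> e' \<otimes>\<^bsub>G\<^esub> e) v \<in> A))"
      by (rule exE[OF frequently_ex[OF frequently_eventually_conj[OF freq[OF \<S>fin \<S>sets Q \<delta>m(1)] ev]]],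
          elim conjE, rule that)

    have sofV: "sofic_approximation G (V k) (\<tau> k)" and sofW: "sofic_approximation C (W k) (\<omega> k)"
      using seqG seqC by (auto simp: sofic_approximation_sequence_def)
    have fin: "finite (V k)" "finite (W k)" "finite (U k)" "U k \<noteq> {}"
      using sofV sofW by (auto simp: sofic_approximation_def U_def)
    have cU: "real (card (U k)) = real (card (V k)) * real (card (W k))"
      by (simp add: U_def card_prod_encode_image card_cartesian_product)
    obtain B where B: "B \<subseteq> W k" "real (card B) \<le> 2 / real (card E1) * real (card (W k))"
      "\<And>w. w \<in> W k \<Longrightarrow> w \<in> B \<or> (\<exists>e\<in>E1. \<exists>e'\<in>E1. \<omega> k (inv\<^bsub>C\<^esub> e' \<otimes>\<^bsub>C\<^esub> e) w \<in> B)"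
      using k1[rule_format, OF subset_refl] by blast
    obtain B' where B': "B' \<subseteq> B" "real (card B') \<le> 2 / real (card E3) * real (card (W k))"
      "\<And>w. w \<in> B \<Longrightarrow> w \<in> B' \<or> (\<exists>e\<in>E3. \<exists>e'\<in>E3. \<omega> k (inv\<^bsub>C\<^esub> e' \<otimes>\<^bsub>C\<^esub> e) w \<in> B')"
      using k3[rule_format, OF B(1)] by blast
    obtain A where A: "A \<subseteq> V k" "real (card A) \<le> 2 / real (card (G.word_ball S0 n0)) * real (card (V k))"
      "\<And>v. v \<in> V k \<Longrightarrow> v \<in> A \<or> (\<exists>e\<in>G.word_ball S0 n0. \<exists>e'\<in>G.word_ball S0 n0. \<tau> k (inv\<^bsub>G\<^esub> e' \<otimes>\<^bsub>G\<^esub> e) v \<in> A)"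
      using k2[rule_format, OF subset_refl] by blast
    define pv where "pv u = fst (prod_decode u)" for u
    define pw where "pw u = snd (prod_decode u)" for u
    have "\<forall>w\<in>W k. \<exists>c. c \<in> insert \<one>\<^bsub>C\<^esub> F1 \<and> (w \<in> B \<longrightarrow> c = \<one>\<^bsub>C\<^esub>) \<and> (w \<notin> B \<longrightarrow> \<omega> k c w \<in> B)"
    proof
      fix w assume w: "w \<in> W k"
      show "\<exists>c. c \<in> insert \<one>\<^bsub>C\<^esub> F1 \<and> (w \<in> B \<longrightarrow> c = \<one>\<^bsub>C\<^esub>) \<and> (w \<notin> B \<longrightarrow> \<omega> k c w \<in> B)"
      proof (cases "w \<in> B")
        case False
        then obtain e e' where "e \<in> E1" "e' \<in> E1" "\<omega> k (inv\<^bsub>C\<^esub> e' \<otimes>\<^bsub>C\<^esub> e) w \<in> B" using B(3)[OF w] by blast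
        then show ?thesis using False by (intro exI[of _ "inv\<^bsub>C\<^esub> e' \<otimes>\<^bsub>C\<^esub> e"]) (auto simp: F1_def)
      qed auto
    qed
    then obtain sC where sC: "\<And>w. w \<in> W k \<Longrightarrow> sC w \<in> insert \<one>\<^bsub>C\<^esub> F1"
      "\<And>w. w \<in> W k \<Longrightarrow> w \<in> B \<Longrightarrow> sC w = \<one>\<^bsub>C\<^esub>" "\<And>w. w \<in> W k \<Longrightarrow> w \<notin> B \<Longrightarrow> \<omega> k (sC w) w \<in> B"
      by metis
    define s where "s u = mk \<one>\<^bsub>G\<^esub> (sC (pw u))" for u
    have pvw: "pv u \<in> V k" "pw u \<in> W k" if "u \<in> U k" for u using that by (auto simp: U_def pv_def pw_def)
    have p\<sigma>: "pv (\<sigma> k l u) = \<tau> k (pr1 l) (pv u)" "pw (\<sigma> k l u) = \<omega> k (pr2 l) (pw u)" if "u \<in> U k" for l u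
      using that by (auto simp: U_def pv_def pw_def \<sigma>_def product_model_encode)
    have sW: "sC (pw u) \<in> carrier C" if "u \<in> U k" for u using sC(1)[OF pvw(2)[OF that]] F1 by auto

    interpret SO: sparse_oe_model G C L M \<alpha> H N \<beta> X K I \<Psi> "U k" "\<sigma> k" Q Q' S T \<N> s pr1 pr2 mk
      "V k" "W k" "\<tau> k" "\<omega> k" pv pw A B B' S0 m P1 Q1 T3 P2 R2 Q2 T2 F'
    proof unfold_locales
      show "finite (U k)" "U k \<noteq> {}" by fact+
      show "\<sigma> k l permutes U k" if "l \<in> carrier L" for l using sofL[of k] that by (simp add: sofic_approximation_def)
      show "Q \<subseteq> carrier L" "finite Q" "T \<subseteq> carrier H" "\<one>\<^bsub>L\<^esub> \<in> S" by fact+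
      show "Q' \<subseteq> Q" "S \<subseteq> Q" using Q'S' by (auto simp: S'_def)
      show "inv\<^bsub>L\<^esub> p \<in> Q" if "p \<in> S" for p using Q'S' that by (auto simp: S'_def)
      show "I t z \<in> Q'" if "t \<in> T" "z \<in> X" for t z by (rule IT[OF that])
      show "inv\<^bsub>L\<^esub> (I t z) \<otimes>\<^bsub>L\<^esub> I t' w \<in> Q'" if "t \<in> T" "t' \<in> T" "z \<in> X" "w \<in> X" for t t' z w by (rule IIT[OF that])
      show "discrepancy z w p \<in> T" if "p \<in> S" "z \<in> X" "w \<in> X" for p z w by (rule dT[OF that])
      show "s u \<in> S" if "u \<in> U k" for u using sC(1)[OF pvw(2)[OF that]] by (auto simp: s_def S_def)
      show "pv u \<in> V k" "pw u \<in> W k" if "u \<in> U k" for u using pvw[OF that] by auto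
      show "pv (\<sigma> k l u) = \<tau> k (pr1 l) (pv u)" "pw (\<sigma> k l u) = \<omega> k (pr2 l) (pw u)" if "l \<in> carrier L" "u \<in> U k" for l u
        using p\<sigma>[OF that(2)] by auto
      show "Q = (\<lambda>(g, c). mk g c) ` (Q1 \<times> Q2)" by (rule Q_def)
      show "Q1 \<subseteq> carrier G" "Q2 \<subseteq> carrier C" "P1 \<subseteq> carrier G" "finite S0" "finite T2" "finite T3" by fact+
      show "S0 \<subseteq> Q1" "G.word_ball S0 m \<subseteq> Q1" "T3 \<subseteq> Q1" by (auto simp: Q1_def)
      show "k' \<otimes>\<^bsub>G\<^esub> g \<in> Q1" if "k' \<in> G.word_ball S0 m" "g \<in> P1" for k' g
        using that image_case_prodI[of k' "G.word_ball S0 m" g P1 "\<lambda>k g. k \<otimes>\<^bsub>G\<^esub> g"] unfolding Q1_def by blast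
      show "g' \<otimes>\<^bsub>G\<^esub> inv\<^bsub>G\<^esub> g \<in> T3" if "g \<in> P1" "g' \<in> P1" for g g'
        using that image_case_prodI[of g P1 g' P1 "\<lambda>g g'. g' \<otimes>\<^bsub>G\<^esub> inv\<^bsub>G\<^esub> g"] unfolding T3_def by blast
      show "P2 \<subseteq> R2" by (simp add: R2_def)
      show "R2 \<subseteq> Q2" "F' \<subseteq> Q2" "T2 \<subseteq> Q2" "\<one>\<^bsub>C\<^esub> \<in> Q2" by (auto simp: Q2_def)
      show "f \<otimes>\<^bsub>C\<^esub> c \<in> R2" if "f \<in> F'" "c \<in> P2" for f c
        using that image_case_prodI[of f F' c P2 "\<lambda>f c. f \<otimes>\<^bsub>C\<^esub> c"] unfolding R2_def by blast
      show "c' \<otimes>\<^bsub>C\<^esub> inv\<^bsub>C\<^esub> c \<in> T2" if "c \<in> R2" "c' \<in> R2" for c c'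
        using that image_case_prodI[of c R2 c' R2 "\<lambda>c c'. c' \<otimes>\<^bsub>C\<^esub> inv\<^bsub>C\<^esub> c"] unfolding T2_def by blast
      show "v \<in> A \<or> (\<exists>k'\<in>G.word_ball S0 m. \<tau> k k' v \<in> A)" if "v \<in> V k" for v
      proof -
        have "inv\<^bsub>G\<^esub> e' \<otimes>\<^bsub>G\<^esub> e \<in> G.word_ball S0 m" if "e \<in> G.word_ball S0 n0" "e' \<in> G.word_ball S0 n0" for e e'
          unfolding m_def by (intro G.word_ball_mult G.word_ball_inv S0 that)
        then show ?thesis using A(3)[OF that] by blast
      qed
      show "B' \<subseteq> B" by fact
      show "w \<in> B' \<or> (\<exists>f\<in>F'. \<omega> k f w \<in> B')" if "w \<in> B" for w
      proof -
        have "inv\<^bsub>C\<^esub> e' \<otimes>\<^bsub>C\<^esub> e \<in> F'" if "e \<in> E3" "e' \<in> E3" for e e'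
          using that image_case_prodI[of e E3 e' E3 "\<lambda>e e'. inv\<^bsub>C\<^esub> e' \<otimes>\<^bsub>C\<^esub> e"] unfolding F'_def by blast
        then show ?thesis using B'(3)[OF that] by blast
      qed
      show "s u = \<one>\<^bsub>L\<^esub>" if "u \<in> U k" "pw u \<in> B" for u using sC(2)[OF pvw(2)] that mk_one by (simp add: s_def)
      show "\<omega> k (pr2 (s u)) (pw u) \<in> B" if "u \<in> U k" "pw u \<notin> B" for u
        using sC(3)[OF pvw(2)] that pr_mk(2)[OF G.one_closed sW] by (simp add: s_def)
      show "pr1 p \<in> P1 \<and> pr2 p \<in> P2" if "p \<in> S" for p by (rule SP[OF that])
      show "pr1 (p \<otimes>\<^bsub>L\<^esub> g) \<in> P1 \<and> pr2 (p \<otimes>\<^bsub>L\<^esub> g) \<in> P2" if "p \<in> S" "g \<in> Q'" for p g by (rule SQP[OF that])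
    qed

    define Y where "Y = microstates M \<alpha> \<S> Q \<delta>m (U k) (\<sigma> k)"
    \<comment> \<open>One microstate is kept for each name, so that counting names becomes counting
      microstates.\<close>
    obtain \<X> where \<X>: "\<X> \<subseteq> Y" "inj_on (names (U k) P) \<X>" "names (U k) P ` \<X> = names (U k) P ` Y"
      using subset_image_inj[of "names (U k) P ` Y" "names (U k) P" Y] by auto
    have finim: "finite (names (U k) P ` \<X>)" by (rule finite_names_image[OF fin(3) P'(1)])
    have \<X>fin: "finite \<X>" using finite_imageD[OF finim \<X>(2)] .
    have large: "exp (c * real (card (U k))) \<le> real (card \<X>)"
      using k card_image[OF \<X>(2)] \<X>(3) by (simp add: Y_def)
    let ?n = "real (card (U k))"
    have dat: "real (card (SO.data ` \<X>)) \<le> exp (\<epsilon> / 2 * ?n)"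
    proof -
      have UB: "real (card {u \<in> U k. pw u \<in> D}) \<le> 2 / d * ?n" if "D \<subseteq> W k" "real (card D) \<le> 2 / d * real (card (W k))" for D d
      proof -
        have "{u \<in> U k. pw u \<in> D} = prod_encode ` (V k \<times> D)" using that(1) by (auto simp: U_def pw_def)
        then have "real (card {u \<in> U k. pw u \<in> D}) = real (card (V k)) * real (card D)"
          by (simp add: card_prod_encode_image card_cartesian_product)
        also have "\<dots> \<le> real (card (V k)) * (2 / d * real (card (W k)))" using that(2) by (intro mult_left_mono) auto
        finally show ?thesis by (simp add: cU mult.left_commute)
      qed
      have UA: "real (card {u \<in> U k. pv u \<in> D}) \<le> 2 / d * ?n" if "D \<subseteq> V k" "real (card D) \<le> 2 / d * real (card (V k))" for D d
      proof -
        have "{u \<in> U k. pv u \<in> D} = prod_encode ` (D \<times> W k)" using that(1) by (auto simp: U_def pv_def)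
        then have "real (card {u \<in> U k. pv u \<in> D}) = real (card D) * real (card (W k))"
          by (simp add: card_prod_encode_image card_cartesian_product)
        also have "\<dots> \<le> (2 / d * real (card (V k))) * real (card (W k))" using that(2) by (intro mult_right_mono) auto
        finally show ?thesis by (simp add: cU mult.assoc)
      qed
      have "real (card (SO.data ` \<X>)) \<le> \<kappa>1 ^ card {u \<in> U k. pw u \<in> B} * \<kappa>2 ^ card {u \<in> U k. pv u \<in> A} * \<kappa>3 ^ card {u \<in> U k. pw u \<in> B'}"
        using SO.card_data[of \<X>] unfolding \<kappa>1_def \<kappa>2_def \<kappa>3_def by (simp flip: of_nat_power of_nat_mult)
      also have "\<dots> \<le> exp (e1 * ?n) * exp (e1 * ?n) * exp (e1 * ?n)"
      proof (intro mult_mono)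
        show "\<kappa>1 ^ card {u \<in> U k. pw u \<in> B} \<le> exp (e1 * ?n)"
        proof (rule power_le_exp_sparse)
          show "\<kappa>1 \<ge> 1" unfolding \<kappa>1_def by (rule card_K_functions[OF S0(1)]) (use S0 in \<open>auto intro: mk_closed\<close>)
          show "real (card {u \<in> U k. pw u \<in> B}) \<le> 2 / real (card E1) * ?n" by (rule UB[OF B(1,2)])
          show "ln \<kappa>1 * (2 / real (card E1)) \<le> e1" using m1 E1(3) by simp
        qed simp
        show "\<kappa>2 ^ card {u \<in> U k. pv u \<in> A} \<le> exp (e1 * ?n)"
        proof (rule power_le_exp_sparse)
          show "\<kappa>2 \<ge> 1" unfolding \<kappa>2_def by (rule card_K_functions[OF T2(1)]) (use T2 in \<open>auto intro: mk_closed\<close>)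
          show "real (card {u \<in> U k. pv u \<in> A}) \<le> 2 / real (card (G.word_ball S0 n0)) * ?n" by (rule UA[OF A(1,2)])
          show "ln \<kappa>2 * (2 / real (card (G.word_ball S0 n0))) \<le> e1" by (rule m2(2)[OF n0])
        qed simp
        show "\<kappa>3 ^ card {u \<in> U k. pw u \<in> B'} \<le> exp (e1 * ?n)"
        proof (rule power_le_exp_sparse)
          show "\<kappa>3 \<ge> 1" unfolding \<kappa>3_def by (rule card_K_functions[OF T3(1)]) (use T3 in \<open>auto intro: mk_closed\<close>)
          show "real (card {u \<in> U k. pw u \<in> B'}) \<le> 2 / real (card E3) * ?n" by (rule UB[OF subset_trans[OF B'(1) B(1)] B'(2)])
          show "ln \<kappa>3 * (2 / real (card E3)) \<le> e1" using m3 E3(3) by simp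
        qed simp
      qed (simp_all add: \<kappa>1_def \<kappa>2_def \<kappa>3_def)
      also have "\<dots> = exp (\<epsilon> / 2 * ?n)" by (simp add: exp_add[symmetric] e1_def field_simps)
      finally show ?thesis .
    qed
    have "\<exists>\<rho>. sofic_approximation H (U k) \<rho> \<and> good_approximation H F \<delta> (U k) \<rho> \<and>
        exp ((c - \<epsilon> / 2 - \<epsilon> / 2) * ?n) \<le> real (card (names (U k) R ` microstates N \<beta> RS F \<delta> (U k) \<rho>))"
    proof (rule SO.ex_action_many_microstates[OF \<X>(1)[unfolded Y_def] \<X>fin \<X>(2) \<S>mem inc])
      show "\<tau>' / 2 + (real (card Q) + 1) * \<delta>m \<le> \<tau>'" using \<delta>m(2) by simp
      show "5 * \<tau>' \<le> \<delta>" "\<tau>' + \<delta>m \<le> \<delta>" "0 \<le> \<tau>'" using \<tau>'\<delta> \<tau>'pos \<delta>m(3) by linarith+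
      show "RS \<subseteq> sets N" "F \<subseteq> T" "finite P" "finite R" "0 < z" "z \<le> 1" by fact+
      show "{z \<in> X. \<Psi> z \<in> A} \<in> \<N>" if "A \<in> RS" for A using that by (auto simp: \<N>_def)
      show "t \<otimes>\<^bsub>H\<^esub> t' \<in> T" if "t \<in> F" "t' \<in> F" for t t' by (rule FT(2)[OF that])
      show "\<Psi> ` (A \<inter> X) \<in> R" if "A \<in> P" for A using that unfolding R_def by blast
      show "\<Psi> ` ({z \<in> X. K (inv\<^bsub>L\<^esub> q) z = h} \<inter> X) \<in> R" if "q \<in> S" "h \<in> range (K (inv\<^bsub>L\<^esub> q))" for q h
        using that unfolding R_def by blast
    qed (assumption | fact dat e2 large)+
    moreover have "c - \<epsilon> / 2 - \<epsilon> / 2 = c - \<epsilon>" by simp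
    ultimately show "\<exists>(V::nat set) \<sigma>. sofic_approximation H V \<sigma> \<and> good_approximation H F \<delta> V \<sigma> \<and>
        exp ((c - \<epsilon>) * real (card V)) \<le> real (card (names V R ` microstates N \<beta> RS F \<delta> V \<sigma>))"
      by (intro exI[of _ "U k"]) (simp only:)
  qed
qed

text \<open>Any one product sequence bounds the infimum from above. A finite set witnessing the
  failure of local finiteness is made symmetric, so that inverses of words are words.\<close>

lemma max_sofic_entropy_ge_inf:
  assumes G: "sofic_group G" and C: "sofic_group C" "infinite (carrier C)"
    and nlf: "\<not> locally_finite_group G" and H: "countable (carrier H)"
  shows "inf_sofic_entropy L M \<alpha> \<le> max_sofic_entropy H N \<beta>"
proof -
  obtain V \<tau> where seqG: "sofic_approximation_sequence G V \<tau>" using G by (auto simp: sofic_group_def)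
  obtain W \<omega> where seqC: "sofic_approximation_sequence C W \<omega>" using C by (auto simp: sofic_group_def)
  let ?U = "\<lambda>k. prod_encode ` (V k \<times> W k)" and ?\<sigma> = "\<lambda>k. product_model pr1 pr2 (V k) (W k) (\<tau> k) (\<omega> k)"
  have seqL: "sofic_approximation_sequence L ?U ?\<sigma>" by (rule sofic_approximation_sequence_product[OF seqG seqC])
  obtain S where S: "finite S" "S \<subseteq> carrier G" "infinite (generate G S)"
    using nlf by (auto simp: locally_finite_group_def)
  define S0 where "S0 = S \<union> m_inv G ` S"
  have S0: "finite S0" "S0 \<subseteq> carrier G" "\<And>g. g \<in> S0 \<Longrightarrow> inv\<^bsub>G\<^esub> g \<in> S0"
    using S by (auto simp: S0_def)
  have "generate G S \<subseteq> generate G S0" by (rule G.mono_generate) (simp add: S0_def)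
  then have inf: "infinite (generate G S0)" using S(3) finite_subset by blast
  have "inf_sofic_entropy L M \<alpha> \<le> sofic_entropy L M \<alpha> ?U ?\<sigma>"
    using seqL by (auto simp: inf_sofic_entropy_def sofic_group_def intro!: INF_lower2[of "(?U, ?\<sigma>)"])
  \<comment> \<open>The entropy may be infinite; it is approached from below by real numbers
    \<open>c\<close>, and the loss is made arbitrarily small afterwards.\<close>
  also have "\<dots> \<le> max_sofic_entropy H N \<beta>"
  proof (rule dense_le)
    fix y :: ereal assume y: "y < sofic_entropy L M \<alpha> ?U ?\<sigma>"
    then obtain c where c: "y < ereal c" "ereal c < sofic_entropy L M \<alpha> ?U ?\<sigma>"
      using ereal_dense2 by blast
    have "ereal c \<le> max_sofic_entropy H N \<beta>"
    proof (rule ereal_le_epsilon2)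
      fix e :: real assume "e > 0"
      have "ereal (c - e) \<le> max_sofic_entropy H N \<beta>"
        by (rule max_sofic_entropy_ge_product[OF seqG seqC C(2) S0 inf H c(2) \<open>e > 0\<close>])
      then have "ereal (c - e) + ereal e \<le> max_sofic_entropy H N \<beta> + ereal e" by (rule add_right_mono)
      then show "ereal c \<le> max_sofic_entropy H N \<beta> + ereal e" by simp
    qed
    then show "y \<le> max_sofic_entropy H N \<beta>" using c(1) by simp
  qed
  finally show ?thesis .
qed

end

theorem theorem1:
  fixes G :: "('g, 'm) monoid_scheme" and \<Gamma> :: "('c, 'n) monoid_scheme"
    and H :: "('h, 'k) monoid_scheme"
    and M :: "'x measure" and \<alpha> :: "'g \<times> 'c \<Rightarrow> 'x \<Rightarrow> 'x"
    and N :: "'y measure" and \<beta> :: "'h \<Rightarrow> 'y \<Rightarrow> 'y"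
  assumes "group G" "countable (carrier G)" "infinite (carrier G)" "sofic_group G"
    and "group \<Gamma>" "countable (carrier \<Gamma>)" "infinite (carrier \<Gamma>)" "sofic_group \<Gamma>"
    and "\<not> locally_finite_group G \<or> \<not> locally_finite_group \<Gamma>"
    and "group H" "countable (carrier H)"
    and "free_pmp_action (G \<times>\<times> \<Gamma>) M \<alpha>"
    and "free_pmp_action H N \<beta>"
    and "boundedly_orbit_equivalent (G \<times>\<times> \<Gamma>) M \<alpha> H N \<beta>"
    and "uniquely_ergodic H N \<beta>"
  shows "max_sofic_entropy H N \<beta> \<ge> inf_sofic_entropy (G \<times>\<times> \<Gamma>) M \<alpha>"
proof -
  interpret G: group G by fact
  interpret \<Gamma>: group \<Gamma> by fact
  interpret GG: group "G \<times>\<times> \<Gamma>" by (rule DirProd_group) fact+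
  have "countable (carrier (G \<times>\<times> \<Gamma>))" using assms(2,6) by simp
  then obtain X K I \<Psi> where oe: "bounded_oe (G \<times>\<times> \<Gamma>) M \<alpha> H N \<beta> X K I \<Psi>"
    using boundedly_orbit_equivalent_cocycles assms(12-14) by metis
  interpret O: bounded_oe "G \<times>\<times> \<Gamma>" M \<alpha> H N \<beta> X K I \<Psi> by (rule oe)
  \<comment> \<open>The factor that is not locally finite takes the role of the first one. In the
    second case only the coordinate maps are exchanged, while the acting group remains the
    same.\<close>
  from assms(9) show ?thesis
  proof
    assume nlf: "\<not> locally_finite_group G"
    interpret product_oe G \<Gamma> "G \<times>\<times> \<Gamma>" M \<alpha> H N \<beta> X K I \<Psi> fst snd Pair
      by unfold_locales auto
    show ?thesis by (rule max_sofic_entropy_ge_inf[OF assms(4,8,7) nlf assms(11)])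
  next
    assume nlf: "\<not> locally_finite_group \<Gamma>"
    interpret product_oe \<Gamma> G "G \<times>\<times> \<Gamma>" M \<alpha> H N \<beta> X K I \<Psi> snd fst "\<lambda>c g. (g, c)"
      by unfold_locales auto
    show ?thesis by (rule max_sofic_entropy_ge_inf[OF assms(8,4,3) nlf assms(11)])
  qed
qed

end
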